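(* Let $M^{+}$ and $M^{-}$ be smooth $n$-dimensional manifolds, let $c \in C^{2}(M^{+}\times M^{-})$ be real-valued, and let $\mu^{+}$ and $\mu^{-}$ be compactly supported Borel probability measures on $M^{+}$ and $M^{-}$ respectively. Let $\gamma$ be a solution of the Kantorovich problem with cost $c$ and marginals $\mu^{+},\mu^{-}$. Suppose $(x_0,y_0)\in \operatorname{spt}(\gamma)$ and $c$ is non-degenerate at $(x_0,y_0)$. Then there is a neighbourhood $N$ of $(x_0,y_0)$ in $M^{+}\times M^{-}$ such that $N\cap \operatorname{spt}(\gamma)$ is contained in an $n$-dimensional Lipschitz submanifold of $M^{+}\times M^{-}$. In particular, if $D^{2}_{xy}c$ is nonsingular everywhere on $M^{+}\times M^{-}$, then $\operatorname{spt}(\gamma)$ is contained in an $n$-dimensional Lipschitz submanifold of $M^{+}\times M^{-}$.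
   Context: Kantorovich problem: given Borel probability measures $\mu^{\pm}$ on $M^{\pm}$ and a cost $c:M^{+}\times M^{-}\to\mathbf{R}$, minimize $\int_{M^{+}\times M^{-}} c(x,y)\,d\gamma(x,y)$ among all measures $\gamma$ on $M^{+}\times M^{-}$ whose marginals are $\mu^{+}$ and $\mu^{-}$, i.e. $\gamma(A\times M^{-})=\mu^{+}(A)$ and $\gamma(M^{+}\times B)=\mu^{-}(B)$ for all Borel $A\subset M^{+}$, $B\subset M^{-}$. A solution is a minimizer. $D^{2}_{xy}c(x_0,y_0)$ denotes the $n\times n$ matrix of mixed second order partial derivatives of $c$ at $(x_0,y_0)$ in local coordinates, with $(i,j)$ entry $\frac{\partial^{2}c}{\partial x^{i}\partial y^{j}}(x_0,y_0)$. The cost $c\in C^2(M^+\times M^-)$ is non-degenerate at $(x_0,y_0)$ if $\det D^{2}_{xy}c(x_0,y_0)\neq 0$ (this does not depend on the choice of local coordinates on $M^{+}$ and $M^{-}$). $\operatorname{spt}(\gamma)$ is the smallest closed set $S\subseteq M^{+}\times M^{-}$ with $\gamma(S)=1$. An $n$-dimensional Lipschitz submanifold is understood in the usual sense: a subset which near each of its points is, in suitable smooth local coordinates $(u,v)\in\mathbf{R}^n\times\mathbf{R}^n$ of $M^{+}\times M^{-}$, the graph of a Lipschitz function $v=v(u)$. *)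

theory Defs
  imports "HOL-Probability.Probability"
begin

text \<open>
  A manifold is a Hausdorff second countable type together with a smooth atlas modelled on a
  Euclidean space.  A chart is a pair of a domain and a coordinate map; the map is only relevant
  on the domain.
\<close>

type_synonym ('a, 'e) chart = "'a set \<times> ('a \<Rightarrow> 'e)"

abbreviation chart_dom :: "('a, 'e) chart \<Rightarrow> 'a set" where
  "chart_dom \<equiv> fst"

abbreviation chart_map :: "('a, 'e) chart \<Rightarrow> 'a \<Rightarrow> 'e" where
  "chart_map \<equiv> snd"

abbreviation chart_cod :: "('a, 'e) chart \<Rightarrow> 'e set" where
  "chart_cod \<kappa> \<equiv> chart_map \<kappa> ` chart_dom \<kappa>"

definition chart_inv :: "('a, 'e) chart \<Rightarrow> 'e \<Rightarrow> 'a" where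
  "chart_inv \<kappa> = the_inv_into (chart_dom \<kappa>) (chart_map \<kappa>)"

definition is_chart :: "('a::topological_space, 'e::euclidean_space) chart \<Rightarrow> bool" where
  "is_chart \<kappa> \<longleftrightarrow> open (chart_dom \<kappa>) \<and> open (chart_cod \<kappa>) \<and>
     homeomorphism (chart_dom \<kappa>) (chart_cod \<kappa>) (chart_map \<kappa>) (chart_inv \<kappa>)"

text \<open>
  The predicate below is only meant for open \<open>S\<close>.  In finite dimension, continuity of
  \<open>x \<mapsto> Df(x)\<close> is continuity of \<open>x \<mapsto> Df(x) v\<close> for each fixed direction \<open>v\<close>, so that this is the
  usual notion of a \<open>k\<close> times continuously differentiable function.
\<close>

primrec Ck_on :: "nat \<Rightarrow> 'e::euclidean_space set \<Rightarrow> ('e \<Rightarrow> 'f::real_normed_vector) \<Rightarrow> bool" where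
  "Ck_on 0 S f \<longleftrightarrow> continuous_on S f"
| "Ck_on (Suc k) S f \<longleftrightarrow> (\<forall>x\<in>S. f differentiable (at x)) \<and>
     (\<forall>v. Ck_on k S (\<lambda>x. frechet_derivative f (at x) v))"

definition smooth_on :: "'e::euclidean_space set \<Rightarrow> ('e \<Rightarrow> 'f::real_normed_vector) \<Rightarrow> bool" where
  "smooth_on S f \<longleftrightarrow> (\<forall>k. Ck_on k S f)"

definition smooth_compat ::
  "('a, 'e::euclidean_space) chart \<Rightarrow> ('a, 'e) chart \<Rightarrow> bool" where
  "smooth_compat \<kappa> \<eta> \<longleftrightarrow>
     smooth_on (chart_map \<kappa> ` (chart_dom \<kappa> \<inter> chart_dom \<eta>)) (chart_map \<eta> \<circ> chart_inv \<kappa>) \<and>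
     smooth_on (chart_map \<eta> ` (chart_dom \<kappa> \<inter> chart_dom \<eta>)) (chart_map \<kappa> \<circ> chart_inv \<eta>)"

definition smooth_atlas :: "('a::topological_space, 'e::euclidean_space) chart set \<Rightarrow> bool" where
  "smooth_atlas \<A> \<longleftrightarrow> (\<forall>\<kappa>\<in>\<A>. is_chart \<kappa>) \<and> (\<Union>\<kappa>\<in>\<A>. chart_dom \<kappa>) = UNIV \<and>
     (\<forall>\<kappa>\<in>\<A>. \<forall>\<eta>\<in>\<A>. smooth_compat \<kappa> \<eta>)"

text \<open>The maximal atlas, that is, all smooth local coordinate systems.\<close>

definition smooth_charts ::
  "('a::topological_space, 'e::euclidean_space) chart set \<Rightarrow> ('a, 'e) chart set" where
  "smooth_charts \<A> = {\<kappa>. is_chart \<kappa> \<and> (\<forall>\<eta>\<in>\<A>. smooth_compat \<kappa> \<eta>)}"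

definition prod_chart :: "('a, 'e) chart \<Rightarrow> ('b, 'f) chart \<Rightarrow> ('a \<times> 'b, 'e \<times> 'f) chart" where
  "prod_chart \<kappa> \<eta> = (chart_dom \<kappa> \<times> chart_dom \<eta>, map_prod (chart_map \<kappa>) (chart_map \<eta>))"

definition prod_atlas ::
  "('a, 'e) chart set \<Rightarrow> ('b, 'f) chart set \<Rightarrow> ('a \<times> 'b, 'e \<times> 'f) chart set" where
  "prod_atlas \<A> \<B> = {prod_chart \<kappa> \<eta> | \<kappa> \<eta>. \<kappa> \<in> \<A> \<and> \<eta> \<in> \<B>}"

definition Ck_function ::
  "nat \<Rightarrow> ('a, 'e::euclidean_space) chart set \<Rightarrow> ('a \<Rightarrow> real) \<Rightarrow> bool" where
  "Ck_function k \<A> f \<longleftrightarrow> (\<forall>\<kappa>\<in>\<A>. Ck_on k (chart_cod \<kappa>) (f \<circ> chart_inv \<kappa>))"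

definition mixed_hessian ::
  "('a, real ^ 'n) chart \<Rightarrow> ('b, real ^ 'n) chart \<Rightarrow> ('a \<times> 'b \<Rightarrow> real) \<Rightarrow> 'a \<Rightarrow> 'b
     \<Rightarrow> real ^ 'n ^ 'n" where
  "mixed_hessian \<kappa> \<eta> c x y =
     (\<chi> i j. deriv (\<lambda>s. deriv (\<lambda>t. c (chart_inv \<kappa> (chart_map \<kappa> x + s *\<^sub>R axis i 1),
                                      chart_inv \<eta> (chart_map \<eta> y + t *\<^sub>R axis j 1))) 0) 0)"

text \<open>
  By the chain rule the choice of charts around \<open>x\<close> and \<open>y\<close> is immaterial for a \<open>C\<^sup>2\<close> cost:
  a change of charts multiplies the matrix on both sides by invertible Jacobians.
\<close>

definition nondegenerate_at ::
  "('a, real ^ 'n) chart set \<Rightarrow> ('b, real ^ 'n) chart set \<Rightarrow> ('a \<times> 'b \<Rightarrow> real)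
     \<Rightarrow> 'a \<Rightarrow> 'b \<Rightarrow> bool" where
  "nondegenerate_at \<A> \<B> c x y \<longleftrightarrow>
     (\<exists>\<kappa>\<in>\<A>. \<exists>\<eta>\<in>\<B>. x \<in> chart_dom \<kappa> \<and> y \<in> chart_dom \<eta> \<and> det (mixed_hessian \<kappa> \<eta> c x y) \<noteq> 0)"

definition borel_prob :: "'a::topological_space measure \<Rightarrow> bool" where
  "borel_prob \<mu> \<longleftrightarrow> prob_space \<mu> \<and> sets \<mu> = sets borel"

text \<open>
  On a second countable space the intersection below has full measure itself, hence it is the
  smallest closed set of full measure of a Borel probability measure.
\<close>

definition spt :: "'a::topological_space measure \<Rightarrow> 'a set" where
  "spt \<mu> = \<Inter>{S. closed S \<and> emeasure \<mu> S = 1}"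

definition has_marginals ::
  "'a::topological_space measure \<Rightarrow> 'b::topological_space measure \<Rightarrow> ('a \<times> 'b) measure \<Rightarrow> bool" where
  "has_marginals \<mu> \<nu> \<gamma> \<longleftrightarrow> sets \<gamma> = sets borel \<and>
     (\<forall>A\<in>sets borel. emeasure \<gamma> (A \<times> UNIV) = emeasure \<mu> A) \<and>
     (\<forall>B\<in>sets borel. emeasure \<gamma> (UNIV \<times> B) = emeasure \<nu> B)"

text \<open>
  If \<open>c\<close> is continuous and the marginals have compact support, then \<open>c\<close> is integrable with respect
  to every competitor, so the value \<open>0\<close> of the integral of a non-integrable function plays no role.
\<close>

definition kantorovich_solution ::
  "('a::topological_space \<times> 'b::topological_space \<Rightarrow> real) \<Rightarrow> 'a measure \<Rightarrow> 'b measure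
     \<Rightarrow> ('a \<times> 'b) measure \<Rightarrow> bool" where
  "kantorovich_solution c \<mu> \<nu> \<gamma> \<longleftrightarrow> has_marginals \<mu> \<nu> \<gamma> \<and>
     (\<forall>\<gamma>'. has_marginals \<mu> \<nu> \<gamma>' \<longrightarrow> integral\<^sup>L \<gamma> c \<le> integral\<^sup>L \<gamma>' c)"

text \<open>
  In a manifold of dimension \<open>2n\<close> modelled on \<open>\<real>\<^sup>n \<times> \<real>\<^sup>n\<close>: near each of its points the set is, in
  some smooth chart with coordinates \<open>(u, v)\<close>, exactly the graph of a Lipschitz function \<open>v = f u\<close>
  over an open set of \<open>\<real>\<^sup>n\<close>.  Openness of the set of parameters \<open>u\<close> is what makes the dimension
  equal to \<open>n\<close>.
\<close>

definition lipschitz_submanifold ::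
  "('p::topological_space, (real ^ 'n) \<times> (real ^ 'n)) chart set \<Rightarrow> 'p set \<Rightarrow> bool" where
  "lipschitz_submanifold \<A> S \<longleftrightarrow>
     (\<forall>p\<in>S. \<exists>\<kappa>\<in>smooth_charts \<A>. p \<in> chart_dom \<kappa> \<and>
        (\<exists>D f L. open D \<and> L-lipschitz_on D f \<and>
           chart_map \<kappa> ` (S \<inter> chart_dom \<kappa>) = {(u, f u) | u. u \<in> D}))"

end

theory Submission
  imports Defs
begin

text \<open>
  The support of an optimal plan is \<open>c\<close>-cyclically monotone, so Rockafellar's construction gives a
  function \<open>\<psi>\<close> on \<open>M\<^sup>-\<close> such that \<open>\<psi> + c (x, \<cdot>)\<close> is minimal at \<open>y\<close> for all \<open>(x, y)\<close> in the support.
  As a supremum of functions \<open>t - c (x, \<cdot>)\<close> with \<open>x\<close> in a compact set, \<open>\<psi>\<close> is locally semiconvex: in a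
  chart, \<open>F v = \<psi> v + \<Lambda> |v|\<^sup>2\<close> is convex.  The support lies in the contact set
  \<open>{(x, y). P (x, y) \<in> \<partial>F y}\<close> with \<open>P (x, y) = 2 \<Lambda> y - D\<^sub>y c (x, y)\<close>.  By Minty's parametrization
  this says \<open>y = J (y + P (x, y))\<close> with the nonexpansive resolvent \<open>J = (id + \<partial>F)\<^sup>-\<^sup>1\<close>.  In the linear
  coordinates \<open>u = y + DP (x, y)\<close>, \<open>v = y\<close>, which are admissible by nondegeneracy, it becomes
  \<open>v = J (u + R (u, v))\<close> with \<open>R\<close> of small Lipschitz constant, and the contraction principle solves
  for \<open>v\<close> as a Lipschitz function of \<open>u\<close>.  The contact set is defined globally, so no gluing of
  local submanifolds is needed.
\<close>

section \<open>Subgradients and their resolvents\<close>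

text \<open>A Lipschitz submanifold is here an exact graph over an open parameter set, which a
  subset of a graph, such as the support, need not be. So the support is enlarged until it fills a
  graph. Global minimality of \<open>\<psi> + c (x, \<cdot>)\<close> at \<open>y\<close> is too
  rigid for that: a subgradient in a chart carries only local information about
  \<open>\<psi>\<close>. The contact set keeps the first-order part, which by convexity of
  \<open>F\<close> is equivalent to the subgradient inclusion; and since the resolvent is defined on
  a whole ball, each \<open>u\<close> near the base point then has a solution \<open>v\<close>. The
  correction \<open>2 \<Lambda> y\<close> does not involve \<open>x\<close>, so the derivative of
  \<open>P\<close> in \<open>x\<close> is minus the mixed Hessian whatever \<open>\<Lambda>\<close>
  is. \<open>P\<close> is continuously differentiable, hence strictly differentiable at the base
  point, and this is what makes the Lipschitz constant of \<open>R\<close> small on a small ball.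
  Compactness of the support of \<open>\<mu>\<close> does double duty: it makes
  \<open>\<psi>\<close> finite everywhere and \<open>\<Lambda>\<close> uniform in
  \<open>x\<close>.\<close>

definition subgradient :: "'e::real_inner set \<Rightarrow> ('e \<Rightarrow> real) \<Rightarrow> 'e \<Rightarrow> 'e \<Rightarrow> bool" where
  "subgradient C F y \<xi> \<longleftrightarrow> (\<forall>z\<in>C. F y + \<xi> \<bullet> (z - y) \<le> F z)"

text \<open>Along the segment, convexity keeps \<open>F\<close> below its chord, so dividing an
  estimate with error \<open>\<epsilon> * t\<close> by \<open>t\<close> turns it into one at the far
  end. This promotes first-order information, of a minimizer or of a Frechet subgradient, to a whole
  convex set.\<close>

lemma convex_on_directional_subgradient:
  assumes F: "convex_on C F" and "y \<in> C" "z \<in> C"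
    and ev: "\<And>\<epsilon>. \<epsilon> > 0 \<Longrightarrow>
      \<forall>\<^sub>F t in at_right 0. F y + t * (\<xi> \<bullet> (z - y)) - \<epsilon> * t \<le> F (y + t *\<^sub>R (z - y))"
  shows "F y + \<xi> \<bullet> (z - y) \<le> F z"
proof (rule field_le_epsilon)
  fix \<epsilon> :: real
  assume "\<epsilon> > 0"
  have "\<forall>\<^sub>F t in at_right 0. t \<in> {0<..<1::real}"
    by (rule eventually_at_right_real) simp
  from eventually_conj[OF this ev[OF \<open>\<epsilon> > 0\<close>]] obtain t where t: "0 < t" "t < 1"
    and le: "F y + t * (\<xi> \<bullet> (z - y)) - \<epsilon> * t \<le> F (y + t *\<^sub>R (z - y))"
    by (auto dest!: eventually_happens'[OF trivial_limit_at_right_real])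
  have "y + t *\<^sub>R (z - y) = (1 - t) *\<^sub>R y + t *\<^sub>R z"
    by (simp add: algebra_simps)
  then have "F (y + t *\<^sub>R (z - y)) \<le> (1 - t) * F y + t * F z"
    using convex_onD[OF F, of t y z] t assms(2,3) by simp
  with le have "t * (F y + \<xi> \<bullet> (z - y) - \<epsilon> - F z) \<le> 0"
    by (simp add: algebra_simps)
  then show "F y + \<xi> \<bullet> (z - y) \<le> F z + \<epsilon>"
    using t by (simp add: mult_le_0_iff)
qed

text \<open>\<open>subgradient C F y (w - y)\<close> means that \<open>y\<close> is the resolvent
  value at \<open>w\<close>. Adding the two inequalities cancels \<open>F\<close> and leaves
  monotonicity, and Cauchy-Schwarz does the rest.\<close>

lemma subgradient_resolvent_nonexpansive:
  assumes "subgradient C F y (w - y)" "subgradient C F y' (w' - y')" "y \<in> C" "y' \<in> C"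
  shows "norm (y - y') \<le> norm (w - w')"
proof -
  have "F y + (w - y) \<bullet> (y' - y) \<le> F y'" "F y' + (w' - y') \<bullet> (y - y') \<le> F y"
    using assms by (auto simp: subgradient_def)
  then have "(y - y') \<bullet> (y - y') \<le> (w - w') \<bullet> (y - y')"
    by (simp add: inner_diff inner_commute)
  also have "\<dots> \<le> norm (w - w') * norm (y - y')"
    by (rule norm_cauchy_schwarz)
  finally have "norm (y - y') * norm (y - y') \<le> norm (w - w') * norm (y - y')"
    by (simp add: dot_square_norm power2_eq_square)
  then show ?thesis
    by (cases "norm (y - y') = 0") (auto simp: mult_le_cancel_right)
qed

text \<open>The resolvent value is the minimizer of \<open>F z + norm (z - w) ^ 2 / 2\<close>. As
  \<open>F\<close> is controlled only on an open ball, the minimum is taken over a smaller closed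
  ball; comparison with \<open>y0\<close>, which is the resolvent value at
  \<open>y0 + \<xi>0\<close>, keeps the minimizer off the boundary.\<close>

lemma subgradient_resolvent_exists:
  fixes F :: "'e::euclidean_space \<Rightarrow> real"
  assumes F: "convex_on (ball y0 r) F" and \<xi>0: "subgradient (ball y0 r) F y0 \<xi>0"
    and w: "norm (w - (y0 + \<xi>0)) < r"
  obtains y where "norm (y - y0) \<le> norm (w - (y0 + \<xi>0))" "subgradient (ball y0 r) F y (w - y)"
proof -
  obtain s where s: "norm (w - (y0 + \<xi>0)) < s" "s < r"
    using w dense by blast
  have "0 < s"
    using s(1) norm_ge_zero[of "w - (y0 + \<xi>0)"] by linarith
  have sub: "cball y0 s \<subseteq> ball y0 r"
    using s by auto
  have "continuous_on (cball y0 s) (\<lambda>z. F z + norm (z - w) ^ 2 / 2)"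
    using convex_on_continuous[OF open_ball F] sub
    by (intro continuous_intros) (auto intro: continuous_on_subset)
  then obtain y where y: "y \<in> cball y0 s"
    and min: "\<And>z. z \<in> cball y0 s \<Longrightarrow> F y + norm (y - w) ^ 2 / 2 \<le> F z + norm (z - w) ^ 2 / 2"
    using continuous_attains_inf[of "cball y0 s" "\<lambda>z. F z + norm (z - w) ^ 2 / 2"] \<open>0 < s\<close> by auto
  \<comment> \<open>First-order condition at the minimizer, in any direction that does not leave the
    closed ball at once. Toward the centre \<open>y0\<close> this holds even from the boundary; the
    other directions must wait until \<open>y\<close> is known to be interior.\<close>
  have variational: "F y + (w - y) \<bullet> (z - y) \<le> F z"
    if z: "z \<in> ball y0 r" and ev: "\<forall>\<^sub>F t in at_right 0. y + t *\<^sub>R (z - y) \<in> cball y0 s" for z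
  proof (rule convex_on_directional_subgradient[OF F _ z])
    show "y \<in> ball y0 r"
      using y sub by auto
    fix \<epsilon> :: real
    assume "\<epsilon> > 0"
    have "((\<lambda>t. t * (norm (z - y) ^ 2 / 2)) \<longlongrightarrow> 0 * (norm (z - y) ^ 2 / 2)) (at_right 0)"
      by (intro tendsto_intros)
    then have "\<forall>\<^sub>F t in at_right 0. t * (norm (z - y) ^ 2 / 2) < \<epsilon>"
      using \<open>\<epsilon> > 0\<close> by (auto dest: order_tendstoD(2))
    moreover have "\<forall>\<^sub>F t in at_right (0::real). t > 0"
      by (simp add: eventually_at_right_less)
    ultimately show "\<forall>\<^sub>F t in at_right 0. F y + t * ((w - y) \<bullet> (z - y)) - \<epsilon> * t \<le> F (y + t *\<^sub>R (z - y))"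
      using ev
    proof eventually_elim
      case (elim t)
      have "norm (y + t *\<^sub>R (z - y) - w) ^ 2
          = norm (y - w) ^ 2 - 2 * t * ((w - y) \<bullet> (z - y)) + t ^ 2 * norm (z - y) ^ 2"
        unfolding power2_norm_eq_inner
        by (simp add: inner_diff_left inner_diff_right inner_add_left inner_add_right inner_commute
            algebra_simps power2_eq_square)
      then have "F y + t * ((w - y) \<bullet> (z - y)) - t * (t * (norm (z - y) ^ 2 / 2)) \<le> F (y + t *\<^sub>R (z - y))"
        using min[OF elim(3)] by (simp add: power2_eq_square field_simps)
      moreover have "t * (t * (norm (z - y) ^ 2 / 2)) \<le> t * \<epsilon>"
        using elim by (intro mult_left_mono) auto
      ultimately show ?case
        by (simp add: mult.commute)
    qed
  qed
  have "y + t *\<^sub>R (y0 - y) \<in> cball y0 s" if "0 < t" "t < 1" for t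
  proof -
    have "y + t *\<^sub>R (y0 - y) = (1 - t) *\<^sub>R y + t *\<^sub>R y0"
      by (simp add: algebra_simps)
    also have "\<dots> \<in> cball y0 s"
      by (rule convexD[OF convex_cball y]) (use that \<open>0 < s\<close> in auto)
    finally show ?thesis .
  qed
  then have "\<forall>\<^sub>F t in at_right 0. y + t *\<^sub>R (y0 - y) \<in> cball y0 s"
    using eventually_at_right_real[of 0 1] by (auto elim: eventually_mono)
  then have "F y + (w - y) \<bullet> (y0 - y) \<le> F y0"
    using \<open>0 < s\<close> s by (intro variational) auto
  \<comment> \<open>So far the inequality at \<open>y\<close> is known only in the direction of
    \<open>y0\<close>, hence the two-point set.\<close>
  then have "subgradient {y, y0} F y (w - y)" "subgradient {y, y0} F y0 \<xi>0"
    using \<xi>0 y sub by (auto simp: subgradient_def)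
  then have near: "norm (y - y0) \<le> norm (w - (y0 + \<xi>0))"
    using subgradient_resolvent_nonexpansive[of "{y, y0}" F y w y0 "y0 + \<xi>0"] by simp
  have "subgradient (ball y0 r) F y (w - y)"
    unfolding subgradient_def
  proof (intro ballI variational)
    fix z
    have "((\<lambda>t. y + t *\<^sub>R (z - y)) \<longlongrightarrow> y + 0 *\<^sub>R (z - y)) (at_right 0)"
      by (intro tendsto_intros)
    moreover have "y \<in> ball y0 s"
      using near s by (simp add: dist_norm norm_minus_commute)
    ultimately have "\<forall>\<^sub>F t in at_right 0. y + t *\<^sub>R (z - y) \<in> ball y0 s"
      by (intro topological_tendstoD) auto
    then show "\<forall>\<^sub>F t in at_right 0. y + t *\<^sub>R (z - y) \<in> cball y0 s"
      by eventually_elim auto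
  qed
  with near show ?thesis
    by (rule that)
qed

text \<open>\<open>strict\<close> is strict differentiability of \<open>P\<close> at the base point
  with derivative \<open>A\<close>, and \<open>A_inj\<close> is nondegeneracy: it makes
  \<open>z \<mapsto> (snd z + A z, snd z)\<close> invertible. Contraction yields a solution for
  every \<open>u\<close> in a ball, hence an open \<open>D\<close>, and uniqueness shows that no
  further points of the relation lie in \<open>W\<close>.\<close>

lemma subgradient_relation_lipschitz_graph:
  fixes P A :: "'e::euclidean_space \<times> 'e \<Rightarrow> 'e"
  assumes F: "convex_on (ball y0 r) F"
    and sub0: "subgradient (ball y0 r) F y0 (P (x0, y0))" and "0 < r"
    and A: "linear A" and A_inj: "\<And>x. A (x, 0) = 0 \<Longrightarrow> x = 0"
    and strict: "\<And>\<epsilon>. \<epsilon> > 0 \<Longrightarrow> \<exists>\<delta>>0. \<forall>z\<in>ball (x0, y0) \<delta>. \<forall>z'\<in>ball (x0, y0) \<delta>.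
                   norm (P z - P z' - A (z - z')) \<le> \<epsilon> * norm (z - z')"
    and N: "open N" "(x0, y0) \<in> N"
  obtains \<Phi> :: "'e \<times> 'e \<Rightarrow> 'e \<times> 'e" and W D f L
  where "linear \<Phi>" "inj \<Phi>" "open W" "(x0, y0) \<in> W" "W \<subseteq> N" "open D" "L-lipschitz_on D f"
    "\<Phi> ` {(x, y) \<in> W. y \<in> ball y0 r \<and> subgradient (ball y0 r) F y (P (x, y))} = {(u, f u) |u. u \<in> D}"
proof -
  define \<Phi> where "\<Phi> z = (snd z + A z, snd z)" for z
  have \<Phi>: "linear \<Phi>"
    unfolding \<Phi>_def by (rule linearI) (simp_all add: linear_add[OF A] linear_scale[OF A] scaleR_right_distrib)
  have inj: "inj \<Phi>"
    using A_inj by (auto simp: linear_injective_0[OF \<Phi>] \<Phi>_def zero_prod_def)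
  from linear_injective_isomorphism[OF \<Phi> inj] obtain \<Psi> where \<Psi>: "linear \<Psi>"
    and \<Psi>\<Phi>: "\<And>z. \<Psi> (\<Phi> z) = z" and \<Phi>\<Psi>: "\<And>p. \<Phi> (\<Psi> p) = p"
    by blast
  obtain B where B: "B > 0" "\<And>p. norm (\<Psi> p) \<le> B * norm p"
    using linear_bounded_pos[OF \<Psi>] by blast
  \<comment> \<open>\<open>B\<close> bounds the inverse coordinate change, so this tolerance makes
    the remainder \<open>R\<close> 1/4-Lipschitz in \<open>(u, v)\<close>.\<close>
  obtain \<delta> where \<delta>: "\<delta> > 0" and strict\<delta>: "\<And>z z'. z \<in> ball (x0, y0) \<delta> \<Longrightarrow> z' \<in> ball (x0, y0) \<delta> \<Longrightarrow>
      norm (P z - P z' - A (z - z')) \<le> 1 / (4 * B) * norm (z - z')"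
    using strict[of "1 / (4 * B)"] B(1) by (metis divide_pos_pos mult_pos_pos zero_less_numeral zero_less_one)
  define V where "V = \<Psi> -` (N \<inter> ball (x0, y0) \<delta>)"
  define u0 where "u0 = y0 + A (x0, y0)"
  have p0: "\<Phi> (x0, y0) = (u0, y0)"
    by (simp add: \<Phi>_def u0_def)
  then have \<Psi>0: "\<Psi> (u0, y0) = (x0, y0)"
    using \<Psi>\<Phi> by metis
  have "continuous_on UNIV \<Psi>"
    using \<Psi> by (simp add: linear_continuous_on linear_conv_bounded_linear)
  then have "open V"
    unfolding V_def using N by (intro open_vimage) auto
  moreover have "(u0, y0) \<in> V"
    using N \<delta> \<Psi>0 by (simp add: V_def)
  ultimately obtain \<rho>0 where \<rho>0: "\<rho>0 > 0" "cball (u0, y0) \<rho>0 \<subseteq> V"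
    using open_contains_cball by blast
  define \<rho> where "\<rho> = min (\<rho>0 / 2) (r / 2)"
  have \<rho>: "0 < \<rho>" "\<rho> < r" "2 * \<rho> \<le> \<rho>0"
    using \<rho>0 \<open>0 < r\<close> by (auto simp: \<rho>_def)
  have inV: "\<Psi> (u, v) \<in> N \<inter> ball (x0, y0) \<delta>" if "norm (u - u0) \<le> \<rho>" "norm (v - y0) \<le> \<rho>" for u v
  proof -
    have "norm ((u, v) - (u0, y0)) \<le> norm (u - u0) + norm (v - y0)"
      using norm_Pair_le[of "u - u0" "v - y0"] by simp
    then have "(u, v) \<in> cball (u0, y0) \<rho>0"
      using that \<rho> by (simp only: mem_cball dist_norm norm_minus_commute)
    with \<rho>0 show ?thesis
      unfolding V_def by auto
  qed
  \<comment> \<open>In the coordinates \<open>p = (u, v)\<close> the relation reads \<open>v = J (u + R p)\<close> with the resolvent \<open>J\<close>.\<close>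
  define R where "R p = P (\<Psi> p) + snd p - fst p" for p
  have snd\<Psi>: "snd (\<Psi> (u, v)) = v" for u v
    using \<Phi>\<Psi>[of "(u, v)"] by (simp add: \<Phi>_def)
  have A\<Psi>: "A (\<Psi> (u, v)) = u - v" for u v
    using \<Phi>\<Psi>[of "(u, v)"] by (auto simp: \<Phi>_def algebra_simps)
  \<comment> \<open>\<open>A (\<Psi> (u, v)) = u - v\<close>, so \<open>R\<close> is
    \<open>P - A\<close> in the new coordinates and its increments are the error terms of strict
    differentiability.\<close>
  have R_lip: "norm (R (u, v) - R (u', v')) \<le> (norm (u - u') + norm (v - v')) / 4"
    if "norm (u - u0) \<le> \<rho>" "norm (v - y0) \<le> \<rho>" "norm (u' - u0) \<le> \<rho>" "norm (v' - y0) \<le> \<rho>"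
    for u v u' v'
  proof -
    have "R (u, v) - R (u', v') = P (\<Psi> (u, v)) - P (\<Psi> (u', v')) - A (\<Psi> (u, v) - \<Psi> (u', v'))"
      by (simp add: R_def linear_diff[OF A] A\<Psi>)
    then have "norm (R (u, v) - R (u', v')) \<le> 1 / (4 * B) * norm (\<Psi> (u, v) - \<Psi> (u', v'))"
      using strict\<delta>[of "\<Psi> (u, v)" "\<Psi> (u', v')"] inV[of u v] inV[of u' v'] that by simp
    also have "\<dots> \<le> 1 / (4 * B) * (B * norm ((u, v) - (u', v')))"
      using B(2)[of "(u, v) - (u', v')"] B(1) unfolding linear_diff[OF \<Psi>, symmetric]
      by (intro mult_left_mono) auto
    also have "\<dots> \<le> (norm (u - u') + norm (v - v')) / 4"
      using B(1) norm_Pair_le[of "u - u'" "v - v'"] by simp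
    finally show ?thesis .
  qed
  define w where "w u v = u + R (u, v)" for u v
  have w_alt: "w u v = v + P (\<Psi> (u, v))" for u v
    by (simp add: w_def R_def)
  have w_lip: "norm (w u v - w u' v') \<le> 5 / 4 * norm (u - u') + norm (v - v') / 4"
    if "norm (u - u0) \<le> \<rho>" "norm (v - y0) \<le> \<rho>" "norm (u' - u0) \<le> \<rho>" "norm (v' - y0) \<le> \<rho>"
    for u v u' v'
  proof -
    have "norm (w u v - w u' v') \<le> norm (u - u') + norm (R (u, v) - R (u', v'))"
      using norm_triangle_ineq[of "u - u'" "R (u, v) - R (u', v')"] by (simp add: w_def algebra_simps)
    with R_lip[OF that] show ?thesis
      by simp
  qed
  have w0: "w u0 y0 = y0 + P (x0, y0)"
    by (simp add: w_alt \<Psi>0)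
  have "\<exists>y. norm (y - y0) \<le> norm (q - w u0 y0) \<and> subgradient (ball y0 r) F y (q - y)"
    if "norm (q - w u0 y0) < r" for q
    using subgradient_resolvent_exists[OF F sub0, of q] that unfolding w0 by blast
  then obtain J where J: "\<And>q. norm (q - w u0 y0) < r \<Longrightarrow> norm (J q - y0) \<le> norm (q - w u0 y0)"
    "\<And>q. norm (q - w u0 y0) < r \<Longrightarrow> subgradient (ball y0 r) F (J q) (q - J q)"
    by metis
  \<comment> \<open>The radius \<open>\<rho> / 4\<close> for \<open>u\<close> leads to 5/4 * 1/4 +
    1/4 = 9/16 of \<open>\<rho>\<close>. This is below \<open>\<rho>\<close>, so the fixed point map
    preserves the closed ball of radius \<open>\<rho>\<close> and its fixed point lies in the open
    one.\<close>
  have near: "norm (w u v - w u0 y0) \<le> 9 / 16 * \<rho>"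
    if "norm (u - u0) < \<rho> / 4" "norm (v - y0) \<le> \<rho>" for u v
    using w_lip[of u v u0 y0] that \<rho> by simp
  have nonexp: "norm (y - y') \<le> norm (w1 - w2)"
    if "subgradient (ball y0 r) F y (w1 - y)" "subgradient (ball y0 r) F y' (w2 - y')"
      "norm (y - y0) < r" "norm (y' - y0) < r" for y y' w1 w2
    using subgradient_resolvent_nonexpansive[OF that(1,2)] that(3,4)
    by (simp add: dist_norm norm_minus_commute)
  have "\<exists>v. norm (v - y0) < \<rho> \<and> subgradient (ball y0 r) F v (P (\<Psi> (u, v)))"
    if u: "norm (u - u0) < \<rho> / 4" for u
  proof -
    have u': "norm (u - u0) \<le> \<rho>"
      using u \<rho> by simp
    have "\<exists>!v. v \<in> cball y0 \<rho> \<and> J (w u v) = v"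
    proof (rule Banach_fix[of _ "1 / 4"])
      show "Topological_Spaces.complete (cball y0 \<rho>)" "cball y0 \<rho> \<noteq> {}"
        using \<rho> by (auto intro: compact_imp_complete)
      show "(\<lambda>v. J (w u v)) ` cball y0 \<rho> \<subseteq> cball y0 \<rho>"
      proof clarify
        fix v
        assume "v \<in> cball y0 \<rho>"
        then have "norm (w u v - w u0 y0) \<le> 9 / 16 * \<rho>"
          using near[OF u, of v] by (simp add: dist_norm norm_minus_commute)
        then show "J (w u v) \<in> cball y0 \<rho>"
          using J(1)[of "w u v"] \<rho> by (simp add: dist_norm norm_minus_commute)
      qed
      fix v v'
      assume "v \<in> cball y0 \<rho>" "v' \<in> cball y0 \<rho>"
      then have v: "norm (v - y0) \<le> \<rho>" "norm (v' - y0) \<le> \<rho>"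
        by (auto simp: dist_norm norm_minus_commute)
      note n = near[OF u v(1)] near[OF u v(2)]
      have lt: "norm (w u v - w u0 y0) < r" "norm (w u v' - w u0 y0) < r"
        using n \<rho> by auto
      have "norm (J (w u v) - J (w u v')) \<le> norm (w u v - w u v')"
        by (rule nonexp[OF J(2)[OF lt(1)] J(2)[OF lt(2)]]) (use J(1) lt in fastforce)+
      also have "\<dots> \<le> 1 / 4 * norm (v - v')"
        using w_lip[OF u' v(1) u' v(2)] by simp
      finally show "dist (J (w u v)) (J (w u v')) \<le> 1 / 4 * dist v v'"
        by (simp add: dist_norm)
    qed auto
    then obtain v where v: "norm (v - y0) \<le> \<rho>" "J (w u v) = v"
      by (auto simp: dist_norm norm_minus_commute)
    have n: "norm (w u v - w u0 y0) \<le> 9 / 16 * \<rho>"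
      by (rule near[OF u v(1)])
    then have "norm (v - y0) < \<rho>"
      using J(1)[of "w u v"] v \<rho> by simp
    moreover have "subgradient (ball y0 r) F v (w u v - v)"
      using J(2)[of "w u v"] v n \<rho> by simp
    ultimately show ?thesis
      by (auto simp: w_alt)
  qed
  then obtain f where f: "\<And>u. norm (u - u0) < \<rho> / 4 \<Longrightarrow> norm (f u - y0) < \<rho>"
    "\<And>u. norm (u - u0) < \<rho> / 4 \<Longrightarrow> subgradient (ball y0 r) F (f u) (P (\<Psi> (u, f u)))"
    by metis
  \<comment> \<open>Absorbing the \<open>v\<close> term leaves the factor 5/3, rounded up to 2. With
    \<open>u = u'\<close> this is also the uniqueness of the solution.\<close>
  have lip: "norm (v - v') \<le> 2 * norm (u - u')"
    if "norm (u - u0) < \<rho> / 4" "norm (v - y0) < \<rho>" "subgradient (ball y0 r) F v (P (\<Psi> (u, v)))"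
      "norm (u' - u0) < \<rho> / 4" "norm (v' - y0) < \<rho>" "subgradient (ball y0 r) F v' (P (\<Psi> (u', v')))"
    for u v u' v'
  proof -
    have "norm (v - v') \<le> norm (w u v - w u' v')"
      by (rule nonexp) (use that \<rho> in \<open>auto simp: w_alt\<close>)
    also have "\<dots> \<le> 5 / 4 * norm (u - u') + norm (v - v') / 4"
      using that \<rho> by (intro w_lip) auto
    finally show ?thesis
      using norm_ge_zero[of "u - u'"] by linarith
  qed
  define D where "D = ball u0 (\<rho> / 4)"
  define W where "W = \<Phi> -` (D \<times> ball y0 \<rho>)"
  have "continuous_on UNIV \<Phi>"
    using \<Phi> by (simp add: linear_continuous_on linear_conv_bounded_linear)
  then have "open W"
    unfolding W_def D_def by (intro open_vimage open_Times) auto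
  moreover have "(x0, y0) \<in> W"
    using p0 \<rho> by (simp add: W_def D_def)
  moreover have "W \<subseteq> N"
  proof
    fix z
    assume "z \<in> W"
    then obtain u v where "\<Phi> z = (u, v)" "norm (u - u0) < \<rho> / 4" "norm (v - y0) < \<rho>"
      by (auto simp: W_def D_def dist_norm norm_minus_commute)
    then show "z \<in> N"
      using inV[of u v] \<Psi>\<Phi>[of z] \<rho> by auto
  qed
  moreover have "open D" "2-lipschitz_on D f"
    using lip f by (auto simp: D_def dist_norm norm_minus_commute intro!: lipschitz_onI)
  moreover have "\<Phi> ` {(x, y) \<in> W. y \<in> ball y0 r \<and> subgradient (ball y0 r) F y (P (x, y))}
      = {(u, f u) |u. u \<in> D}" (is "\<Phi> ` ?S = ?G")
  proof
    show "\<Phi> ` ?S \<subseteq> ?G"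
    proof (rule image_subsetI)
      fix z
      assume "z \<in> ?S"
      then obtain x y where z: "z = (x, y)"
        and xy: "(x, y) \<in> W" "subgradient (ball y0 r) F y (P (x, y))"
        by auto
      define u where "u = fst (\<Phi> (x, y))"
      have \<Phi>xy: "\<Phi> (x, y) = (u, y)"
        by (simp add: u_def \<Phi>_def)
      then have u: "norm (u - u0) < \<rho> / 4" "norm (y - y0) < \<rho>" "\<Psi> (u, y) = (x, y)"
        using xy(1) \<Psi>\<Phi>[of "(x, y)"] by (auto simp: W_def D_def dist_norm norm_minus_commute)
      then have "norm (y - f u) \<le> 2 * norm (u - u)"
        using xy(2) f[of u] by (intro lip) auto
      then show "\<Phi> z \<in> ?G"
        using z \<Phi>xy u by (auto simp: D_def dist_norm norm_minus_commute)
    qed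
    show "?G \<subseteq> \<Phi> ` ?S"
    proof clarify
      fix u
      assume "u \<in> D"
      then have u: "norm (u - u0) < \<rho> / 4"
        by (simp add: D_def dist_norm norm_minus_commute)
      obtain x where x: "\<Psi> (u, f u) = (x, f u)"
        using snd\<Psi>[of u "f u"] by (cases "\<Psi> (u, f u)") auto
      then have "\<Phi> (x, f u) = (u, f u)"
        using \<Phi>\<Psi> by metis
      moreover have "(x, f u) \<in> ?S"
        using f[OF u] x \<open>u \<in> D\<close> \<rho> calculation
        by (simp add: W_def mem_ball dist_norm norm_minus_commute[of y0])
      ultimately show "(u, f u) \<in> \<Phi> ` ?S"
        by (intro image_eqI) (rule sym)
    qed
  qed
  ultimately show ?thesis
    using that[OF \<Phi> inj] by blast
qed

section \<open>Strict derivatives and semiconcavity\<close>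

lemma linear_euclidean_expansion:
  fixes f :: "'x::euclidean_space \<Rightarrow> 'f::real_vector"
  assumes "linear f"
  shows "f h = (\<Sum>b\<in>Basis. (h \<bullet> b) *\<^sub>R f b)"
proof -
  have "f h = f (\<Sum>b\<in>Basis. (h \<bullet> b) *\<^sub>R b)"
    by (simp add: euclidean_representation)
  then show ?thesis
    by (simp add: linear_sum[OF assms] linear_scale[OF assms])
qed

text \<open>The mean value inequality for \<open>P - P' z0\<close>, whose derivative is small in
  operator norm near \<open>z0\<close>. Continuity is given only in each fixed direction, as in
  \<open>Ck_on\<close>; a finite basis upgrades it to the operator norm, each basis vector receiving
  an equal share of \<open>\<epsilon>\<close>.\<close>

lemma continuous_derivative_imp_strict:
  fixes P :: "'x::euclidean_space \<Rightarrow> 'f::real_normed_vector"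
  assumes "open S" "z0 \<in> S" and P: "\<And>z. z \<in> S \<Longrightarrow> (P has_derivative P' z) (at z)"
    and cont: "\<And>v. continuous_on S (\<lambda>z. P' z v)" and "\<epsilon> > 0"
  obtains \<delta> where "\<delta> > 0" "ball z0 \<delta> \<subseteq> S"
    "\<And>z z'. z \<in> ball z0 \<delta> \<Longrightarrow> z' \<in> ball z0 \<delta> \<Longrightarrow> norm (P z - P z' - P' z0 (z - z')) \<le> \<epsilon> * norm (z - z')"
proof -
  define e where "e = \<epsilon> / real DIM('x)"
  have "e > 0"
    using \<open>\<epsilon> > 0\<close> by (simp add: e_def)
  have "\<forall>\<^sub>F z in nhds z0. dist (P' z b) (P' z0 b) < e" if "b \<in> Basis" for b
    using cont[of b] assms(1,2) \<open>e > 0\<close>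
    by (intro tendstoD) (auto simp: continuous_on_eq_continuous_at isCont_def tendsto_nhds_iff)
  then have "\<forall>\<^sub>F z in nhds z0. z \<in> S \<and> (\<forall>b\<in>Basis. dist (P' z b) (P' z0 b) < e)"
    using assms(1,2) by (intro eventually_conj eventually_ball_finite) (auto intro: eventually_nhds_in_open)
  then obtain \<delta> where "\<delta> > 0" and \<delta>: "\<And>z. dist z z0 < \<delta> \<Longrightarrow> z \<in> S"
    "\<And>z b. dist z z0 < \<delta> \<Longrightarrow> b \<in> Basis \<Longrightarrow> dist (P' z b) (P' z0 b) < e"
    unfolding eventually_nhds_metric by blast
  have lin: "linear (P' z)" if "z \<in> S" for z
    using has_derivative_linear[OF P[OF that]] .
  have bound: "norm (P' z h - P' z0 h) \<le> \<epsilon> * norm h" if "dist z z0 < \<delta>" for z h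
  proof -
    have expand: "P' w h = (\<Sum>b\<in>Basis. (h \<bullet> b) *\<^sub>R P' w b)" if "w \<in> S" for w
      by (rule linear_euclidean_expansion[OF lin[OF that]])
    have "norm (P' z h - P' z0 h) = norm (\<Sum>b\<in>Basis. (h \<bullet> b) *\<^sub>R (P' z b - P' z0 b))"
      using \<delta>(1)[OF that] assms(2) by (subst (1 2) expand) (simp_all add: sum_subtractf scaleR_diff_right)
    also have "\<dots> \<le> (\<Sum>b\<in>(Basis::'x set). norm h * e)"
    proof (rule sum_norm_le)
      fix b :: 'x
      assume b: "b \<in> Basis"
      show "norm ((h \<bullet> b) *\<^sub>R (P' z b - P' z0 b)) \<le> norm h * e"
        unfolding norm_scaleR using \<delta>(2)[OF that b] Basis_le_norm[OF b, of h]
        by (intro mult_mono) (auto simp: dist_norm)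
    qed
    finally show ?thesis
      by (simp add: e_def mult.commute)
  qed
  have "norm (P z - P z' - P' z0 (z - z')) \<le> \<epsilon> * norm (z - z')"
    if "z \<in> ball z0 \<delta>" "z' \<in> ball z0 \<delta>" for z z'
  proof -
    have "norm ((P z - P' z0 z) - (P z' - P' z0 z')) \<le> \<epsilon> * norm (z - z')"
    proof (rule differentiable_bound[where S = "ball z0 \<delta>" and f = "\<lambda>w. P w - P' z0 w" and f' = "\<lambda>w h. P' w h - P' z0 h"])
      fix w
      assume "w \<in> ball z0 \<delta>"
      then have w: "dist w z0 < \<delta>"
        by (simp add: dist_commute)
      show "((\<lambda>w. P w - P' z0 w) has_derivative (\<lambda>h. P' w h - P' z0 h)) (at w within ball z0 \<delta>)"
        using P[OF \<delta>(1)[OF w]] lin[OF assms(2)]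
        by (intro has_derivative_diff has_derivative_at_withinI[OF linear_imp_has_derivative])
          (auto intro: has_derivative_at_withinI)
      show "onorm (\<lambda>h. P' w h - P' z0 h) \<le> \<epsilon>"
        using bound[OF w] by (rule onorm_le)
    qed (use that in auto)
    then show ?thesis
      by (simp add: linear_diff[OF lin[OF assms(2)]] algebra_simps)
  qed
  moreover have "ball z0 \<delta> \<subseteq> S"
    using \<delta>(1) by (auto simp: dist_commute)
  ultimately show ?thesis
    using \<open>\<delta> > 0\<close> that by blast
qed

lemma convex_on_tangent:
  assumes "convex C"
    and tangent: "\<And>y z. y \<in> C \<Longrightarrow> z \<in> C \<Longrightarrow> H y + G y \<bullet> (z - y) \<le> H z"
  shows "convex_on C H"
proof (rule convex_onI)
  fix t :: real and y z
  assume t: "0 < t" "t < 1" and yz: "y \<in> C" "z \<in> C"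
  define m where "m = (1 - t) *\<^sub>R y + t *\<^sub>R z"
  have m: "m \<in> C"
    unfolding m_def using convexD[OF assms(1) yz, of "1 - t" t] t by simp
  have "y - m = - t *\<^sub>R (z - y)" "z - m = (1 - t) *\<^sub>R (z - y)"
    by (simp_all add: m_def algebra_simps)
  then have "H m - t * (G m \<bullet> (z - y)) \<le> H y" "H m + (1 - t) * (G m \<bullet> (z - y)) \<le> H z"
    using tangent[OF m yz(1)] tangent[OF m yz(2)] by simp_all
  then have "(1 - t) * (H m - t * (G m \<bullet> (z - y))) + t * (H m + (1 - t) * (G m \<bullet> (z - y)))
      \<le> (1 - t) * H y + t * H z"
    using t by (intro add_mono mult_left_mono) auto
  then show "H ((1 - t) *\<^sub>R y + t *\<^sub>R z) \<le> (1 - t) * H y + t * H z"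
    unfolding m_def[symmetric] by (simp add: algebra_simps)
qed (fact assms(1))

text \<open>By the mean value theorem \<open>h\<close> falls below its tangent by at most
  \<open>\<Lambda> * norm (z - y) ^ 2\<close>, which is exactly the second-order term of
  \<open>\<Lambda> * norm y ^ 2\<close>. So the sum lies above its tangents.\<close>

lemma lipschitz_gradient_imp_semiconvex:
  fixes h :: "'e::real_inner \<Rightarrow> real"
  assumes "convex C" and h: "\<And>y. y \<in> C \<Longrightarrow> (h has_derivative (\<lambda>k. g y \<bullet> k)) (at y)"
    and lip: "\<And>y z. y \<in> C \<Longrightarrow> z \<in> C \<Longrightarrow> norm (g y - g z) \<le> \<Lambda> * norm (y - z)" and "\<Lambda> \<ge> 0"
  shows "convex_on C (\<lambda>y. \<Lambda> * norm y ^ 2 + h y)"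
proof (rule convex_on_tangent[OF \<open>convex C\<close>])
  fix y z
  assume yz: "y \<in> C" "z \<in> C"
  define d where "d = z - y"
  have seg: "y + t *\<^sub>R d \<in> C" if "0 \<le> t" "t \<le> 1" for t
  proof -
    have "y + t *\<^sub>R d = (1 - t) *\<^sub>R y + t *\<^sub>R z"
      by (simp add: d_def algebra_simps)
    then show ?thesis
      using convexD[OF assms(1) yz, of "1 - t" t] that by simp
  qed
  have "((\<lambda>t. h (y + t *\<^sub>R d)) has_derivative (\<lambda>s. g (y + t *\<^sub>R d) \<bullet> (s *\<^sub>R d))) (at t within {0..1})"
    if "0 \<le> t" "t \<le> 1" for t
  proof (rule has_derivative_compose[of "\<lambda>t. y + t *\<^sub>R d" "\<lambda>s. s *\<^sub>R d" _ _ h])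
    show "((\<lambda>t. y + t *\<^sub>R d) has_derivative (\<lambda>s. s *\<^sub>R d)) (at t within {0..1})"
      by (auto intro!: derivative_eq_intros)
  qed (rule h[OF seg[OF that]])
  from mvt_very_simple[of 0 1 "\<lambda>t. h (y + t *\<^sub>R d)", OF _ this]
  obtain t where t: "0 \<le> t" "t \<le> 1" and "h z - h y = g (y + t *\<^sub>R d) \<bullet> d"
    by (auto simp: d_def)
  then have "h z - h y - g y \<bullet> d = (g (y + t *\<^sub>R d) - g y) \<bullet> d"
    by (simp add: inner_diff_left)
  also have "\<dots> \<ge> - (norm (g (y + t *\<^sub>R d) - g y) * norm d)"
    using norm_cauchy_schwarz[of "- (g (y + t *\<^sub>R d) - g y)" d] by (simp add: norm_minus_commute inner_diff_left)
  moreover have "norm (g (y + t *\<^sub>R d) - g y) * norm d \<le> \<Lambda> * norm d * norm d"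
  proof (rule mult_right_mono)
    have "norm (g (y + t *\<^sub>R d) - g y) \<le> \<Lambda> * (t * norm d)"
      using lip[OF seg[OF t] yz(1)] t by simp
    also have "\<dots> \<le> \<Lambda> * norm d"
      using t \<open>\<Lambda> \<ge> 0\<close> by (intro mult_left_mono mult_left_le_one_le) auto
    finally show "norm (g (y + t *\<^sub>R d) - g y) \<le> \<Lambda> * norm d" .
  qed simp
  moreover have "\<Lambda> * norm z ^ 2 = \<Lambda> * norm y ^ 2 + (2 * \<Lambda>) * (y \<bullet> d) + \<Lambda> * norm d * norm d"
  proof -
    have "norm z ^ 2 = norm y ^ 2 + 2 * (y \<bullet> d) + norm d * norm d"
      by (simp add: d_def dot_square_norm[symmetric] power2_eq_square[symmetric] inner_diff_left inner_diff_right inner_commute)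
    then show ?thesis
      by (simp add: algebra_simps)
  qed
  ultimately show "\<Lambda> * norm y ^ 2 + h y + ((2 * \<Lambda>) *\<^sub>R y + g y) \<bullet> (z - y) \<le> \<Lambda> * norm z ^ 2 + h z"
    by (simp add: inner_add_left d_def[symmetric])
qed

definition partial_gradient :: "('d::euclidean_space \<times> 'e::euclidean_space \<Rightarrow> real) \<Rightarrow> 'd \<times> 'e \<Rightarrow> 'e" where
  "partial_gradient f z = (\<Sum>j\<in>Basis. frechet_derivative f (at z) (0, j) *\<^sub>R j)"

text \<open>
  The derivative in the second variable is taken first, as in \<open>mixed_hessian\<close>, so that the
  symmetry of second derivatives is never needed.
\<close>

definition partial_gradient_deriv ::
  "('d::euclidean_space \<times> 'e::euclidean_space \<Rightarrow> real) \<Rightarrow> 'd \<times> 'e \<Rightarrow> 'd \<times> 'e \<Rightarrow> 'e" where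
  "partial_gradient_deriv f z v =
     (\<Sum>j\<in>Basis. frechet_derivative (\<lambda>w. frechet_derivative f (at w) (0, j)) (at z) v *\<^sub>R j)"

lemma Ck_on_2D:
  assumes "Ck_on 2 S f"
  shows "\<And>x. x \<in> S \<Longrightarrow> f differentiable at x"
    and "\<And>x v. x \<in> S \<Longrightarrow> (\<lambda>x. frechet_derivative f (at x) v) differentiable at x"
    and "\<And>v w. continuous_on S (\<lambda>x. frechet_derivative (\<lambda>x. frechet_derivative f (at x) v) (at x) w)"
  using assms unfolding numeral_2_eq_2 Ck_on.simps by blast+

lemma partial_gradient_has_derivative:
  assumes "Ck_on 2 S f" "z \<in> S"
  shows "(partial_gradient f has_derivative partial_gradient_deriv f z) (at z)"
  unfolding partial_gradient_def[abs_def] partial_gradient_deriv_def[abs_def]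
  by (intro has_derivative_sum has_derivative_scaleR_left)
    (simp add: frechet_derivative_works[symmetric] Ck_on_2D(2)[OF assms])

lemma continuous_on_partial_gradient_deriv:
  assumes "Ck_on 2 S f"
  shows "continuous_on S (\<lambda>z. partial_gradient_deriv f z v)"
  unfolding partial_gradient_deriv_def by (intro continuous_intros Ck_on_2D(3)[OF assms])

lemma has_derivative_partial_gradient:
  assumes "Ck_on 2 S f" "(x, y) \<in> S"
  shows "((\<lambda>y. f (x, y)) has_derivative (\<lambda>k. partial_gradient f (x, y) \<bullet> k)) (at y)"
proof -
  have f: "(f has_derivative frechet_derivative f (at (x, y))) (at (x, y))"
    using Ck_on_2D(1)[OF assms] by (simp add: frechet_derivative_works[symmetric])
  have "((\<lambda>y. f (x, y)) has_derivative (\<lambda>k. frechet_derivative f (at (x, y)) (0, k))) (at y)"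
    by (rule has_derivative_compose[where f = "Pair x" and g = f, OF _ f]) (auto intro!: derivative_eq_intros)
  moreover have "frechet_derivative f (at (x, y)) (0, k) = partial_gradient f (x, y) \<bullet> k" for k
  proof -
    have "linear (\<lambda>k. frechet_derivative f (at (x, y)) (0, k))"
      using has_derivative_linear[OF calculation] .
    from linear_euclidean_expansion[OF this, of k]
    show ?thesis
      by (simp add: partial_gradient_def inner_sum_left inner_commute[of k] mult.commute)
  qed
  ultimately show ?thesis
    by simp
qed

text \<open>\<open>B\<close> bounds the derivative of the \<open>y\<close>-gradient at the base
  point and strict differentiability with tolerance 1 adds one, so the gradient is
  \<open>B + 1\<close>-Lipschitz in \<open>y\<close> nearby. It matters that the same
  \<open>\<delta>\<close> and \<open>\<Lambda>\<close> serve all \<open>x\<close> close to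
  \<open>x0\<close>: a supremum over \<open>x\<close> inherits them.\<close>

lemma Ck_2_imp_semiconcave:
  fixes f :: "'d::euclidean_space \<times> 'e::euclidean_space \<Rightarrow> real"
  assumes "Ck_on 2 S f" "open S" "(x0, y0) \<in> S"
  obtains \<delta> \<Lambda> where "\<delta> > 0" "\<Lambda> \<ge> 0" "\<And>x. x \<in> ball x0 \<delta> \<Longrightarrow> convex_on (ball y0 \<delta>) (\<lambda>y. \<Lambda> * norm y ^ 2 - f (x, y))"
proof -
  let ?g' = "partial_gradient_deriv f (x0, y0)"
  obtain \<delta> where \<delta>: "\<delta> > 0" "ball (x0, y0) \<delta> \<subseteq> S"
    and strict: "\<And>z z'. z \<in> ball (x0, y0) \<delta> \<Longrightarrow> z' \<in> ball (x0, y0) \<delta> \<Longrightarrow>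
      norm (partial_gradient f z - partial_gradient f z' - ?g' (z - z')) \<le> 1 * norm (z - z')"
    using continuous_derivative_imp_strict[OF assms(2,3) partial_gradient_has_derivative[OF assms(1)]
        continuous_on_partial_gradient_deriv[OF assms(1)] zero_less_one] by blast
  obtain B where B: "B > 0" "\<And>v. norm (?g' v) \<le> B * norm v"
    using linear_bounded_pos[OF has_derivative_linear[OF partial_gradient_has_derivative[OF assms(1,3)]]] by blast
  have box: "(x, y) \<in> ball (x0, y0) \<delta>" if "x \<in> ball x0 (\<delta> / 2)" "y \<in> ball y0 (\<delta> / 2)" for x y
    using that norm_Pair_le[of "x0 - x" "y0 - y"] by (simp add: dist_norm)
  have "convex_on (ball y0 (\<delta> / 2)) (\<lambda>y. (B + 1) * norm y ^ 2 - f (x, y))" if x: "x \<in> ball x0 (\<delta> / 2)" for x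
  proof -
    have "convex_on (ball y0 (\<delta> / 2)) (\<lambda>y. (B + 1) * norm y ^ 2 + - f (x, y))"
    proof (rule lipschitz_gradient_imp_semiconvex[where g = "\<lambda>y. - partial_gradient f (x, y)"])
      fix y
      assume "y \<in> ball y0 (\<delta> / 2)"
      then have y: "(x, y) \<in> ball (x0, y0) \<delta>"
        using box x by blast
      show "((\<lambda>y. - f (x, y)) has_derivative (\<lambda>k. - partial_gradient f (x, y) \<bullet> k)) (at y)"
        using has_derivative_minus[OF has_derivative_partial_gradient[OF assms(1), of x y]] y \<delta> by (auto simp: inner_minus_left)
      fix z
      assume "z \<in> ball y0 (\<delta> / 2)"
      then have z: "(x, z) \<in> ball (x0, y0) \<delta>"
        using box x by blast
      have "norm (partial_gradient f (x, y) - partial_gradient f (x, z)) \<le>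
          norm (?g' ((x, y) - (x, z))) + norm ((x, y) - (x, z))"
        using strict[OF y z] norm_triangle_sub[of "partial_gradient f (x, y) - partial_gradient f (x, z)"
            "?g' ((x, y) - (x, z))"] by simp
      also have "\<dots> \<le> (B + 1) * norm (y - z)"
        using B(2)[of "(x, y) - (x, z)"] by (simp add: algebra_simps)
      finally show "norm (- partial_gradient f (x, y) - - partial_gradient f (x, z)) \<le> (B + 1) * norm (y - z)"
        by (simp add: norm_minus_commute)
    qed (use B in auto)
    then show ?thesis
      by simp
  qed
  then show ?thesis
    using that[of "\<delta> / 2" "B + 1"] \<delta> B by simp
qed

section \<open>Optimal plans are cyclically monotone\<close>

definition add_measure :: "'p measure \<Rightarrow> 'p measure \<Rightarrow> 'p measure" where
  "add_measure M N = measure_of (space M) (sets M) (\<lambda>A. emeasure M A + emeasure N A)"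

lemma sets_add_measure [simp, measurable_cong]: "sets (add_measure M N) = sets M"
  by (simp add: add_measure_def)

lemma space_add_measure [simp]: "space (add_measure M N) = space M"
  by (simp add: add_measure_def)

lemma emeasure_add_measure:
  assumes N: "sets N = sets M" and "A \<in> sets M"
  shows "emeasure (add_measure M N) A = emeasure M A + emeasure N A"
  unfolding add_measure_def
proof (rule emeasure_measure_of_sigma)
  show "countably_additive (sets M) (\<lambda>A. emeasure M A + emeasure N A)"
  proof (rule countably_additiveI)
    fix A :: "nat \<Rightarrow> _"
    assume "range A \<subseteq> sets M" "disjoint_family A"
    then show "(\<Sum>i. emeasure M (A i) + emeasure N (A i)) = emeasure M (\<Union> (range A)) + emeasure N (\<Union> (range A))"
      using N by (subst suminf_add[symmetric]) (auto simp: suminf_emeasure)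
  qed
qed (auto simp: positive_def assms sets.sigma_algebra_axioms)

lemma nn_integral_add_measure:
  assumes N: "sets N = sets M" and "f \<in> borel_measurable M"
  shows "(\<integral>\<^sup>+x. f x \<partial>add_measure M N) = (\<integral>\<^sup>+x. f x \<partial>M) + (\<integral>\<^sup>+x. f x \<partial>N)"
proof -
  have meas: "u \<in> borel_measurable N" "u \<in> borel_measurable (add_measure M N)"
    if "u \<in> borel_measurable M" for u :: "'a \<Rightarrow> ennreal"
    using that N by (simp_all cong: measurable_cong_sets)
  show ?thesis
    using assms(2)
  proof (induction rule: borel_measurable_induct)
    case (cong f g)
    have "(\<integral>\<^sup>+x. f x \<partial>L) = (\<integral>\<^sup>+x. g x \<partial>L)" if "space L = space M" for L
      using cong(3) that by (intro nn_integral_cong) simp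
    then show ?case
      using cong(4) sets_eq_imp_space_eq[OF N] by simp
  next
    case (set A)
    then show ?case
      by (simp add: N emeasure_add_measure)
  next
    case (mult u c)
    then show ?case
      by (simp add: nn_integral_cmult meas distrib_left)
  next
    case (add u v)
    have uv: "u \<in> borel_measurable M" "v \<in> borel_measurable M"
      by fact+
    have IH: "integral\<^sup>N (add_measure M N) u = integral\<^sup>N M u + integral\<^sup>N N u"
      "integral\<^sup>N (add_measure M N) v = integral\<^sup>N M v + integral\<^sup>N N v"
      by fact+
    show ?case
      unfolding nn_integral_add[OF uv(2,1)] nn_integral_add[OF meas(1)[OF uv(2)] meas(1)[OF uv(1)]]
        nn_integral_add[OF meas(2)[OF uv(2)] meas(2)[OF uv(1)]] IH
      by (simp only: ac_simps)
  next
    case (seq U)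
    have U: "U i \<in> borel_measurable M" "U i \<in> borel_measurable N"
      "U i \<in> borel_measurable (add_measure M N)" for i
      using meas[OF seq(1)] seq(1) by blast+
    have IH: "integral\<^sup>N (add_measure M N) (U i) = integral\<^sup>N M (U i) + integral\<^sup>N N (U i)" for i
      by fact
    have Sup: "Sup (range U) = (\<lambda>x. SUP i. U i x)"
      by (auto simp: image_comp)
    have "(SUP i. integral\<^sup>N (add_measure M N) (U i)) = (SUP i. integral\<^sup>N M (U i) + integral\<^sup>N N (U i))"
      by (simp only: IH)
    also have "\<dots> = (SUP i. integral\<^sup>N M (U i)) + (SUP i. integral\<^sup>N N (U i))"
      using \<open>incseq U\<close> by (intro ennreal_SUP_add incseq_nn_integral)
    finally show ?case
      unfolding Sup using \<open>incseq U\<close> U by (simp only: nn_integral_monotone_convergence_SUP)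
  qed
qed

lemma
  fixes f :: "'p \<Rightarrow> real"
  assumes N: "sets N = sets M" and M: "integrable M f" and Nf: "integrable N f"
  shows integrable_add_measure: "integrable (add_measure M N) f"
    and integral_add_measure: "integral\<^sup>L (add_measure M N) f = integral\<^sup>L M f + integral\<^sup>L N f"
proof -
  have [measurable]: "f \<in> borel_measurable M"
    using M by auto
  show "integrable (add_measure M N) f"
    using M Nf by (auto simp: integrable_iff_bounded nn_integral_add_measure[OF N])
  then show "integral\<^sup>L (add_measure M N) f = integral\<^sup>L M f + integral\<^sup>L N f"
    using M Nf
    by (simp add: real_lebesgue_integral_def nn_integral_add_measure[OF N] real_integrable_def
        enn2real_plus less_top)
qed

text \<open>The complements of the closed sets of full measure are open null sets; by Lindelof
  countably many of them already cover their union, which is therefore null.\<close>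

lemma spt_borel_prob:
  fixes \<mu> :: "'a::second_countable_topology measure"
  assumes "borel_prob \<mu>"
  shows "closed (spt \<mu>)" "emeasure \<mu> (spt \<mu>) = 1"
proof -
  interpret prob_space \<mu>
    using assms by (simp add: borel_prob_def)
  have sets: "sets \<mu> = sets borel"
    using assms by (simp add: borel_prob_def)
  show closed: "closed (spt \<mu>)"
    by (auto simp: spt_def)
  define \<F> where "\<F> = uminus ` {S. closed S \<and> emeasure \<mu> S = 1}"
  obtain \<G> where \<G>: "\<G> \<subseteq> \<F>" "countable \<G>" "\<Union>\<G> = \<Union>\<F>"
    using Lindelof[of \<F>] by (auto simp: \<F>_def)
  have "G \<in> null_sets \<mu>" if "G \<in> \<F>" for G
  proof -
    obtain S where S: "G = - S" "closed S" "emeasure \<mu> S = 1"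
      using \<open>G \<in> \<F>\<close> by (auto simp: \<F>_def)
    then have "emeasure \<mu> (space \<mu> - S) = 0"
      using emeasure_compl[of S \<mu>] sets by (simp add: emeasure_space_1)
    moreover have "space \<mu> - S = G"
      using S sets_eq_imp_space_eq[OF sets] by auto
    ultimately show ?thesis
      using S sets by auto
  qed
  then have "\<Union>\<G> \<in> null_sets \<mu>"
    using \<G>(1,2) null_sets_UN'[OF \<G>(2), of id \<mu>] by auto
  moreover have "space \<mu> - spt \<mu> = \<Union>\<F>"
    using sets_eq_imp_space_eq[OF sets] by (auto simp: spt_def \<F>_def)
  ultimately have "emeasure \<mu> (space \<mu> - spt \<mu>) = 0"
    using \<G>(3) by auto
  then show "emeasure \<mu> (spt \<mu>) = 1"
    using closed sets prob_compl[of "spt \<mu>"] by (simp add: emeasure_eq_measure)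
qed

lemma emeasure_open_spt_pos:
  assumes "borel_prob \<mu>" "p \<in> spt \<mu>" "open W" "p \<in> W"
  shows "emeasure \<mu> W > 0"
proof (rule ccontr)
  interpret prob_space \<mu>
    using assms by (simp add: borel_prob_def)
  have sets: "sets \<mu> = sets borel"
    using assms by (simp add: borel_prob_def)
  have "emeasure \<mu> UNIV = 1"
    using emeasure_space_1 sets_eq_imp_space_eq[OF sets] by simp
  moreover assume "\<not> emeasure \<mu> W > 0"
  ultimately have "emeasure \<mu> (- W) = 1"
    using emeasure_compl[of W \<mu>] assms sets sets_eq_imp_space_eq[OF sets]
    by (simp add: Compl_eq_Diff_UNIV)
  then have "spt \<mu> \<subseteq> - W"
    using assms by (auto simp: spt_def)
  with assms show False
    by auto
qed

lemma (in prob_space) integral_pair_product: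
  fixes f g :: "'a \<Rightarrow> real"
  assumes [measurable]: "f \<in> borel_measurable M" "g \<in> borel_measurable M"
    and "\<And>x. \<bar>f x\<bar> \<le> B" "\<And>x. \<bar>g x\<bar> \<le> C"
  shows "(\<integral>w. f (fst w) * g (snd w) \<partial>(M \<Otimes>\<^sub>M M)) = (\<integral>x. f x \<partial>M) * (\<integral>x. g x \<partial>M)"
proof -
  interpret pair: pair_prob_space M M ..
  have "integrable (M \<Otimes>\<^sub>M M) (\<lambda>w. f (fst w) * g (snd w))"
  proof (rule pair.integrable_const_bound)
    show "AE w in M \<Otimes>\<^sub>M M. norm (f (fst w) * g (snd w)) \<le> B * C"
      using assms(3,4) by (intro AE_I2) (auto simp: abs_mult intro!: mult_mono order_trans[OF abs_ge_zero])
  qed measurable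
  from pair.integral_fst'[OF this] show ?thesis
    by simp
qed

text \<open>Continuity spreads a strict gain at finitely many points over small neighbourhoods, and
  these carry mass because the points lie in the support. The cost involves only the pairs
  \<open>(i, \<sigma> i)\<close>, so the exchange can be built on two copies of
  \<open>\<gamma>\<close> instead of an \<open>N\<close>-fold product.\<close>

lemma exists_cheaper_coupling:
  fixes \<gamma> :: "('a::second_countable_topology \<times> 'b::second_countable_topology) measure" and N :: nat
    and c :: "'a \<times> 'b \<Rightarrow> real"
  assumes \<gamma>: "borel_prob \<gamma>" and c: "continuous_on UNIV c" and C: "\<And>z. \<bar>c z\<bar> \<le> C"
    and p: "\<And>i. i < N \<Longrightarrow> p i \<in> spt \<gamma>" and \<sigma>: "bij_betw \<sigma> {..<N} {..<N}"
    and less: "(\<Sum>i<N. c (fst (p i), snd (p (\<sigma> i)))) < (\<Sum>i<N. c (p i))"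
  obtains \<gamma>' where "sets \<gamma>' = sets borel"
    "\<And>A. A \<in> sets borel \<Longrightarrow> emeasure \<gamma>' (A \<times> UNIV) = emeasure \<gamma> (A \<times> UNIV)"
    "\<And>B. B \<in> sets borel \<Longrightarrow> emeasure \<gamma>' (UNIV \<times> B) = emeasure \<gamma> (UNIV \<times> B)"
    "integral\<^sup>L \<gamma>' c < integral\<^sup>L \<gamma> c"
proof -
  interpret prob_space \<gamma>
    using \<gamma> by (simp add: borel_prob_def)
  interpret pair: pair_prob_space \<gamma> \<gamma> ..
  have sets_\<gamma> [measurable_cong]: "sets \<gamma> = sets borel"
    using \<gamma> by (simp add: borel_prob_def)
  have space_\<gamma>: "space \<gamma> = UNIV"
    using sets_eq_imp_space_eq[OF sets_\<gamma>] by simp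
  have "N > 0"
    using less by (cases N) auto
  have \<sigma>N: "\<sigma> i < N" if "i < N" for i
    using bij_betwE[OF \<sigma>] that by auto

  \<comment> \<open>Each index may lose \<open>\<epsilon>\<close> on the removed and
    \<open>\<epsilon>\<close> on the added mass, \<open>2 * N * \<epsilon>\<close> in all; dividing
    the gain by \<open>3 * N\<close> leaves a third of it.\<close>
  define \<epsilon> where "\<epsilon> = ((\<Sum>i<N. c (p i)) - (\<Sum>i<N. c (fst (p i), snd (p (\<sigma> i))))) / (3 * N)"
  have "\<epsilon> > 0"
    using less \<open>N > 0\<close> by (simp add: \<epsilon>_def)
  have "\<exists>A B. open A \<and> open B \<and> fst (p i) \<in> A \<and> snd (p j) \<in> B \<and>
      (\<forall>z\<in>A \<times> B. \<bar>c z - c (fst (p i), snd (p j))\<bar> < \<epsilon>)" for i j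
  proof -
    define a where "a = c (fst (p i), snd (p j))"
    have "open (c -` {a - \<epsilon><..<a + \<epsilon>})"
      using c by (intro open_vimage) auto
    moreover have "(fst (p i), snd (p j)) \<in> c -` {a - \<epsilon><..<a + \<epsilon>}"
      using \<open>\<epsilon> > 0\<close> by (simp add: a_def)
    ultimately obtain A B where AB: "open A" "open B" "(fst (p i), snd (p j)) \<in> A \<times> B"
      "A \<times> B \<subseteq> c -` {a - \<epsilon><..<a + \<epsilon>}"
      by (rule open_prod_elim)
    have "\<bar>c z - a\<bar> < \<epsilon>" if "z \<in> A \<times> B" for z
      using AB(4) that by (auto simp: abs_less_iff)
    with AB show ?thesis
      unfolding a_def by blast
  qed
  then obtain A B where AB: "\<And>i j. open (A i j)" "\<And>i j. open (B i j)" "\<And>i j. fst (p i) \<in> A i j"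
    "\<And>i j. snd (p j) \<in> B i j"
    "\<And>i j z. z \<in> A i j \<times> B i j \<Longrightarrow> \<bar>c z - c (fst (p i), snd (p j))\<bar> < \<epsilon>"
    by metis
  \<comment> \<open>Intersecting over the partner index gives one neighbourhood per coordinate that
    is good for all pairs \<open>(i, j)\<close>, the old \<open>(i, i)\<close> and the new
    \<open>(i, \<sigma> i)\<close> alike.\<close>
  define U where "U i = (\<Inter>j<N. A i j)" for i
  define V where "V j = (\<Inter>i<N. B i j)" for j
  have cUV: "\<bar>c (x, y) - c (fst (p i), snd (p j))\<bar> < \<epsilon>" if "x \<in> U i" "y \<in> V j" "i < N" "j < N" for x y i j
    using AB(5)[of "(x, y)" i j] that by (auto simp: U_def V_def)
  define W where "W i = U i \<times> V i" for i
  have "open (W i)" "p i \<in> W i" for i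
    using AB(1-4) by (auto simp: W_def U_def V_def mem_Times_iff intro!: open_Times open_INT)
  then have W [measurable]: "W i \<in> sets borel" for i
    by auto
  define m where "m i = measure \<gamma> (W i)" for i
  have m: "m i > 0" if "i < N" for i
    using emeasure_open_spt_pos[OF \<gamma> p[OF that] \<open>open (W i)\<close> \<open>p i \<in> W i\<close>]
    by (simp add: m_def emeasure_eq_measure)
  \<comment> \<open>The neighbourhoods may overlap, even coincide. The factor \<open>1 / N\<close>
    keeps the total density removed at any point at most 1.\<close>
  define l where "l = Min (m ` {..<N}) / N"
  have "l > 0"
    unfolding l_def using m \<open>N > 0\<close> by (intro divide_pos_pos) (auto simp: Min_gr_iff lessThan_empty_iff)
  have l: "l / m i \<le> 1 / N" if "i < N" for i
  proof -
    have "Min (m ` {..<N}) \<le> m i"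
      using that by (intro Min_le) auto
    then show ?thesis
      using m[OF that] \<open>N > 0\<close> by (simp add: l_def field_simps)
  qed

  \<comment> \<open>Remove a multiple of \<open>\<gamma>\<close> near each \<open>p i\<close>, and put back the product of its first marginal
    near \<open>p i\<close> with its second marginal near \<open>p (\<sigma> i)\<close>.\<close>
  define \<rho> where "\<rho> z = 1 - (\<Sum>i<N. l / m i * indicat_real (W i) z)" for z
  define d where "d w = (\<Sum>i<N. l / (m i * m (\<sigma> i)) * (indicat_real (W i) (fst w) * indicat_real (W (\<sigma> i)) (snd w)))"
    for w :: "('a \<times> 'b) \<times> ('a \<times> 'b)"
  define T where "T w = (fst (fst w), snd (snd w))" for w :: "('a \<times> 'b) \<times> ('a \<times> 'b)"
  have [measurable]: "\<rho> \<in> borel_measurable borel" "d \<in> borel_measurable (\<gamma> \<Otimes>\<^sub>M \<gamma>)"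
    unfolding \<rho>_def[abs_def] d_def[abs_def] by measurable
  have [measurable]: "fst \<in> borel_measurable \<gamma>" "snd \<in> borel_measurable \<gamma>"
    unfolding measurable_cong_sets[OF sets_\<gamma> refl]
    by (auto intro!: borel_measurable_continuous_onI continuous_intros)
  have T [measurable]: "T \<in> \<gamma> \<Otimes>\<^sub>M \<gamma> \<rightarrow>\<^sub>M borel"
    unfolding T_def[abs_def] borel_prod[symmetric] by measurable
  have \<rho>_nonneg: "\<rho> z \<ge> 0" for z
  proof -
    have "(\<Sum>i<N. l / m i * indicat_real (W i) z) \<le> (\<Sum>i<N. 1 / N)"
      using l \<open>N > 0\<close> by (intro sum_mono) (auto simp: indicator_def)
    then show ?thesis
      using \<open>N > 0\<close> by (simp add: \<rho>_def)
  qed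
  have d_nonneg: "d w \<ge> 0" for w
    unfolding d_def using m \<sigma>N \<open>l > 0\<close> by (intro sum_nonneg) (simp add: less_imp_le)
  define M1 where "M1 = density \<gamma> \<rho>"
  define M2 where "M2 = distr (density (\<gamma> \<Otimes>\<^sub>M \<gamma>) d) borel T"
  define \<gamma>' where "\<gamma>' = add_measure M1 M2"
  \<comment> \<open>Averages of \<open>h\<close> over the mass removed near \<open>p i\<close> and
    over the mass put back for it. The integral then changes by
    \<open>l * (\<Sum>i<N. K i h - I i h)\<close> for every bounded measurable \<open>h\<close>:
    indicators of cylinders give the marginals, \<open>h = c\<close> gives the gain.\<close>
  define I where "I i h = (\<integral>z. indicator (W i) z * h z \<partial>\<gamma>) / m i" for i and h :: "'a \<times> 'b \<Rightarrow> real"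
  define K where "K i h = (\<integral>w. indicator (W i) (fst w) * indicator (W (\<sigma> i)) (snd w) * h (T w) \<partial>(\<gamma> \<Otimes>\<^sub>M \<gamma>))
      / (m i * m (\<sigma> i))" for i and h :: "'a \<times> 'b \<Rightarrow> real"
  have sets12: "sets M2 = sets M1"
    by (simp add: M1_def M2_def sets_\<gamma>)
  have \<gamma>': "integrable \<gamma>' h \<and> integral\<^sup>L \<gamma>' h = integral\<^sup>L \<gamma> h + l * (\<Sum>i<N. K i h - I i h)"
    if h [measurable]: "h \<in> borel_measurable borel" and bound: "\<And>z. \<bar>h z\<bar> \<le> H" for h H
  proof -
    have i0: "integrable \<gamma> h"
      using bound by (intro integrable_const_bound[of _ H]) auto
    have "\<bar>indicator (W i) z * h z\<bar> \<le> H" for i z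
      using bound[of z] by (auto simp: indicator_def)
    then have i1: "integrable \<gamma> (\<lambda>z. indicator (W i) z * h z)" for i
      by (intro integrable_const_bound[of _ H]) auto
    have "\<bar>indicator (W i) (fst w) * indicator (W (\<sigma> i)) (snd w) * h (T w)\<bar> \<le> H" for i w
      using bound[of "T w"] by (auto simp: indicator_def)
    then have i2: "integrable (\<gamma> \<Otimes>\<^sub>M \<gamma>) (\<lambda>w. indicator (W i) (fst w) * indicator (W (\<sigma> i)) (snd w) * h (T w))" for i
      by (intro pair.integrable_const_bound[of _ H]) auto
    have \<rho>h: "\<rho> z * h z = h z - (\<Sum>i<N. l / m i * (indicator (W i) z * h z))" for z
      by (simp add: \<rho>_def left_diff_distrib sum_distrib_right mult.assoc)
    have dh: "d w * h (T w) = (\<Sum>i<N. l / (m i * m (\<sigma> i)) *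
        (indicator (W i) (fst w) * indicator (W (\<sigma> i)) (snd w) * h (T w)))" for w
      by (simp add: d_def sum_distrib_right mult.assoc)
    have M1: "integrable M1 h" "integral\<^sup>L M1 h = integral\<^sup>L \<gamma> h - l * (\<Sum>i<N. I i h)"
      unfolding M1_def using \<rho>_nonneg i0 i1
      by (simp_all add: integrable_density integral_density \<rho>h I_def sum_distrib_left)
    have M2: "integrable M2 h" "integral\<^sup>L M2 h = l * (\<Sum>i<N. K i h)"
      unfolding M2_def using d_nonneg i2
      by (simp_all add: integrable_distr_eq integral_distr integrable_density integral_density dh K_def sum_distrib_left)
    show ?thesis
      unfolding \<gamma>'_def using M1 M2 integrable_add_measure[OF sets12, of h] integral_add_measure[OF sets12, of h]
      by (simp add: sum_subtractf right_diff_distrib)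
  qed
  have sets_\<gamma>': "sets \<gamma>' = sets borel"
    by (simp add: \<gamma>'_def M1_def sets_\<gamma>)
  have emeasure_\<gamma>': "emeasure \<gamma>' S = emeasure \<gamma> S"
    if S [measurable]: "S \<in> sets borel" and eq: "(\<Sum>i<N. K i (indicator S)) = (\<Sum>i<N. I i (indicator S))" for S
  proof -
    have "integrable \<gamma>' (indicat_real S)" "integral\<^sup>L \<gamma>' (indicat_real S) = integral\<^sup>L \<gamma> (indicat_real S)"
      using \<gamma>'[of "indicat_real S" 1] eq by (auto simp: sum_subtractf indicator_def)
    then show ?thesis
      using S sets_\<gamma>' sets_eq_imp_space_eq[OF sets_\<gamma>'] space_\<gamma>
      by (simp add: emeasure_eq_measure integrable_indicator_iff emeasure_eq_ennreal_measure less_top)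
  qed
  have ind_int: "(\<integral>z. indicat_real (W i) z \<partial>\<gamma>) = m i" for i
    by (simp add: m_def space_\<gamma>)
  show ?thesis
  proof
    show "sets \<gamma>' = sets borel"
      by (fact sets_\<gamma>')
    show "emeasure \<gamma>' (A \<times> UNIV) = emeasure \<gamma> (A \<times> UNIV)" if [measurable]: "A \<in> sets borel" for A
    proof (rule emeasure_\<gamma>')
      show S: "A \<times> (UNIV :: 'b set) \<in> sets borel"
        unfolding borel_prod[symmetric] using that by (intro pair_measureI) auto
      have "K i (indicator (A \<times> UNIV)) = I i (indicator (A \<times> UNIV))" if "i < N" for i
      proof -
        have "(\<integral>w. indicator (W i) (fst w) * indicator (W (\<sigma> i)) (snd w) * indicat_real (A \<times> UNIV) (T w) \<partial>(\<gamma> \<Otimes>\<^sub>M \<gamma>))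
            = (\<integral>w. (indicator (W i) (fst w) * indicat_real (A \<times> UNIV) (fst w)) * indicator (W (\<sigma> i)) (snd w) \<partial>(\<gamma> \<Otimes>\<^sub>M \<gamma>))"
          by (intro Bochner_Integration.integral_cong) (auto simp: T_def indicator_def mem_Times_iff)
        also have "\<dots> = (\<integral>z. indicator (W i) z * indicat_real (A \<times> UNIV) z \<partial>\<gamma>) * m (\<sigma> i)"
          using S unfolding ind_int[symmetric]
          by (intro integral_pair_product[where B = 1 and C = 1]) (auto simp: indicator_def)
        finally show ?thesis
          using m[OF \<sigma>N[OF that]] by (simp add: K_def I_def)
      qed
      then show "(\<Sum>i<N. K i (indicator (A \<times> UNIV))) = (\<Sum>i<N. I i (indicator (A \<times> UNIV)))"
        by simp
    qed
    show "emeasure \<gamma>' (UNIV \<times> B) = emeasure \<gamma> (UNIV \<times> B)" if [measurable]: "B \<in> sets borel" for B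
    proof (rule emeasure_\<gamma>')
      show S: "(UNIV :: 'a set) \<times> B \<in> sets borel"
        unfolding borel_prod[symmetric] using that by (intro pair_measureI) auto
      \<comment> \<open>Added and removed mass agree in the second marginal only after the shift by
        \<open>\<sigma>\<close>; bijectivity enters when summing over \<open>i\<close>.\<close>
      have "K i (indicator (UNIV \<times> B)) = I (\<sigma> i) (indicator (UNIV \<times> B))" if "i < N" for i
      proof -
        have "(\<integral>w. indicator (W i) (fst w) * indicator (W (\<sigma> i)) (snd w) * indicat_real (UNIV \<times> B) (T w) \<partial>(\<gamma> \<Otimes>\<^sub>M \<gamma>))
            = (\<integral>w. indicator (W i) (fst w) * (indicator (W (\<sigma> i)) (snd w) * indicat_real (UNIV \<times> B) (snd w)) \<partial>(\<gamma> \<Otimes>\<^sub>M \<gamma>))"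
          by (intro Bochner_Integration.integral_cong) (auto simp: T_def indicator_def mem_Times_iff)
        also have "\<dots> = m i * (\<integral>z. indicator (W (\<sigma> i)) z * indicat_real (UNIV \<times> B) z \<partial>\<gamma>)"
          using S unfolding ind_int[symmetric]
          by (intro integral_pair_product[where B = 1 and C = 1]) (auto simp: indicator_def)
        finally show ?thesis
          using m[OF that] by (simp add: K_def I_def)
      qed
      then show "(\<Sum>i<N. K i (indicator (UNIV \<times> B))) = (\<Sum>i<N. I i (indicator (UNIV \<times> B)))"
        using sum.reindex_bij_betw[OF \<sigma>, of "\<lambda>i. I i (indicator (UNIV \<times> B))"] by simp
    qed
    have c_meas [measurable]: "c \<in> borel_measurable borel"
      using c by (rule borel_measurable_continuous_onI)
    have I: "I i c \<ge> c (p i) - \<epsilon>" if "i < N" for i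
    proof -
      have "(\<integral>z. (c (p i) - \<epsilon>) * indicator (W i) z \<partial>\<gamma>) \<le> (\<integral>z. indicator (W i) z * c z \<partial>\<gamma>)"
      proof (rule integral_mono)
        show "integrable \<gamma> (\<lambda>z. indicator (W i) z * c z)"
          using C by (intro integrable_const_bound[of _ C]) (auto simp: indicator_def intro: order_trans[OF abs_ge_zero])
        show "integrable \<gamma> (\<lambda>z. (c (p i) - \<epsilon>) * indicator (W i) z)"
          by (intro integrable_mult_right integrable_const_bound[of _ 1]) (auto simp: indicator_def)
        show "(c (p i) - \<epsilon>) * indicator (W i) z \<le> indicator (W i) z * c z" for z
          using cUV[of "fst z" i "snd z" i] that by (auto simp: indicator_def W_def)
      qed
      then have "(c (p i) - \<epsilon>) * m i \<le> I i c * m i"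
        using m[OF that] by (simp add: I_def m_def)
      then show ?thesis
        using m[OF that] by (simp add: mult_le_cancel_right)
    qed
    have K: "K i c \<le> c (fst (p i), snd (p (\<sigma> i))) + \<epsilon>" if "i < N" for i
    proof -
      define a where "a = c (fst (p i), snd (p (\<sigma> i))) + \<epsilon>"
      have "(\<integral>w. indicator (W i) (fst w) * indicator (W (\<sigma> i)) (snd w) * c (T w) \<partial>(\<gamma> \<Otimes>\<^sub>M \<gamma>))
          \<le> (\<integral>w. a * (indicator (W i) (fst w) * indicator (W (\<sigma> i)) (snd w)) \<partial>(\<gamma> \<Otimes>\<^sub>M \<gamma>))"
      proof (rule integral_mono)
        show "integrable (\<gamma> \<Otimes>\<^sub>M \<gamma>) (\<lambda>w. indicator (W i) (fst w) * indicator (W (\<sigma> i)) (snd w) * c (T w))"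
          using C by (intro pair.integrable_const_bound[of _ C]) (auto simp: indicator_def intro: order_trans[OF abs_ge_zero])
        show "integrable (\<gamma> \<Otimes>\<^sub>M \<gamma>) (\<lambda>w. a * (indicator (W i) (fst w) * indicator (W (\<sigma> i)) (snd w)))"
          by (intro integrable_mult_right pair.integrable_const_bound[of _ 1]) (auto simp: indicator_def)
        show "indicator (W i) (fst w) * indicator (W (\<sigma> i)) (snd w) * c (T w)
            \<le> a * (indicator (W i) (fst w) * indicator (W (\<sigma> i)) (snd w))" for w
          using cUV[of "fst (fst w)" i "snd (snd w)" "\<sigma> i"] that \<sigma>N[OF that]
          by (auto simp: indicator_def W_def T_def a_def)
      qed
      also have "\<dots> = a * (m i * m (\<sigma> i))"
      proof -
        have "(\<integral>w. indicator (W i) (fst w) * indicat_real (W (\<sigma> i)) (snd w) \<partial>(\<gamma> \<Otimes>\<^sub>M \<gamma>)) = m i * m (\<sigma> i)"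
          unfolding ind_int[symmetric]
          by (rule integral_pair_product[where B = 1 and C = 1]) (auto simp: indicator_def)
        then show ?thesis
          by simp
      qed
      finally show ?thesis
        using m[OF that] m[OF \<sigma>N[OF that]] unfolding K_def a_def[symmetric] by (simp add: divide_le_eq)
    qed
    have "(\<Sum>i<N. K i c - I i c) \<le> (\<Sum>i<N. (c (fst (p i), snd (p (\<sigma> i))) + \<epsilon>) - (c (p i) - \<epsilon>))"
      by (intro sum_mono diff_mono) (use K I in auto)
    also have "\<dots> = (\<Sum>i<N. c (fst (p i), snd (p (\<sigma> i)))) - (\<Sum>i<N. c (p i)) + 2 * (N * \<epsilon>)"
      by (simp add: sum.distrib sum_subtractf)
    also have "\<dots> < 0"
      using less \<open>N > 0\<close> by (simp add: \<epsilon>_def field_simps)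
    finally have "l * (\<Sum>i<N. K i c - I i c) < 0"
      using \<open>l > 0\<close> by (simp add: mult_pos_neg)
    then show "integral\<^sup>L \<gamma>' c < integral\<^sup>L \<gamma> c"
      using \<gamma>'[OF c_meas C] by simp
  qed
qed

text \<open>Arbitrary permutations replace cycles, which is equivalent by decomposition into
  disjoint cycles; the form suits both the exchange of mass and the closing of a chain.\<close>

definition cyclically_monotone :: "('a \<times> 'b \<Rightarrow> real) \<Rightarrow> ('a \<times> 'b) set \<Rightarrow> bool" where
  "cyclically_monotone c K \<longleftrightarrow> (\<forall>(N::nat) p \<sigma>. (\<forall>i<N. p i \<in> K) \<and> bij_betw \<sigma> {..<N} {..<N} \<longrightarrow>
     (\<Sum>i<N. c (p i)) \<le> (\<Sum>i<N. c (fst (p i), snd (p (\<sigma> i)))))"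

lemma has_marginals_borel_prob:
  assumes "has_marginals \<mu> \<nu> \<gamma>" "borel_prob \<mu>"
  shows "borel_prob \<gamma>"
proof -
  interpret \<mu>: prob_space \<mu>
    using assms by (simp add: borel_prob_def)
  have sets: "sets \<gamma> = sets borel" "sets \<mu> = sets borel"
    using assms by (auto simp: borel_prob_def has_marginals_def)
  have "emeasure \<gamma> (UNIV \<times> UNIV) = emeasure \<mu> UNIV"
    using assms by (simp add: has_marginals_def del: UNIV_Times_UNIV)
  then have "emeasure \<gamma> (space \<gamma>) = 1"
    using \<mu>.emeasure_space_1 sets_eq_imp_space_eq[OF sets(1)] sets_eq_imp_space_eq[OF sets(2)] by simp
  then show ?thesis
    using sets by (auto simp: borel_prob_def intro: prob_spaceI)
qed

lemma has_marginals_spt: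
  fixes \<mu> :: "'a::second_countable_topology measure" and \<nu> :: "'b::second_countable_topology measure"
  assumes marg: "has_marginals \<mu> \<nu> \<gamma>" and \<mu>: "borel_prob \<mu>" and \<nu>: "borel_prob \<nu>"
  shows "AE z in \<gamma>. z \<in> spt \<mu> \<times> spt \<nu>" "spt \<gamma> \<subseteq> spt \<mu> \<times> spt \<nu>"
proof -
  interpret prob_space \<gamma>
    using has_marginals_borel_prob[OF marg \<mu>] by (simp add: borel_prob_def)
  have sets: "sets \<gamma> = sets borel"
    using marg by (simp add: has_marginals_def)
  have closed: "closed (spt \<mu> \<times> UNIV)" "closed (UNIV \<times> spt \<nu>)"
    using spt_borel_prob(1)[OF \<mu>] spt_borel_prob(1)[OF \<nu>] by (auto intro: closed_Times)
  have one: "emeasure \<gamma> (spt \<mu> \<times> UNIV) = 1" "emeasure \<gamma> (UNIV \<times> spt \<nu>) = 1"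
    using marg spt_borel_prob[OF \<mu>] spt_borel_prob[OF \<nu>] by (auto simp: has_marginals_def)
  show "spt \<gamma> \<subseteq> spt \<mu> \<times> spt \<nu>"
    using closed one by (auto simp: spt_def[of \<gamma>])
  have "AE z in \<gamma>. z \<in> spt \<mu> \<times> UNIV" "AE z in \<gamma>. z \<in> UNIV \<times> spt \<nu>"
    using closed one sets by (auto intro!: AE_prob_1 simp: emeasure_eq_measure)
  then show "AE z in \<gamma>. z \<in> spt \<mu> \<times> spt \<nu>"
    by eventually_elim auto
qed

text \<open>A violation would produce a cheaper plan. The exchange asks for a bounded cost, whereas
  boundedness of \<open>c\<close> is available only on the compact product of the supports; every
  coupling is concentrated there.\<close>

lemma kantorovich_solution_cyclically_monotone:
  fixes \<mu> :: "'a::second_countable_topology measure" and \<nu> :: "'b::second_countable_topology measure"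
  assumes c: "continuous_on UNIV c" and \<mu>: "borel_prob \<mu>" "compact (spt \<mu>)" and \<nu>: "borel_prob \<nu>" "compact (spt \<nu>)"
    and sol: "kantorovich_solution c \<mu> \<nu> \<gamma>"
  shows "cyclically_monotone c (spt \<gamma>)"
  unfolding cyclically_monotone_def
proof (intro allI impI, rule ccontr)
  fix N :: nat and p \<sigma>
  assume "(\<forall>i<N. p i \<in> spt \<gamma>) \<and> bij_betw \<sigma> {..<N} {..<N}"
  then have p: "\<And>i. i < N \<Longrightarrow> p i \<in> spt \<gamma>" and \<sigma>: "bij_betw \<sigma> {..<N} {..<N}"
    by auto
  assume less: "\<not> (\<Sum>i<N. c (p i)) \<le> (\<Sum>i<N. c (fst (p i), snd (p (\<sigma> i))))"
  have marg: "has_marginals \<mu> \<nu> \<gamma>"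
    using sol by (simp add: kantorovich_solution_def)
  have "compact (c ` (spt \<mu> \<times> spt \<nu>))"
    using c \<mu>(2) \<nu>(2) by (intro compact_continuous_image compact_Times) (auto intro: continuous_on_subset)
  from compact_imp_bounded[OF this] obtain C where C: "\<And>z. z \<in> spt \<mu> \<times> spt \<nu> \<Longrightarrow> \<bar>c z\<bar> \<le> C"
    by (auto simp: bounded_iff)
  \<comment> \<open>The truncated cost is bounded and agrees with \<open>c\<close> where the couplings live.\<close>
  define c' where "c' z = max (- \<bar>C\<bar>) (min \<bar>C\<bar> (c z))" for z
  have c'_eq: "c' z = c z" if "z \<in> spt \<mu> \<times> spt \<nu>" for z
    using C[OF that] by (auto simp: c'_def)
  have c'_cont: "continuous_on UNIV c'"
    unfolding c'_def[abs_def] by (intro continuous_intros c)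
  have int_eq: "integral\<^sup>L \<gamma>' c' = integral\<^sup>L \<gamma>' c" if "has_marginals \<mu> \<nu> \<gamma>'" for \<gamma>'
  proof (rule integral_cong_AE)
    have "sets \<gamma>' = sets borel"
      using that by (simp add: has_marginals_def)
    from measurable_cong_sets[OF this refl] show "c' \<in> borel_measurable \<gamma>'" "c \<in> borel_measurable \<gamma>'"
      using c c'_cont by (auto intro: borel_measurable_continuous_onI)
    show "AE z in \<gamma>'. c' z = c z"
      using has_marginals_spt(1)[OF that \<mu>(1) \<nu>(1)] by eventually_elim (rule c'_eq)
  qed
  have p': "(fst (p i), snd (p j)) \<in> spt \<mu> \<times> spt \<nu>" if "i < N" "j < N" for i j
    using has_marginals_spt(2)[OF marg \<mu>(1) \<nu>(1)] p[OF that(1)] p[OF that(2)] by auto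
  have "(\<Sum>i<N. c' (fst (p i), snd (p (\<sigma> i)))) = (\<Sum>i<N. c (fst (p i), snd (p (\<sigma> i))))"
    using bij_betwE[OF \<sigma>] by (intro sum.cong refl c'_eq p') auto
  moreover have "(\<Sum>i<N. c' (p i)) = (\<Sum>i<N. c (p i))"
    using p'[of i i for i] by (intro sum.cong refl c'_eq) (simp add: mem_Times_iff)
  ultimately have less': "(\<Sum>i<N. c' (fst (p i), snd (p (\<sigma> i)))) < (\<Sum>i<N. c' (p i))"
    using less by simp
  have bound: "\<bar>c' z\<bar> \<le> \<bar>C\<bar>" for z
    by (auto simp: c'_def)
  obtain \<gamma>' where \<gamma>': "sets \<gamma>' = sets borel"
    "\<And>A. A \<in> sets borel \<Longrightarrow> emeasure \<gamma>' (A \<times> UNIV) = emeasure \<gamma> (A \<times> UNIV)"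
    "\<And>B. B \<in> sets borel \<Longrightarrow> emeasure \<gamma>' (UNIV \<times> B) = emeasure \<gamma> (UNIV \<times> B)"
    "integral\<^sup>L \<gamma>' c' < integral\<^sup>L \<gamma> c'"
    using exists_cheaper_coupling[OF has_marginals_borel_prob[OF marg \<mu>(1)] c'_cont bound p \<sigma> less'] by blast
  then have marg': "has_marginals \<mu> \<nu> \<gamma>'"
    using marg by (simp add: has_marginals_def)
  then have "integral\<^sup>L \<gamma> c \<le> integral\<^sup>L \<gamma>' c"
    using sol by (simp add: kantorovich_solution_def)
  with \<gamma>'(4) int_eq[OF marg] int_eq[OF marg'] show False
    by simp
qed

text \<open>
  In Rockafellar's construction, \<open>R\<close> collects the ends of the chains in \<open>K\<close> that start at a base
  point, together with their values.
\<close>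

lemma cyclically_monotone_potential:
  assumes mono: "cyclically_monotone c K" and "K \<noteq> {}" and X: "compact X" "fst ` K \<subseteq> X"
    and c: "continuous_on UNIV c"
  obtains R \<psi> where "R \<noteq> {}" "fst ` R \<subseteq> X"
    "\<forall>y. bdd_above ((\<lambda>(x, t). t - c (x, y)) ` R)" "\<forall>y. \<psi> y = (SUP (x, t)\<in>R. t - c (x, y))"
    "\<forall>x y y'. (x, y) \<in> K \<longrightarrow> \<psi> y + c (x, y) \<le> \<psi> y' + c (x, y')"
proof -
  obtain z0 where z0: "z0 \<in> K"
    using \<open>K \<noteq> {}\<close> by auto
  \<comment> \<open>Value of the chain \<open>p 0, ..., p N\<close>: \<open>N + 1\<close> visits but
    \<open>N\<close> links. The link out of \<open>p N\<close> is left open, and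
    \<open>- c (x, y)\<close> supplies it in \<open>\<psi> y\<close>.\<close>
  define val where "val N p = (\<Sum>i<Suc N. c (p i)) - (\<Sum>i<N. c (fst (p i), snd (p (Suc i))))" for N p
  define R where "R = {(fst (p N), val N p) |N p. p 0 = z0 \<and> (\<forall>i\<le>N. p i \<in> K)}"
  \<comment> \<open>A chain can be prolonged by any point of \<open>K\<close>. Applied to the point
    at which minimality is claimed, this gives the inequality for \<open>\<psi>\<close>.\<close>
  have R_step: "(fst z, t - c (x, snd z) + c z) \<in> R" if xt: "(x, t) \<in> R" and z: "z \<in> K" for x t z
  proof -
    obtain N p where p: "x = fst (p N)" "t = val N p" "p 0 = z0" "\<forall>i\<le>N. p i \<in> K"
      using xt by (auto simp: R_def)
    define q where "q = p(Suc N := z)"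
    have "(\<Sum>i<Suc N. c (q i)) = (\<Sum>i<Suc N. c (p i))"
      by (intro sum.cong) (auto simp: q_def)
    moreover have "(\<Sum>i<N. c (fst (q i), snd (q (Suc i)))) = (\<Sum>i<N. c (fst (p i), snd (p (Suc i))))"
      by (intro sum.cong) (auto simp: q_def)
    ultimately have "val (Suc N) q = t - c (x, snd z) + c z"
      unfolding val_def sum.lessThan_Suc[of _ "Suc N"] p(1,2) by (simp add: q_def)
    moreover have "q (Suc N) = z" "q 0 = z0" "\<forall>i\<le>Suc N. q i \<in> K"
      using p z by (auto simp: q_def)
    moreover from this(2,3) have "(fst (q (Suc N)), val (Suc N) q) \<in> R"
      unfolding R_def by blast
    ultimately show ?thesis
      by simp
  qed
  \<comment> \<open>Returning to \<open>z0\<close> closes the chain to a cycle, whose value cyclical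
    monotonicity bounds. With compactness of \<open>X\<close> this makes \<open>\<psi>\<close>
    finite at every \<open>y\<close>, also outside the projection of \<open>K\<close>.\<close>
  have R_le: "t \<le> c (x, snd z0)" and R_X: "x \<in> X" if xt: "(x, t) \<in> R" for x t
  proof -
    obtain N p where p: "x = fst (p N)" "t = val N p" "p 0 = z0" "\<forall>i\<le>N. p i \<in> K"
      using xt by (auto simp: R_def)
    show "x \<in> X"
      using p X by auto
    define \<sigma> where "\<sigma> i = (if i < N then Suc i else 0)" for i
    have "inj_on \<sigma> {..<Suc N}"
      by (auto simp: inj_on_def \<sigma>_def split: if_splits)
    moreover have "\<sigma> ` {..<Suc N} \<subseteq> {..<Suc N}"
      by (auto simp: \<sigma>_def)
    ultimately have "bij_betw \<sigma> {..<Suc N} {..<Suc N}"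
      by (simp add: bij_betw_def endo_inj_surj)
    then have "(\<Sum>i<Suc N. c (p i)) \<le> (\<Sum>i<Suc N. c (fst (p i), snd (p (\<sigma> i))))"
      using mono p(4) unfolding cyclically_monotone_def by (metis less_Suc_eq_le)
    also have "\<dots> = (\<Sum>i<N. c (fst (p i), snd (p (Suc i)))) + c (x, snd z0)"
      using p by (simp add: \<sigma>_def)
    finally show "t \<le> c (x, snd z0)"
      by (simp add: p(2) val_def)
  qed
  have "(fst z0, val 0 (\<lambda>_. z0)) \<in> R"
    unfolding R_def using z0 by (intro CollectI exI[of _ 0] exI[of _ "\<lambda>_. z0"]) simp
  then have "R \<noteq> {}"
    by auto
  have bdd: "bdd_above ((\<lambda>(x, t). t - c (x, y)) ` R)" for y
  proof -
    have "continuous_on X (\<lambda>x. c (x, snd z0) - c (x, y))"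
      by (intro continuous_on_diff continuous_on_compose2[OF c] continuous_intros) auto
    from compact_continuous_image[OF this X(1)]
    have "bdd_above ((\<lambda>x. c (x, snd z0) - c (x, y)) ` X)"
      by (intro bounded_imp_bdd_above compact_imp_bounded)
    then obtain B where B: "\<And>x. x \<in> X \<Longrightarrow> c (x, snd z0) - c (x, y) \<le> B"
      by (auto simp: bdd_above_def)
    have "t - c (x, y) \<le> B" if "(x, t) \<in> R" for x t
      using R_le[OF that] B[OF R_X[OF that]] by simp
    then show ?thesis
      by (intro bdd_aboveI[of _ B]) auto
  qed
  define \<psi> where "\<psi> y = (SUP (x, t)\<in>R. t - c (x, y))" for y
  have "\<psi> y + c (x, y) \<le> \<psi> y' + c (x, y')" if "(x, y) \<in> K" for x y y'
  proof -
    have "\<psi> y \<le> \<psi> y' + c (x, y') - c (x, y)"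
      unfolding \<psi>_def[of y]
    proof (rule cSUP_least[OF \<open>R \<noteq> {}\<close>], clarify)
      fix x' t
      assume "(x', t) \<in> R"
      from cSUP_upper[OF R_step[OF this that] bdd[of y']]
      show "t - c (x', y) \<le> \<psi> y' + c (x, y') - c (x, y)"
        by (simp add: \<psi>_def)
    qed
    then show ?thesis
      by simp
  qed
  then show ?thesis
    using that[of R \<psi>] \<open>R \<noteq> {}\<close> R_X bdd \<psi>_def by fastforce
qed

section \<open>Smooth functions and charts\<close>

lemma Ck_on_cong:
  assumes "Ck_on k S f" "open S" "\<And>x. x \<in> S \<Longrightarrow> f x = g x"
  shows "Ck_on k S g"
  using assms
proof (induction k arbitrary: f g)
  case 0
  then show ?case
    using continuous_on_cong[of S S f g] by simp
next
  case (Suc k)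
  have D: "(g has_derivative frechet_derivative f (at x)) (at x)" if "x \<in> S" for x
    using Suc.prems that
    by (auto intro!: has_derivative_transform_within_open[of f _ x UNIV S g] simp: frechet_derivative_works[symmetric])
  then have "g differentiable (at x)" if "x \<in> S" for x
    using that by (auto simp: differentiable_def)
  moreover have "Ck_on k S (\<lambda>x. frechet_derivative g (at x) v)" for v
  proof (rule Suc.IH[of "\<lambda>x. frechet_derivative f (at x) v"])
    show "Ck_on k S (\<lambda>x. frechet_derivative f (at x) v)"
      using Suc.prems(1) by simp
    show "frechet_derivative f (at x) v = frechet_derivative g (at x) v" if "x \<in> S" for x
      using frechet_derivative_at[OF D[OF that]] by simp
  qed (fact Suc.prems(2))
  ultimately show ?case
    by simp
qed

lemma Ck_on_subset: "Ck_on k S f \<Longrightarrow> T \<subseteq> S \<Longrightarrow> Ck_on k T f"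
  by (induction k arbitrary: f) (auto intro: continuous_on_subset)

text \<open>Only linear inner and outer maps are composed: nonlinear coordinate changes are
  transitions of the given atlases, smooth by assumption. The directional derivative of the
  composite is again a composite with \<open>L\<close>, so the induction closes without a product
  rule.\<close>

lemma Ck_on_compose_linear:
  fixes L :: "'d::euclidean_space \<Rightarrow> 'e::euclidean_space"
  assumes "linear L" "Ck_on k S f" "open T" "L ` T \<subseteq> S"
  shows "Ck_on k T (\<lambda>x. f (L x))"
  using assms(2)
proof (induction k arbitrary: f)
  case 0
  then show ?case
    using assms continuous_on_compose2[of S f T L] linear_continuous_on[of L T]
    by (simp add: linear_conv_bounded_linear)
next
  case (Suc k)
  have D: "((\<lambda>x. f (L x)) has_derivative (\<lambda>v. frechet_derivative f (at (L x)) (L v))) (at x)" if "x \<in> T" for x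
  proof (rule has_derivative_compose[where f = L and g = f])
    show "(L has_derivative L) (at x)"
      using assms(1) by (simp add: linear_imp_has_derivative)
    show "(f has_derivative frechet_derivative f (at (L x))) (at (L x))"
      using Suc.prems assms(4) that by (auto simp: frechet_derivative_works[symmetric])
  qed
  then have "(\<lambda>x. f (L x)) differentiable (at x)" if "x \<in> T" for x
    using that by (auto simp: differentiable_def)
  moreover have "Ck_on k T (\<lambda>x. frechet_derivative (\<lambda>x. f (L x)) (at x) v)" for v
  proof (rule Ck_on_cong[OF _ assms(3)])
    show "Ck_on k T (\<lambda>x. frechet_derivative f (at (L x)) (L v))"
      using Suc.prems by (intro Suc.IH[of "\<lambda>y. frechet_derivative f (at y) (L v)"]) simp
    show "frechet_derivative f (at (L x)) (L v) = frechet_derivative (\<lambda>x. f (L x)) (at x) v" if "x \<in> T" for x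
      using frechet_derivative_at[OF D[OF that]] by metis
  qed
  ultimately show ?case
    by simp
qed

lemma Ck_on_linear_compose:
  fixes f :: "'d::euclidean_space \<Rightarrow> 'e::real_normed_vector"
  assumes "bounded_linear L" "Ck_on k S f" "open S"
  shows "Ck_on k S (\<lambda>x. L (f x))"
  using assms(2)
proof (induction k arbitrary: f)
  case 0
  then show ?case
    using assms(1) by (auto intro: bounded_linear.continuous_on)
next
  case (Suc k)
  have D: "((\<lambda>x. L (f x)) has_derivative (\<lambda>v. L (frechet_derivative f (at x) v))) (at x)" if "x \<in> S" for x
    using Suc.prems that
    by (intro bounded_linear.has_derivative[OF assms(1)]) (auto simp: frechet_derivative_works[symmetric])
  then have "(\<lambda>x. L (f x)) differentiable (at x)" if "x \<in> S" for x
    using that by (auto simp: differentiable_def)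
  moreover have "Ck_on k S (\<lambda>x. frechet_derivative (\<lambda>x. L (f x)) (at x) v)" for v
  proof (rule Ck_on_cong[OF _ assms(3)])
    show "Ck_on k S (\<lambda>x. L (frechet_derivative f (at x) v))"
      using Suc.prems by (intro Suc.IH) simp
    show "L (frechet_derivative f (at x) v) = frechet_derivative (\<lambda>x. L (f x)) (at x) v" if "x \<in> S" for x
      using frechet_derivative_at[OF D[OF that]] by metis
  qed
  ultimately show ?case
    by simp
qed

lemma Ck_on_add:
  fixes f g :: "'d::euclidean_space \<Rightarrow> 'e::real_normed_vector"
  assumes "Ck_on k S f" "Ck_on k S g" "open S"
  shows "Ck_on k S (\<lambda>x. f x + g x)"
  using assms(1,2)
proof (induction k arbitrary: f g)
  case 0
  then show ?case
    by (auto intro: continuous_on_add)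
next
  case (Suc k)
  have D: "((\<lambda>x. f x + g x) has_derivative (\<lambda>v. frechet_derivative f (at x) v + frechet_derivative g (at x) v)) (at x)"
    if "x \<in> S" for x
    using Suc.prems that
    by (intro has_derivative_add) (auto simp: frechet_derivative_works[symmetric])
  then have "(\<lambda>x. f x + g x) differentiable (at x)" if "x \<in> S" for x
    using that by (auto simp: differentiable_def)
  moreover have "Ck_on k S (\<lambda>x. frechet_derivative (\<lambda>x. f x + g x) (at x) v)" for v
  proof (rule Ck_on_cong[OF _ assms(3)])
    show "Ck_on k S (\<lambda>x. frechet_derivative f (at x) v + frechet_derivative g (at x) v)"
      using Suc.prems by (intro Suc.IH) simp_all
    show "frechet_derivative f (at x) v + frechet_derivative g (at x) v = frechet_derivative (\<lambda>x. f x + g x) (at x) v"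
      if "x \<in> S" for x
      using frechet_derivative_at[OF D[OF that]] by metis
  qed
  ultimately show ?case
    by simp
qed

text \<open>\<open>map_prod f g\<close> is a sum of \<open>f\<close> and \<open>g\<close>, each
  between a projection and an inclusion, so linear compositions and addition suffice.\<close>

lemma smooth_on_map_prod:
  fixes f :: "'d::euclidean_space \<Rightarrow> 'd2::euclidean_space" and g :: "'e::euclidean_space \<Rightarrow> 'e2::euclidean_space"
  assumes "smooth_on S f" "smooth_on T g" "open S" "open T"
  shows "smooth_on (S \<times> T) (map_prod f g)"
  unfolding smooth_on_def
proof
  fix k
  have ST: "open (S \<times> T)"
    using assms by (simp add: open_Times)
  have f: "Ck_on k (S \<times> T) (\<lambda>z. f (fst z))"
    using assms by (intro Ck_on_compose_linear[OF linear_fst _ ST]) (auto simp: smooth_on_def)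
  have g: "Ck_on k (S \<times> T) (\<lambda>z. g (snd z))"
    using assms by (intro Ck_on_compose_linear[OF linear_snd _ ST]) (auto simp: smooth_on_def)
  have "bounded_linear (\<lambda>x. (x, 0))" "bounded_linear (Pair 0)"
    by (intro bounded_linear_Pair bounded_linear_ident bounded_linear_zero)+
  from Ck_on_add[OF Ck_on_linear_compose[OF this(1) f ST] Ck_on_linear_compose[OF this(2) g ST] ST]
  show "Ck_on k (S \<times> T) (map_prod f g)"
    by (rule Ck_on_cong[OF _ ST]) (auto simp: map_prod_def)
qed

section \<open>Charts, products of charts and product atlases\<close>

lemma chart_inv_map [simp]: "is_chart \<kappa> \<Longrightarrow> x \<in> chart_dom \<kappa> \<Longrightarrow> chart_inv \<kappa> (chart_map \<kappa> x) = x"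
  by (auto simp: is_chart_def homeomorphism_def)

lemma chart_inj_on: "is_chart \<kappa> \<Longrightarrow> inj_on (chart_map \<kappa>) (chart_dom \<kappa>)"
  by (metis chart_inv_map inj_onI)

lemma continuous_on_chart_map: "is_chart \<kappa> \<Longrightarrow> continuous_on (chart_dom \<kappa>) (chart_map \<kappa>)"
  unfolding is_chart_def homeomorphism_def by blast

lemma continuous_on_chart_inv: "is_chart \<kappa> \<Longrightarrow> continuous_on (chart_cod \<kappa>) (chart_inv \<kappa>)"
  unfolding is_chart_def homeomorphism_def by blast

lemma is_chartI:
  assumes "open (chart_dom \<kappa>)" "open (chart_cod \<kappa>)" "inj_on (chart_map \<kappa>) (chart_dom \<kappa>)"
    "continuous_on (chart_dom \<kappa>) (chart_map \<kappa>)" "continuous_on (chart_cod \<kappa>) g"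
    "\<And>x. x \<in> chart_dom \<kappa> \<Longrightarrow> g (chart_map \<kappa> x) = x"
  shows "is_chart \<kappa>"
proof -
  have eq: "chart_inv \<kappa> u = g u" if "u \<in> chart_cod \<kappa>" for u
    using that assms(3,6) by (auto simp: chart_inv_def the_inv_into_f_f)
  then have "continuous_on (chart_cod \<kappa>) (chart_inv \<kappa>)"
    using assms(5) continuous_on_cong by metis
  moreover have left: "chart_inv \<kappa> (chart_map \<kappa> x) = x" if "x \<in> chart_dom \<kappa>" for x
    using eq[of "chart_map \<kappa> x"] assms(6)[OF that] that by simp
  moreover have "chart_inv \<kappa> ` chart_cod \<kappa> = chart_dom \<kappa>"
    using left by force
  ultimately show ?thesis
    using assms(1-4) unfolding is_chart_def homeomorphism_def by auto
qed

lemma chart_dom_prod_chart [simp]: "chart_dom (prod_chart \<kappa> \<eta>) = chart_dom \<kappa> \<times> chart_dom \<eta>"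
  by (simp add: prod_chart_def)

lemma chart_map_prod_chart [simp]: "chart_map (prod_chart \<kappa> \<eta>) = map_prod (chart_map \<kappa>) (chart_map \<eta>)"
  by (simp add: prod_chart_def)

lemma chart_cod_prod_chart: "chart_cod (prod_chart \<kappa> \<eta>) = chart_cod \<kappa> \<times> chart_cod \<eta>"
  by (auto simp: image_iff)

lemma is_chart_prod_chart:
  assumes \<kappa>: "is_chart \<kappa>" and \<eta>: "is_chart \<eta>"
  shows "is_chart (prod_chart \<kappa> \<eta>)"
proof (rule is_chartI[where g = "map_prod (chart_inv \<kappa>) (chart_inv \<eta>)"])
  show "inj_on (chart_map (prod_chart \<kappa> \<eta>)) (chart_dom (prod_chart \<kappa> \<eta>))"
    using chart_inj_on[OF \<kappa>] chart_inj_on[OF \<eta>] by (auto simp: inj_on_def)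
  show "continuous_on (chart_dom (prod_chart \<kappa> \<eta>)) (chart_map (prod_chart \<kappa> \<eta>))"
    unfolding chart_dom_prod_chart chart_map_prod_chart map_prod_def split_beta
    by (intro continuous_on_Pair continuous_on_compose2[OF continuous_on_chart_map[OF \<kappa>]]
        continuous_on_compose2[OF continuous_on_chart_map[OF \<eta>]] continuous_intros) auto
  show "continuous_on (chart_cod (prod_chart \<kappa> \<eta>)) (map_prod (chart_inv \<kappa>) (chart_inv \<eta>))"
    unfolding chart_cod_prod_chart map_prod_def split_beta
    by (intro continuous_on_Pair continuous_on_compose2[OF continuous_on_chart_inv[OF \<kappa>]]
        continuous_on_compose2[OF continuous_on_chart_inv[OF \<eta>]] continuous_intros) auto
  show "open (chart_dom (prod_chart \<kappa> \<eta>))" "open (chart_cod (prod_chart \<kappa> \<eta>))"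
    unfolding chart_cod_prod_chart unfolding chart_dom_prod_chart using assms by (auto simp: is_chart_def intro!: open_Times)
qed (use assms in auto)

lemma chart_inv_prod_chart:
  assumes "is_chart \<kappa>" "is_chart \<eta>" "u \<in> chart_cod \<kappa>" "v \<in> chart_cod \<eta>"
  shows "chart_inv (prod_chart \<kappa> \<eta>) (u, v) = (chart_inv \<kappa> u, chart_inv \<eta> v)"
proof -
  obtain x y where "u = chart_map \<kappa> x" "v = chart_map \<eta> y" "x \<in> chart_dom \<kappa>" "y \<in> chart_dom \<eta>"
    using assms by blast
  then show ?thesis
    using chart_inv_map[OF is_chart_prod_chart[OF assms(1,2)], of "(x, y)"] assms by simp
qed

lemma open_chart_image:
  assumes "is_chart \<kappa>" "open W" "W \<subseteq> chart_dom \<kappa>"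
  shows "open (chart_map \<kappa> ` W)"
proof -
  have "chart_map \<kappa> ` W = chart_cod \<kappa> \<inter> chart_inv \<kappa> -` W"
    using assms(1,3) by force
  moreover have "open (chart_cod \<kappa> \<inter> chart_inv \<kappa> -` W)"
    using assms(1,2) continuous_on_chart_inv[OF assms(1)]
    by (intro continuous_open_preimage) (auto simp: is_chart_def)
  ultimately show ?thesis
    by simp
qed

lemma open_chart_preimage:
  assumes "is_chart \<kappa>" "open U"
  shows "open (chart_dom \<kappa> \<inter> chart_map \<kappa> -` U)"
  using assms continuous_on_chart_map[OF assms(1)]
  by (intro continuous_open_preimage) (auto simp: is_chart_def)

lemma smooth_compat_prod_chart:
  fixes \<kappa> \<kappa>' :: "('a::topological_space, 'e::euclidean_space) chart"
    and \<eta> \<eta>' :: "('b::topological_space, 'f::euclidean_space) chart"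
  assumes "is_chart \<kappa>" "is_chart \<kappa>'" "is_chart \<eta>" "is_chart \<eta>'" "smooth_compat \<kappa> \<kappa>'" "smooth_compat \<eta> \<eta>'"
  shows "smooth_compat (prod_chart \<kappa> \<eta>) (prod_chart \<kappa>' \<eta>')"
proof -
  have *: "smooth_on (chart_map (prod_chart \<kappa> \<eta>) ` (chart_dom (prod_chart \<kappa> \<eta>) \<inter> chart_dom (prod_chart \<kappa>' \<eta>')))
      (chart_map (prod_chart \<kappa>' \<eta>') \<circ> chart_inv (prod_chart \<kappa> \<eta>))"
    if charts: "is_chart \<kappa>" "is_chart \<kappa>'" "is_chart \<eta>" "is_chart \<eta>'"
      and \<kappa>: "smooth_on (chart_map \<kappa> ` (chart_dom \<kappa> \<inter> chart_dom \<kappa>')) (chart_map \<kappa>' \<circ> chart_inv \<kappa>)"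
      and \<eta>: "smooth_on (chart_map \<eta> ` (chart_dom \<eta> \<inter> chart_dom \<eta>')) (chart_map \<eta>' \<circ> chart_inv \<eta>)"
    for \<kappa> \<kappa>' :: "('a, 'e) chart" and \<eta> \<eta>' :: "('b, 'f) chart"
  proof -
    have sets: "chart_map (prod_chart \<kappa> \<eta>) ` (chart_dom (prod_chart \<kappa> \<eta>) \<inter> chart_dom (prod_chart \<kappa>' \<eta>'))
        = chart_map \<kappa> ` (chart_dom \<kappa> \<inter> chart_dom \<kappa>') \<times> chart_map \<eta> ` (chart_dom \<eta> \<inter> chart_dom \<eta>')"
      by (auto simp: image_iff)
    have opn: "open (chart_map \<kappa> ` (chart_dom \<kappa> \<inter> chart_dom \<kappa>'))" "open (chart_map \<eta> ` (chart_dom \<eta> \<inter> chart_dom \<eta>'))"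
      using charts by (auto intro!: open_chart_image simp: is_chart_def)
    have "Ck_on k (chart_map \<kappa> ` (chart_dom \<kappa> \<inter> chart_dom \<kappa>') \<times> chart_map \<eta> ` (chart_dom \<eta> \<inter> chart_dom \<eta>'))
      (chart_map (prod_chart \<kappa>' \<eta>') \<circ> chart_inv (prod_chart \<kappa> \<eta>))" for k
    proof (rule Ck_on_cong)
      show "Ck_on k (chart_map \<kappa> ` (chart_dom \<kappa> \<inter> chart_dom \<kappa>') \<times> chart_map \<eta> ` (chart_dom \<eta> \<inter> chart_dom \<eta>'))
          (map_prod (chart_map \<kappa>' \<circ> chart_inv \<kappa>) (chart_map \<eta>' \<circ> chart_inv \<eta>))"
        using smooth_on_map_prod[OF \<kappa> \<eta> opn] by (simp add: smooth_on_def)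
    qed (use opn charts in \<open>auto intro!: open_Times simp: chart_inv_prod_chart\<close>)
    then show ?thesis
      unfolding sets smooth_on_def by blast
  qed
  show ?thesis
    unfolding smooth_compat_def
    using *[of \<kappa> \<kappa>' \<eta> \<eta>'] *[of \<kappa>' \<kappa> \<eta>' \<eta>] assms by (simp add: smooth_compat_def Int_commute)
qed

lemma prod_chart_in_prod_atlas: "\<kappa> \<in> \<A> \<Longrightarrow> \<eta> \<in> \<B> \<Longrightarrow> prod_chart \<kappa> \<eta> \<in> prod_atlas \<A> \<B>"
  unfolding prod_atlas_def by blast

lemma smooth_atlas_prod_atlas:
  assumes "smooth_atlas \<A>" "smooth_atlas \<B>"
  shows "smooth_atlas (prod_atlas \<A> \<B>)"
proof -
  have "is_chart \<omega>" if "\<omega> \<in> prod_atlas \<A> \<B>" for \<omega>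
    using that assms by (auto simp: prod_atlas_def smooth_atlas_def is_chart_prod_chart)
  moreover have "\<exists>\<omega>\<in>prod_atlas \<A> \<B>. z \<in> chart_dom \<omega>" for z
  proof -
    obtain \<kappa> \<eta> where "\<kappa> \<in> \<A>" "\<eta> \<in> \<B>" "fst z \<in> chart_dom \<kappa>" "snd z \<in> chart_dom \<eta>"
      using assms unfolding smooth_atlas_def by (metis UN_E UNIV_I)
    then show ?thesis
      by (intro bexI[OF _ prod_chart_in_prod_atlas]) (simp_all add: mem_Times_iff)
  qed
  moreover have "smooth_compat \<omega> \<omega>'" if "\<omega> \<in> prod_atlas \<A> \<B>" "\<omega>' \<in> prod_atlas \<A> \<B>" for \<omega> \<omega>'
    using that assms unfolding prod_atlas_def smooth_atlas_def by (auto intro!: smooth_compat_prod_chart)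
  ultimately show ?thesis
    unfolding smooth_atlas_def by blast
qed

text \<open>The coordinates \<open>(u, v)\<close> mix both factors and so in general belong to no
  product chart; this places them in the maximal atlas. The free choice of \<open>W\<close> lets the
  chart be shrunk into a prescribed neighbourhood.\<close>

lemma linear_rechart:
  fixes \<omega> :: "('p::topological_space, 'e::euclidean_space) chart" and \<Phi> :: "'e \<Rightarrow> 'e"
  assumes atlas: "smooth_atlas \<C>" and \<omega>: "\<omega> \<in> \<C>" and \<Phi>: "linear \<Phi>" "inj \<Phi>" and W: "open W" "W \<subseteq> chart_dom \<omega>"
  shows "(W, \<Phi> \<circ> chart_map \<omega>) \<in> smooth_charts \<C>" (is "?\<zeta> \<in> _")
proof -
  obtain \<Psi> where \<Psi>: "linear \<Psi>" "\<And>z. \<Psi> (\<Phi> z) = z" "\<And>p. \<Phi> (\<Psi> p) = p"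
    using linear_injective_isomorphism[OF \<Phi>] by blast
  have cont: "continuous_on S \<Phi>" "continuous_on S \<Psi>" for S
    using \<Phi>(1) \<Psi>(1) by (auto intro: linear_continuous_on simp: linear_conv_bounded_linear)
  have chart: "is_chart \<omega>"
    using atlas \<omega> by (simp add: smooth_atlas_def)
  have open_\<Phi>: "open (\<Phi> ` U)" if "open U" for U
  proof -
    have "\<Phi> ` U = \<Psi> -` U"
      using \<Psi>(2,3) by (auto intro: image_eqI[OF sym])
    then show ?thesis
      using cont(2)[of UNIV] that by (simp add: open_vimage)
  qed
  have \<zeta>: "is_chart ?\<zeta>"
  proof (rule is_chartI[where g = "chart_inv \<omega> \<circ> \<Psi>"])
    show "inj_on (chart_map ?\<zeta>) (chart_dom ?\<zeta>)"
      using chart_inj_on[OF chart] W(2) inj_on_subset[OF \<Phi>(2)] by (auto intro!: comp_inj_on intro: inj_on_subset)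
    show "open (chart_cod ?\<zeta>)"
      using open_\<Phi>[OF open_chart_image[OF chart W]] by (simp add: image_comp)
    show "continuous_on (chart_dom ?\<zeta>) (chart_map ?\<zeta>)"
      using continuous_on_subset[OF continuous_on_chart_map[OF chart] W(2)] cont
      unfolding fst_conv snd_conv by (intro continuous_on_compose)
    show "continuous_on (chart_cod ?\<zeta>) (chart_inv \<omega> \<circ> \<Psi>)"
      using W(2) \<Psi>(2)
      by (intro continuous_on_compose cont continuous_on_subset[OF continuous_on_chart_inv[OF chart]]) auto
  qed (use W \<Psi> chart in auto)
  have inv_\<zeta>: "chart_inv ?\<zeta> p = chart_inv \<omega> (\<Psi> p)" if "p \<in> chart_cod ?\<zeta>" for p
    using that chart_inv_map[OF \<zeta>] chart_inv_map[OF chart] W(2) \<Psi>(2) by auto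
  have "smooth_compat ?\<zeta> \<eta>" if "\<eta> \<in> \<C>" for \<eta>
  proof -
    have \<eta>: "is_chart \<eta>"
      using atlas that by (simp add: smooth_atlas_def)
    have compat: "smooth_on (chart_map \<omega> ` (chart_dom \<omega> \<inter> chart_dom \<eta>)) (chart_map \<eta> \<circ> chart_inv \<omega>)"
      "smooth_on (chart_map \<eta> ` (chart_dom \<omega> \<inter> chart_dom \<eta>)) (chart_map \<omega> \<circ> chart_inv \<eta>)"
      using atlas \<omega> that by (auto simp: smooth_atlas_def smooth_compat_def)
    have opn: "open (W \<inter> chart_dom \<eta>)"
      using W \<eta> by (auto simp: is_chart_def)
    have "Ck_on k (chart_map ?\<zeta> ` (chart_dom ?\<zeta> \<inter> chart_dom \<eta>)) (chart_map \<eta> \<circ> chart_inv ?\<zeta>)" for k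
    proof (rule Ck_on_cong)
      show opn': "open (chart_map ?\<zeta> ` (chart_dom ?\<zeta> \<inter> chart_dom \<eta>))"
        using opn by (intro open_chart_image[OF \<zeta>]) auto
      have "Ck_on k (chart_map ?\<zeta> ` (chart_dom ?\<zeta> \<inter> chart_dom \<eta>)) (\<lambda>p. (chart_map \<eta> \<circ> chart_inv \<omega>) (\<Psi> p))"
        using compat(1) W(2) \<Psi>(2)
        by (intro Ck_on_compose_linear[OF \<Psi>(1) _ opn', of _ "chart_map \<omega> ` (chart_dom \<omega> \<inter> chart_dom \<eta>)"])
          (auto simp: smooth_on_def comp_def)
      then show "Ck_on k (chart_map ?\<zeta> ` (chart_dom ?\<zeta> \<inter> chart_dom \<eta>)) (chart_map \<eta> \<circ> chart_inv \<omega> \<circ> \<Psi>)"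
        by (simp add: comp_def)
    qed (use inv_\<zeta> in auto)
    moreover have "Ck_on k (chart_map \<eta> ` (chart_dom ?\<zeta> \<inter> chart_dom \<eta>)) (chart_map ?\<zeta> \<circ> chart_inv \<eta>)" for k
    proof -
      have opn'': "open (chart_map \<eta> ` (W \<inter> chart_dom \<eta>))"
        using opn by (intro open_chart_image[OF \<eta>]) auto
      have "Ck_on k (chart_map \<eta> ` (chart_dom \<omega> \<inter> chart_dom \<eta>)) (chart_map \<omega> \<circ> chart_inv \<eta>)"
        using compat(2) by (simp add: smooth_on_def)
      then have "Ck_on k (chart_map \<eta> ` (W \<inter> chart_dom \<eta>)) (chart_map \<omega> \<circ> chart_inv \<eta>)"
        by (rule Ck_on_subset) (use W(2) in blast)
      moreover have "bounded_linear \<Phi>"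
        using \<Phi>(1) by (simp add: linear_conv_bounded_linear)
      ultimately show ?thesis
        using Ck_on_linear_compose[OF _ _ opn''] unfolding comp_def fst_conv snd_conv by blast
    qed
    ultimately show ?thesis
      by (auto simp: smooth_compat_def smooth_on_def)
  qed
  with \<zeta> show ?thesis
    by (simp add: smooth_charts_def)
qed

section \<open>The contact set of a potential\<close>

lemma has_derivative_eventually_small:
  assumes "(f has_derivative D) (at x)" "\<epsilon> > 0"
  shows "\<forall>\<^sub>F z in nhds x. norm (f z - f x - D (z - x)) \<le> \<epsilon> * norm (z - x)"
proof -
  obtain d where "d > 0" "\<And>z. norm (z - x) < d \<Longrightarrow> norm (f z - f x - D (z - x)) \<le> \<epsilon> * norm (z - x)"
    using assms unfolding has_derivative_at_alt by blast
  then show ?thesis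
    unfolding eventually_nhds_metric by (auto simp: dist_norm)
qed

text \<open>\<open>h\<close> and the quadratic term differ from their linear parts at
  \<open>v\<close> by an error of order smaller than \<open>norm (w - v)\<close>. So a first-order
  inequality for \<open>\<Psi> + h\<close> is one for the convex function with slope
  \<open>2 \<Lambda> v - g\<close>, and convexity extends it to the ball.\<close>

lemma frechet_subgradient_iff:
  fixes h \<Psi> :: "'e::euclidean_space \<Rightarrow> real"
  assumes F: "convex_on (ball v0 r) (\<lambda>v. \<Psi> v + \<Lambda> * norm v ^ 2)" and "\<Lambda> \<ge> 0" and v: "v \<in> ball v0 r"
    and h: "(h has_derivative (\<lambda>k. g \<bullet> k)) (at v)"
  shows "(\<forall>\<epsilon>>0. \<forall>\<^sub>F w in nhds v. \<Psi> v + h v - \<epsilon> * norm (w - v) \<le> \<Psi> w + h w) \<longleftrightarrow>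
    subgradient (ball v0 r) (\<lambda>v. \<Psi> v + \<Lambda> * norm v ^ 2) v ((2 * \<Lambda>) *\<^sub>R v - g)"
    (is "?L \<longleftrightarrow> subgradient ?B ?F v ?\<xi>")
proof
  have sq: "\<Lambda> * norm w ^ 2 = \<Lambda> * norm v ^ 2 + (2 * \<Lambda>) * (v \<bullet> (w - v)) + \<Lambda> * norm (w - v) ^ 2" for w
  proof -
    have eq: "norm w ^ 2 = norm v ^ 2 + 2 * (v \<bullet> (w - v)) + norm (w - v) ^ 2"
      unfolding power2_norm_eq_inner by (simp add: inner_diff_left inner_diff_right inner_commute)
    show ?thesis
      unfolding eq by (simp add: distrib_left)
  qed
  have \<xi>: "?\<xi> \<bullet> k = (2 * \<Lambda>) * (v \<bullet> k) - g \<bullet> k" for k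
    by (simp add: inner_diff_left)
  {
    assume L: ?L
    show "subgradient ?B ?F v ?\<xi>"
      unfolding subgradient_def
    proof
      fix z
      assume z: "z \<in> ?B"
      show "?F v + ?\<xi> \<bullet> (z - v) \<le> ?F z"
      proof (rule convex_on_directional_subgradient[OF F v z])
        fix \<epsilon> :: real
        assume "\<epsilon> > 0"
        \<comment> \<open>Half of \<open>\<epsilon>\<close> goes to the hypothesis and half to the
          remainder of \<open>h\<close>; the summand 1 covers \<open>z = v\<close>.\<close>
        define e where "e = \<epsilon> / (2 * (norm (z - v) + 1))"
        have "norm (z - v) + 1 > 0"
          using norm_ge_zero[of "z - v"] by linarith
        then have e: "e > 0" "2 * e * norm (z - v) \<le> \<epsilon>"
          using \<open>\<epsilon> > 0\<close> by (auto simp: e_def field_simps)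
        have "\<forall>\<^sub>F w in nhds v. ?F v + ?\<xi> \<bullet> (w - v) - 2 * e * norm (w - v) \<le> ?F w"
          using L[rule_format, OF e(1)] has_derivative_eventually_small[OF h e(1)]
        proof eventually_elim
          case (elim w)
          have "\<Lambda> * norm (w - v) ^ 2 \<ge> 0"
            using \<open>\<Lambda> \<ge> 0\<close> by simp
          with elim show ?case
            unfolding sq[of w] \<xi> real_norm_def by linarith
        qed
        moreover have "((\<lambda>t. v + t *\<^sub>R (z - v)) \<longlongrightarrow> v + 0 *\<^sub>R (z - v)) (at_right 0)"
          by (intro tendsto_intros)
        ultimately have "\<forall>\<^sub>F t in at_right 0. ?F v + ?\<xi> \<bullet> (t *\<^sub>R (z - v)) - 2 * e * norm (t *\<^sub>R (z - v)) \<le> ?F (v + t *\<^sub>R (z - v))"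
          by (auto dest: eventually_compose_filterlim)
        moreover have "\<forall>\<^sub>F t in at_right (0::real). t > 0"
          by (simp add: eventually_at_right_less)
        ultimately show "\<forall>\<^sub>F t in at_right 0. ?F v + t * (?\<xi> \<bullet> (z - v)) - \<epsilon> * t \<le> ?F (v + t *\<^sub>R (z - v))"
        proof eventually_elim
          case (elim t)
          have "2 * e * norm (t *\<^sub>R (z - v)) \<le> \<epsilon> * t"
            using mult_right_mono[OF e(2), of t] elim(2) by (simp add: ac_simps)
          with elim(1) show ?case
            by simp
        qed
      qed
    qed
  }
  assume sub: "subgradient ?B ?F v ?\<xi>"
  show ?L
  proof (intro allI impI)
    fix \<epsilon> :: real
    assume "\<epsilon> > 0"
    have "((\<lambda>w. \<Lambda> * norm (w - v)) \<longlongrightarrow> \<Lambda> * norm (v - v)) (nhds v)"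
      by (intro tendsto_intros filterlim_ident)
    then have "\<forall>\<^sub>F w in nhds v. \<Lambda> * norm (w - v) < \<epsilon> / 2"
      by (rule order_tendstoD(2)) (use \<open>\<epsilon> > 0\<close> in simp)
    moreover have "\<forall>\<^sub>F w in nhds v. w \<in> ?B"
      using v by (intro eventually_nhds_in_open) auto
    moreover have "\<forall>\<^sub>F w in nhds v. norm (h w - h v - g \<bullet> (w - v)) \<le> \<epsilon> / 2 * norm (w - v)"
      using \<open>\<epsilon> > 0\<close> by (intro has_derivative_eventually_small[OF h]) simp
    ultimately show "\<forall>\<^sub>F w in nhds v. \<Psi> v + h v - \<epsilon> * norm (w - v) \<le> \<Psi> w + h w"
    proof eventually_elim
      case (elim w)
      have "\<Lambda> * norm (w - v) ^ 2 \<le> \<epsilon> / 2 * norm (w - v)"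
        using mult_right_mono[OF less_imp_le[OF elim(1)], of "norm (w - v)"] by (simp add: power2_eq_square mult.assoc)
      moreover have "?F v + ?\<xi> \<bullet> (w - v) \<le> ?F w"
        using sub elim(2) by (simp add: subgradient_def)
      ultimately show ?case
        using elim(3) unfolding sq[of w] \<xi> real_norm_def by argo
    qed
  qed
qed

lemma chart_map_inv: "u \<in> chart_cod \<kappa> \<Longrightarrow> is_chart \<kappa> \<Longrightarrow> chart_map \<kappa> (chart_inv \<kappa> u) = u"
  and chart_inv_in_dom: "u \<in> chart_cod \<kappa> \<Longrightarrow> is_chart \<kappa> \<Longrightarrow> chart_inv \<kappa> u \<in> chart_dom \<kappa>"
  by (metis chart_inv_map imageE)+

lemma tendsto_chart_map:
  fixes \<eta> :: "('b::t2_space, 'e::euclidean_space) chart"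
  assumes "is_chart \<eta>" "y \<in> chart_dom \<eta>"
  shows "(chart_map \<eta> \<longlongrightarrow> chart_map \<eta> y) (nhds y)"
proof -
  have "isCont (chart_map \<eta>) y"
    using assms continuous_on_chart_map[OF assms(1)] continuous_on_eq_continuous_at[of "chart_dom \<eta>"]
    unfolding is_chart_def by blast
  then show ?thesis
    by (simp add: isCont_def tendsto_nhds_iff)
qed

lemma tendsto_chart_inv:
  assumes "is_chart \<eta>" "y \<in> chart_dom \<eta>"
  shows "(chart_inv \<eta> \<longlongrightarrow> y) (nhds (chart_map \<eta> y))"
proof -
  have "isCont (chart_inv \<eta>) (chart_map \<eta> y)"
    using assms continuous_on_chart_inv[OF assms(1)] continuous_on_eq_continuous_at[of "chart_cod \<eta>"]
    unfolding is_chart_def by blast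
  then have "(chart_inv \<eta> \<longlongrightarrow> chart_inv \<eta> (chart_map \<eta> y)) (nhds (chart_map \<eta> y))"
    by (simp only: isCont_def tendsto_at_iff_tendsto_nhds)
  then show ?thesis
    using assms by simp
qed

lemma eventually_nhds_chart_iff:
  fixes \<eta> :: "('b::t2_space, 'e::euclidean_space) chart"
  assumes "is_chart \<eta>" "y \<in> chart_dom \<eta>"
  shows "(\<forall>\<^sub>F z in nhds y. Q (chart_map \<eta> z) z) \<longleftrightarrow> (\<forall>\<^sub>F v in nhds (chart_map \<eta> y). Q v (chart_inv \<eta> v))"
proof
  assume "\<forall>\<^sub>F z in nhds y. Q (chart_map \<eta> z) z"
  then have "\<forall>\<^sub>F v in nhds (chart_map \<eta> y). Q (chart_map \<eta> (chart_inv \<eta> v)) (chart_inv \<eta> v)"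
    using eventually_compose_filterlim[OF _ tendsto_chart_inv[OF assms]] by fast
  moreover have "\<forall>\<^sub>F v in nhds (chart_map \<eta> y). v \<in> chart_cod \<eta>"
    using assms by (intro eventually_nhds_in_open) (auto simp: is_chart_def)
  ultimately show "\<forall>\<^sub>F v in nhds (chart_map \<eta> y). Q v (chart_inv \<eta> v)"
    by eventually_elim (simp add: chart_map_inv assms)
next
  assume "\<forall>\<^sub>F v in nhds (chart_map \<eta> y). Q v (chart_inv \<eta> v)"
  then have "\<forall>\<^sub>F z in nhds y. Q (chart_map \<eta> z) (chart_inv \<eta> (chart_map \<eta> z))"
    using eventually_compose_filterlim[OF _ tendsto_chart_map[OF assms]] by fast
  moreover have "\<forall>\<^sub>F z in nhds y. z \<in> chart_dom \<eta>"
    using assms by (intro eventually_nhds_in_open) (auto simp: is_chart_def)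
  ultimately show "\<forall>\<^sub>F z in nhds y. Q (chart_map \<eta> z) z"
    by eventually_elim (simp add: assms)
qed

text \<open>
  The condition says that \<open>0\<close> is a Frechet subgradient of \<open>\<psi> + c (x, \<cdot>)\<close> at \<open>y\<close>.  Being of first
  order, it does not depend on the chart.
\<close>

definition contact_set ::
  "('b::topological_space, 'e::euclidean_space) chart set \<Rightarrow> ('b \<Rightarrow> real) \<Rightarrow> ('a \<times> 'b \<Rightarrow> real) \<Rightarrow> ('a \<times> 'b) set" where
  "contact_set \<B> \<psi> c = {(x, y). \<exists>\<eta>\<in>\<B>. y \<in> chart_dom \<eta> \<and>
     (\<forall>\<epsilon>>0. \<forall>\<^sub>F z in nhds y. \<psi> y + c (x, y) - \<epsilon> * norm (chart_map \<eta> z - chart_map \<eta> y) \<le> \<psi> z + c (x, z))}"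

text \<open>Differentiability of the transition map at one point gives this, with the bound
  \<open>B\<close> of the derivative plus 1 for the remainder. The comparison makes the contact
  condition independent of the chart.\<close>

lemma smooth_atlas_transition_lipschitz_at:
  fixes \<B> :: "('b::t2_space, 'e::euclidean_space) chart set"
  assumes \<B>: "smooth_atlas \<B>" and \<eta>: "\<eta> \<in> \<B>" "\<eta>' \<in> \<B>" and y: "y \<in> chart_dom \<eta>" "y \<in> chart_dom \<eta>'"
  obtains C where "C > 0"
    "\<forall>\<^sub>F z in nhds y. norm (chart_map \<eta> z - chart_map \<eta> y) \<le> C * norm (chart_map \<eta>' z - chart_map \<eta>' y)"
proof -
  have charts: "is_chart \<eta>" "is_chart \<eta>'"
    using \<B> \<eta> by (auto simp: smooth_atlas_def)
  define \<theta> where "\<theta> = chart_map \<eta> \<circ> chart_inv \<eta>'"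
  have "Ck_on (Suc 0) (chart_map \<eta>' ` (chart_dom \<eta> \<inter> chart_dom \<eta>')) \<theta>"
    using \<B> \<eta> unfolding smooth_atlas_def smooth_compat_def smooth_on_def \<theta>_def by blast
  then have "\<theta> differentiable (at (chart_map \<eta>' y))"
    using y by auto
  then obtain D where D: "(\<theta> has_derivative D) (at (chart_map \<eta>' y))"
    by (auto simp: differentiable_def)
  obtain B where B: "B > 0" "\<And>k. norm (D k) \<le> B * norm k"
    using linear_bounded_pos[OF has_derivative_linear[OF D]] by blast
  have "\<forall>\<^sub>F v in nhds (chart_map \<eta>' y). norm (\<theta> v - \<theta> (chart_map \<eta>' y)) \<le> (B + 1) * norm (v - chart_map \<eta>' y)"
    using has_derivative_eventually_small[OF D zero_less_one]
  proof eventually_elim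
    case (elim v)
    then show ?case
      using norm_triangle_sub[of "\<theta> v - \<theta> (chart_map \<eta>' y)" "D (v - chart_map \<eta>' y)"] B(2)[of "v - chart_map \<eta>' y"]
      by (simp add: algebra_simps)
  qed
  then have "\<forall>\<^sub>F z in nhds y. norm (\<theta> (chart_map \<eta>' z) - \<theta> (chart_map \<eta>' y)) \<le> (B + 1) * norm (chart_map \<eta>' z - chart_map \<eta>' y)"
    using eventually_compose_filterlim[OF _ tendsto_chart_map[OF charts(2) y(2)]] by fast
  moreover have "\<forall>\<^sub>F z in nhds y. z \<in> chart_dom \<eta>'"
    using charts y by (intro eventually_nhds_in_open) (auto simp: is_chart_def)
  ultimately have "\<forall>\<^sub>F z in nhds y. norm (chart_map \<eta> z - chart_map \<eta> y) \<le> (B + 1) * norm (chart_map \<eta>' z - chart_map \<eta>' y)"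
    by eventually_elim (simp add: \<theta>_def charts y)
  then show ?thesis
    using that[of "B + 1"] B(1) by simp
qed

text \<open>The definition asks for some chart around \<open>y\<close>; here any chart serves. A
  change of chart multiplies distances to \<open>y\<close> by at most \<open>C\<close>, which is
  absorbed by passing from \<open>\<epsilon>\<close> to \<open>\<epsilon> / C\<close>.\<close>

lemma contact_set_chart_iff:
  fixes \<B> :: "('b::t2_space, 'e::euclidean_space) chart set"
  assumes \<B>: "smooth_atlas \<B>" and \<eta>: "\<eta> \<in> \<B>" "y \<in> chart_dom \<eta>"
  shows "(x, y) \<in> contact_set \<B> \<psi> c \<longleftrightarrow>
    (\<forall>\<epsilon>>0. \<forall>\<^sub>F v in nhds (chart_map \<eta> y). \<psi> y + c (x, y) - \<epsilon> * norm (v - chart_map \<eta> y)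
       \<le> \<psi> (chart_inv \<eta> v) + c (x, chart_inv \<eta> v))" (is "_ \<longleftrightarrow> ?rhs")
proof -
  have chart: "is_chart \<eta>"
    using \<B> \<eta> by (simp add: smooth_atlas_def)
  let ?P = "\<lambda>\<eta>. \<forall>\<epsilon>>0. \<forall>\<^sub>F z in nhds y. \<psi> y + c (x, y) - \<epsilon> * norm (chart_map \<eta> z - chart_map \<eta> y) \<le> \<psi> z + c (x, z)"
  have "?P \<eta>" if \<eta>': "\<eta>' \<in> \<B>" "y \<in> chart_dom \<eta>'" and P: "?P \<eta>'" for \<eta>'
  proof (intro allI impI)
    fix \<epsilon> :: real
    assume "\<epsilon> > 0"
    obtain C where C: "C > 0"
      "\<forall>\<^sub>F z in nhds y. norm (chart_map \<eta>' z - chart_map \<eta>' y) \<le> C * norm (chart_map \<eta> z - chart_map \<eta> y)"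
      using smooth_atlas_transition_lipschitz_at[OF \<B> \<eta>'(1) \<eta>(1) \<eta>'(2) \<eta>(2)] by blast
    from C(1) \<open>\<epsilon> > 0\<close> have "\<epsilon> / C > 0"
      by simp
    from C(2) P[rule_format, OF this]
    show "\<forall>\<^sub>F z in nhds y. \<psi> y + c (x, y) - \<epsilon> * norm (chart_map \<eta> z - chart_map \<eta> y) \<le> \<psi> z + c (x, z)"
    proof eventually_elim
      case (elim z)
      have "\<epsilon> / C * norm (chart_map \<eta>' z - chart_map \<eta>' y) \<le> \<epsilon> / C * (C * norm (chart_map \<eta> z - chart_map \<eta> y))"
        using elim(1) \<open>\<epsilon> / C > 0\<close> by (intro mult_left_mono) auto
      with elim(2) C(1) show ?case
        by simp
    qed
  qed
  then have "(x, y) \<in> contact_set \<B> \<psi> c \<longleftrightarrow> ?P \<eta>"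
    using \<eta> by (auto simp: contact_set_def)
  also have "\<dots> \<longleftrightarrow> ?rhs"
    using eventually_nhds_chart_iff[OF chart \<eta>(2), of "\<lambda>v z. \<psi> y + c (x, y) - \<epsilon> * norm (v - chart_map \<eta> y) \<le> \<psi> z + c (x, z)" for \<epsilon>]
    by simp
  finally show ?thesis .
qed

abbreviation coordinate_cost ::
  "('a, 'd) chart \<Rightarrow> ('b, 'e) chart \<Rightarrow> ('a \<times> 'b \<Rightarrow> real) \<Rightarrow> 'd \<times> 'e \<Rightarrow> real" where
  "coordinate_cost \<kappa> \<eta> c \<equiv> c \<circ> chart_inv (prod_chart \<kappa> \<eta>)"

lemma Ck_function_coordinate_cost:
  assumes "Ck_function k (prod_atlas \<A> \<B>) c" "\<kappa> \<in> \<A>" "\<eta> \<in> \<B>"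
  shows "Ck_on k (chart_cod \<kappa> \<times> chart_cod \<eta>) (coordinate_cost \<kappa> \<eta> c)"
  using assms prod_chart_in_prod_atlas[OF assms(2,3)] unfolding Ck_function_def chart_cod_prod_chart[symmetric] by blast

lemma Ck_function_continuous:
  fixes \<C> :: "('p::t2_space, 'e::euclidean_space) chart set"
  assumes "Ck_function (Suc k) \<C> c" "smooth_atlas \<C>"
  shows "continuous_on UNIV c"
  unfolding continuous_on_eq_continuous_at[OF open_UNIV]
proof
  fix z
  obtain \<omega> where \<omega>: "\<omega> \<in> \<C>" "z \<in> chart_dom \<omega>"
    using assms(2) unfolding smooth_atlas_def by (metis UN_E UNIV_I)
  have chart: "is_chart \<omega>"
    using assms(2) \<omega> by (simp add: smooth_atlas_def)
  have "continuous_on (chart_cod \<omega>) (c \<circ> chart_inv \<omega>)"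
    using assms(1) \<omega> unfolding Ck_function_def Ck_on.simps
    by (blast intro: differentiable_imp_continuous_on differentiable_at_imp_differentiable_on)
  then have "continuous_on (chart_dom \<omega>) ((c \<circ> chart_inv \<omega>) \<circ> chart_map \<omega>)"
    by (rule continuous_on_compose[OF continuous_on_chart_map[OF chart]])
  then have "continuous_on (chart_dom \<omega>) c"
    by (rule continuous_on_eq) (simp add: chart)
  then show "isCont c z"
    using chart \<omega> by (auto simp: is_chart_def continuous_on_eq_continuous_at)
qed

section \<open>Local semiconvexity and nondegeneracy\<close>

lemma convex_on_norm_square:
  fixes C :: "'e::real_inner set"
  assumes "convex C" "a \<ge> 0"
  shows "convex_on C (\<lambda>v. a * norm v ^ 2)"
proof (rule convex_on_tangent[OF assms(1)])
  fix y z :: 'e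
  have "norm z ^ 2 = norm y ^ 2 + 2 * (y \<bullet> (z - y)) + norm (z - y) ^ 2"
    unfolding power2_norm_eq_inner by (simp add: inner_diff_left inner_diff_right inner_commute)
  then have "norm y ^ 2 + 2 * (y \<bullet> (z - y)) \<le> norm z ^ 2"
    by simp
  from mult_left_mono[OF this assms(2)]
  show "a * norm y ^ 2 + ((2 * a) *\<^sub>R y) \<bullet> (z - y) \<le> a * norm z ^ 2"
    by (simp add: distrib_left)
qed

lemma convex_on_eq:
  assumes "convex_on S f" "\<And>x. x \<in> S \<Longrightarrow> f x = g x"
  shows "convex_on S g"
proof -
  have "convex S"
    by (rule convex_on_imp_convex[OF assms(1)])
  then show ?thesis
    using assms convexD[OF \<open>convex S\<close>] unfolding convex_on_def by metis
qed

text \<open>Each \<open>- c (x, \<cdot>)\<close> becomes convex in the chart after adding a multiple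
  of the squared norm, with constants that are locally uniform in \<open>x\<close>; compactness of
  \<open>X\<close> makes them uniform, and a supremum of convex functions is convex.\<close>

lemma sup_potential_semiconvex:
  fixes c :: "'a::topological_space \<times> 'b::t2_space \<Rightarrow> real"
    and \<A> :: "('a, 'd::euclidean_space) chart set" and \<B> :: "('b, 'e::euclidean_space) chart set"
  assumes \<A>: "smooth_atlas \<A>" and \<B>: "smooth_atlas \<B>" and c: "Ck_function 2 (prod_atlas \<A> \<B>) c"
    and X: "compact X" "fst ` R \<subseteq> X" and R: "R \<noteq> {}"
    and bdd: "\<And>y. bdd_above ((\<lambda>(x, t). t - c (x, y)) ` R)"
    and \<psi>: "\<And>y. \<psi> y = (SUP (x, t)\<in>R. t - c (x, y))"
    and \<eta>: "\<eta> \<in> \<B>" "y0 \<in> chart_dom \<eta>"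
  obtains r \<Lambda> where "r > 0" "\<Lambda> \<ge> 0" "ball (chart_map \<eta> y0) r \<subseteq> chart_cod \<eta>"
    "convex_on (ball (chart_map \<eta> y0) r) (\<lambda>v. \<psi> (chart_inv \<eta> v) + \<Lambda> * norm v ^ 2)"
proof -
  define v0 where "v0 = chart_map \<eta> y0"
  \<comment> \<open>A single integer encodes both the radius and the constant, and \<open>Q\<close>
    is monotone in it. \<open>O' n\<close>, the interior of the set where \<open>Q n\<close> holds,
    gives an open cover, and the largest index of a finite subcover works throughout
    \<open>X\<close>.\<close>
  define Q where "Q n x \<longleftrightarrow> ball v0 (1 / real (Suc n)) \<subseteq> chart_cod \<eta> \<and>
      convex_on (ball v0 (1 / real (Suc n))) (\<lambda>v. real n * norm v ^ 2 - c (x, chart_inv \<eta> v))" for n x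
  define O' where "O' n = \<Union>{U. open U \<and> (\<forall>x\<in>U. Q n x)}" for n
  have \<eta>_chart: "is_chart \<eta>"
    using \<B> \<eta> by (simp add: smooth_atlas_def)
  have Q_mono: "Q m x" if "Q n x" "n \<le> m" for n m x
  proof -
    have sub: "ball v0 (1 / real (Suc m)) \<subseteq> ball v0 (1 / real (Suc n))"
      using that(2) by (intro subset_ball) (simp add: field_simps)
    have "convex_on (ball v0 (1 / real (Suc m))) (\<lambda>v. (real m - real n) * norm v ^ 2)"
      using that(2) by (intro convex_on_norm_square) auto
    moreover have "convex_on (ball v0 (1 / real (Suc m))) (\<lambda>v. real n * norm v ^ 2 - c (x, chart_inv \<eta> v))"
      using that(1) sub by (auto simp: Q_def intro: convex_on_subset)
    ultimately have "convex_on (ball v0 (1 / real (Suc m)))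
        (\<lambda>v. (real m - real n) * norm v ^ 2 + (real n * norm v ^ 2 - c (x, chart_inv \<eta> v)))"
      by (rule convex_on_add)
    then have "convex_on (ball v0 (1 / real (Suc m))) (\<lambda>v. real m * norm v ^ 2 - c (x, chart_inv \<eta> v))"
      by (simp add: algebra_simps)
    then show ?thesis
      using that(1) sub unfolding Q_def by blast
  qed
  have "x \<in> \<Union> (range O')" for x
  proof -
    obtain \<kappa> where \<kappa>: "\<kappa> \<in> \<A>" "x \<in> chart_dom \<kappa>"
      using \<A> unfolding smooth_atlas_def by (metis UN_E UNIV_I)
    have \<kappa>_chart: "is_chart \<kappa>"
      using \<A> \<kappa> by (simp add: smooth_atlas_def)
    have opn: "open (chart_cod \<kappa> \<times> chart_cod \<eta>)"
      using \<kappa>_chart \<eta>_chart unfolding is_chart_def by (intro open_Times) blast+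
    have in_cod: "(chart_map \<kappa> x, v0) \<in> chart_cod \<kappa> \<times> chart_cod \<eta>"
      using \<kappa> \<eta> by (simp add: v0_def)
    obtain \<delta> \<Lambda> where \<delta>: "\<delta> > 0" "\<Lambda> \<ge> 0"
      and conv: "\<And>u. u \<in> ball (chart_map \<kappa> x) \<delta> \<Longrightarrow>
        convex_on (ball v0 \<delta>) (\<lambda>v. \<Lambda> * norm v ^ 2 - coordinate_cost \<kappa> \<eta> c (u, v))"
      using Ck_2_imp_semiconcave[OF Ck_function_coordinate_cost[OF c \<kappa>(1) \<eta>(1)] opn in_cod] by blast
    have "open (chart_cod \<eta>)"
      using \<eta>_chart unfolding is_chart_def by blast
    then obtain \<delta>' where \<delta>': "\<delta>' > 0" "ball v0 \<delta>' \<subseteq> chart_cod \<eta>"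
      using in_cod open_contains_ball by blast
    obtain n :: nat where n: "\<Lambda> \<le> n" "1 / real (Suc n) \<le> \<delta>" "1 / real (Suc n) \<le> \<delta>'"
    proof -
      obtain n1 n2 n3 :: nat where "\<Lambda> \<le> n1" "1 / \<delta> \<le> n2" "1 / \<delta>' \<le> n3"
        by (meson real_arch_simple)
      then have "\<Lambda> \<le> n1 + n2 + n3" "1 / \<delta> \<le> Suc (n1 + n2 + n3)" "1 / \<delta>' \<le> Suc (n1 + n2 + n3)"
        by auto
      then have "1 / real (Suc (n1 + n2 + n3)) \<le> \<delta>" "1 / real (Suc (n1 + n2 + n3)) \<le> \<delta>'"
        using \<delta>(1) \<delta>'(1) by (simp_all add: field_simps del: of_nat_Suc)
      with \<open>\<Lambda> \<le> n1 + n2 + n3\<close> show thesis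
        using that[of "n1 + n2 + n3"] by simp
    qed
    define U where "U = chart_dom \<kappa> \<inter> chart_map \<kappa> -` ball (chart_map \<kappa> x) \<delta>"
    have "open U"
      unfolding U_def by (rule open_chart_preimage[OF \<kappa>_chart]) simp
    moreover have "Q n x'" if "x' \<in> U" for x'
    proof -
      have u: "chart_map \<kappa> x' \<in> ball (chart_map \<kappa> x) \<delta>" "x' \<in> chart_dom \<kappa>"
        using that by (auto simp: U_def)
      have sub: "ball v0 (1 / real (Suc n)) \<subseteq> ball v0 \<delta>" "ball v0 (1 / real (Suc n)) \<subseteq> chart_cod \<eta>"
        using subset_ball[OF n(2), of v0] subset_ball[OF n(3), of v0] \<delta>'(2) by auto
      have "convex_on (ball v0 (1 / real (Suc n))) (\<lambda>v. \<Lambda> * norm v ^ 2 - coordinate_cost \<kappa> \<eta> c (chart_map \<kappa> x', v))"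
        by (rule convex_on_subset[OF conv[OF u(1)] sub(1) convex_ball])
      moreover have "convex_on (ball v0 (1 / real (Suc n))) (\<lambda>v. (real n - \<Lambda>) * norm v ^ 2)"
        using n(1) by (intro convex_on_norm_square) auto
      ultimately have "convex_on (ball v0 (1 / real (Suc n)))
          (\<lambda>v. (\<Lambda> * norm v ^ 2 - coordinate_cost \<kappa> \<eta> c (chart_map \<kappa> x', v)) + (real n - \<Lambda>) * norm v ^ 2)"
        by (rule convex_on_add)
      then have "convex_on (ball v0 (1 / real (Suc n))) (\<lambda>v. real n * norm v ^ 2 - c (x', chart_inv \<eta> v))"
        by (rule convex_on_eq)
          (use sub(2) u in \<open>auto simp: chart_inv_prod_chart \<kappa>_chart \<eta>_chart algebra_simps subset_eq\<close>)
      then show ?thesis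
        using sub(2) by (simp add: Q_def)
    qed
    moreover have "x \<in> U"
      using \<kappa> \<delta> by (simp add: U_def)
    ultimately have "x \<in> O' n"
      unfolding O'_def by blast
    then show ?thesis
      by blast
  qed
  then have cover: "X \<subseteq> \<Union> (range O')"
    by blast
  have "open (O' n)" for n
    unfolding O'_def by blast
  from compactE_image[OF X(1) this cover]
  obtain J where J: "finite J" "X \<subseteq> (\<Union>n\<in>J. O' n)"
    by metis
  define n where "n = Max (insert 0 J)"
  have Qn: "Q n x" if "x \<in> X" for x
  proof -
    obtain m where m: "m \<in> J" "x \<in> O' m"
      using J(2) \<open>x \<in> X\<close> by blast
    have "Q m x"
      using m(2) by (auto simp: O'_def)
    moreover have "m \<le> n"
      using m(1) J(1) by (simp add: n_def)
    ultimately show ?thesis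
      by (rule Q_mono)
  qed
  define B where "B = ball v0 (1 / real (Suc n))"
  obtain x1 t1 where x1: "(x1, t1) \<in> R"
    using R by auto
  then have "x1 \<in> X"
    using X(2) by force
  then have B: "B \<subseteq> chart_cod \<eta>"
    using Qn by (simp add: Q_def B_def)
  have "convex_on B (\<lambda>v. \<psi> (chart_inv \<eta> v) + real n * norm v ^ 2)"
  proof (rule convex_onI)
    fix s :: real and p q
    assume s: "0 < s" "s < 1" and pq: "p \<in> B" "q \<in> B"
    define w where "w = (1 - s) *\<^sub>R p + s *\<^sub>R q"
    have upper: "t - c (x, y) \<le> \<psi> y" if "(x, t) \<in> R" for x t y
      using cSUP_upper[OF that bdd[of y]] by (simp add: \<psi>)
    have "\<psi> (chart_inv \<eta> w) \<le> (1 - s) * (\<psi> (chart_inv \<eta> p) + real n * norm p ^ 2)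
        + s * (\<psi> (chart_inv \<eta> q) + real n * norm q ^ 2) - real n * norm w ^ 2"
      unfolding \<psi>[of "chart_inv \<eta> w"]
    proof (rule cSUP_least[OF R], clarify)
      fix x t
      assume xt: "(x, t) \<in> R"
      then have "x \<in> X"
        using X(2) by force
      then have "convex_on B (\<lambda>v. real n * norm v ^ 2 - c (x, chart_inv \<eta> v))"
        using Qn by (simp add: Q_def B_def)
      from convex_onD[OF this, of s p q] s pq
      have "real n * norm w ^ 2 - c (x, chart_inv \<eta> w) \<le>
          (1 - s) * (real n * norm p ^ 2 - c (x, chart_inv \<eta> p)) + s * (real n * norm q ^ 2 - c (x, chart_inv \<eta> q))"
        by (simp add: w_def)
      moreover have "(1 - s) * (t - c (x, chart_inv \<eta> p)) \<le> (1 - s) * \<psi> (chart_inv \<eta> p)"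
        "s * (t - c (x, chart_inv \<eta> q)) \<le> s * \<psi> (chart_inv \<eta> q)"
        using s upper[OF xt] by (auto intro: mult_left_mono)
      ultimately show "t - c (x, chart_inv \<eta> w) \<le> (1 - s) * (\<psi> (chart_inv \<eta> p) + real n * norm p ^ 2)
        + s * (\<psi> (chart_inv \<eta> q) + real n * norm q ^ 2) - real n * norm w ^ 2"
        by (simp add: algebra_simps)
    qed
    then show "\<psi> (chart_inv \<eta> ((1 - s) *\<^sub>R p + s *\<^sub>R q)) + real n * norm ((1 - s) *\<^sub>R p + s *\<^sub>R q) ^ 2
      \<le> (1 - s) * (\<psi> (chart_inv \<eta> p) + real n * norm p ^ 2) + s * (\<psi> (chart_inv \<eta> q) + real n * norm q ^ 2)"
      by (simp add: w_def)
  qed (simp add: B_def)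
  then show ?thesis
    using that[of "1 / real (Suc n)" "real n"] B by (simp add: B_def v0_def)
qed

section \<open>The mixed Hessian as a derivative of the partial gradient\<close>

lemma deriv_along_line:
  fixes f :: "'e::real_normed_vector \<Rightarrow> real"
  assumes "(f has_derivative D) (at p)"
  shows "deriv (\<lambda>t. f (p + t *\<^sub>R q)) 0 = D q"
proof (rule DERIV_imp_deriv)
  have "((\<lambda>t. f (p + t *\<^sub>R q)) has_derivative (\<lambda>t. D (t *\<^sub>R q))) (at 0)"
    by (rule has_derivative_compose[where f = "\<lambda>t. p + t *\<^sub>R q" and g = f])
      (auto intro!: derivative_eq_intros simp: assms)
  moreover have "(\<lambda>t. D (t *\<^sub>R q)) = (*) (D q)"
    by (rule ext) (simp add: linear_scale[OF has_derivative_linear[OF assms]])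
  ultimately show "((\<lambda>t. f (p + t *\<^sub>R q)) has_real_derivative D q) (at 0)"
    by (simp add: has_field_derivative_def)
qed

text \<open>\<open>deriv\<close> at 0 depends only on small parameters, for which the coordinate
  lines stay inside the codomains. Elsewhere \<open>chart_inv\<close> is unspecified, so the
  functions are compared by eventual equality near 0.\<close>

lemma mixed_hessian_eq:
  fixes \<kappa> :: "('a::topological_space, real ^ 'n) chart" and \<eta> :: "('b::topological_space, real ^ 'n) chart"
  assumes \<kappa>: "is_chart \<kappa>" "x \<in> chart_dom \<kappa>" and \<eta>: "is_chart \<eta>" "y \<in> chart_dom \<eta>"
    and f: "Ck_on 2 (chart_cod \<kappa> \<times> chart_cod \<eta>) (coordinate_cost \<kappa> \<eta> c)"
  shows "mixed_hessian \<kappa> \<eta> c x y $ i $ j =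
    partial_gradient_deriv (coordinate_cost \<kappa> \<eta> c) (chart_map \<kappa> x, chart_map \<eta> y) (axis i 1, 0) $ j"
proof -
  let ?f = "coordinate_cost \<kappa> \<eta> c"
  let ?g = "\<lambda>w. frechet_derivative ?f (at w) (0, axis j 1)"
  define u where "u = chart_map \<kappa> x"
  define v where "v = chart_map \<eta> y"
  have uv: "u \<in> chart_cod \<kappa>" "v \<in> chart_cod \<eta>"
    using \<kappa> \<eta> by (auto simp: u_def v_def)
  have opn: "open (chart_cod \<kappa>)" "open (chart_cod \<eta>)"
    using \<kappa> \<eta> unfolding is_chart_def by blast+
  have tend: "((\<lambda>t. p + t *\<^sub>R q) \<longlongrightarrow> p) (nhds (0::real))" for p q :: "real ^ 'n"
  proof -
    have "((\<lambda>t. p + t *\<^sub>R q) \<longlongrightarrow> p + 0 *\<^sub>R q) (nhds (0::real))"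
      by (intro tendsto_intros filterlim_ident)
    then show ?thesis
      by simp
  qed
  have ev_u: "\<forall>\<^sub>F s in nhds 0. u + s *\<^sub>R axis i 1 \<in> chart_cod \<kappa>"
    by (rule topological_tendstoD[OF tend opn(1) uv(1)])
  have ev_v: "\<forall>\<^sub>F t in nhds 0. v + t *\<^sub>R axis j 1 \<in> chart_cod \<eta>"
    by (rule topological_tendstoD[OF tend opn(2) uv(2)])
  have inner: "deriv (\<lambda>t. c (chart_inv \<kappa> u', chart_inv \<eta> (v + t *\<^sub>R axis j 1))) 0 = ?g (u', v)"
    if u': "u' \<in> chart_cod \<kappa>" for u'
  proof -
    have "\<forall>\<^sub>F t in nhds 0. c (chart_inv \<kappa> u', chart_inv \<eta> (v + t *\<^sub>R axis j 1)) = ?f ((u', v) + t *\<^sub>R (0, axis j 1))"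
      using ev_v by eventually_elim (simp add: chart_inv_prod_chart \<kappa> \<eta> u')
    then have "deriv (\<lambda>t. c (chart_inv \<kappa> u', chart_inv \<eta> (v + t *\<^sub>R axis j 1))) 0 = deriv (\<lambda>t. ?f ((u', v) + t *\<^sub>R (0, axis j 1))) 0"
      by (rule deriv_cong_ev) simp
    also have "\<dots> = ?g (u', v)"
    proof (rule deriv_along_line)
      have "?f differentiable at (u', v)"
        by (rule Ck_on_2D(1)[OF f]) (use u' uv in blast)
      then show "(?f has_derivative frechet_derivative ?f (at (u', v))) (at (u', v))"
        by (simp only: frechet_derivative_works)
    qed
    finally show ?thesis .
  qed
  have "mixed_hessian \<kappa> \<eta> c x y $ i $ j =
      deriv (\<lambda>s. deriv (\<lambda>t. c (chart_inv \<kappa> (u + s *\<^sub>R axis i 1), chart_inv \<eta> (v + t *\<^sub>R axis j 1))) 0) 0"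
    by (simp add: mixed_hessian_def u_def v_def)
  also have "\<dots> = deriv (\<lambda>s. ?g ((u, v) + s *\<^sub>R (axis i 1, 0))) 0"
  proof (rule deriv_cong_ev)
    show "\<forall>\<^sub>F s in nhds 0. deriv (\<lambda>t. c (chart_inv \<kappa> (u + s *\<^sub>R axis i 1), chart_inv \<eta> (v + t *\<^sub>R axis j 1))) 0
        = ?g ((u, v) + s *\<^sub>R (axis i 1, 0))"
      using ev_u by eventually_elim (simp add: inner)
  qed simp
  also have "\<dots> = frechet_derivative ?g (at (u, v)) (axis i 1, 0)"
  proof (rule deriv_along_line)
    have "?g differentiable at (u, v)"
      by (rule Ck_on_2D(2)[OF f]) (use uv in blast)
    then show "(?g has_derivative frechet_derivative ?g (at (u, v))) (at (u, v))"
      by (simp only: frechet_derivative_works)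
  qed
  also have "\<dots> = partial_gradient_deriv ?f (u, v) (axis i 1, 0) \<bullet> axis j 1"
    by (simp add: partial_gradient_deriv_def inner_sum_left inner_Basis if_distrib sum.delta axis_in_Basis_iff cong: if_cong)
  also have "\<dots> = partial_gradient_deriv ?f (u, v) (axis i 1, 0) $ j"
    by (simp add: inner_axis)
  finally show ?thesis
    by (simp add: u_def v_def)
qed

text \<open>Rows of the Hessian belong to directions in \<open>x\<close>, so the derivative acts on
  \<open>(u, 0)\<close> by the transposed matrix. Its trivial kernel is the injectivity that the
  resolvent argument asks of the linear part.\<close>

lemma mixed_hessian_injective:
  fixes \<kappa> :: "('a::topological_space, real ^ 'n) chart" and \<eta> :: "('b::topological_space, real ^ 'n) chart"
  assumes \<kappa>: "is_chart \<kappa>" "x \<in> chart_dom \<kappa>" and \<eta>: "is_chart \<eta>" "y \<in> chart_dom \<eta>"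
    and f: "Ck_on 2 (chart_cod \<kappa> \<times> chart_cod \<eta>) (coordinate_cost \<kappa> \<eta> c)"
    and det: "det (mixed_hessian \<kappa> \<eta> c x y) \<noteq> 0"
    and zero: "partial_gradient_deriv (coordinate_cost \<kappa> \<eta> c) (chart_map \<kappa> x, chart_map \<eta> y) (u, 0) = 0"
  shows "u = 0"
proof -
  let ?H = "mixed_hessian \<kappa> \<eta> c x y"
  let ?D = "partial_gradient_deriv (coordinate_cost \<kappa> \<eta> c) (chart_map \<kappa> x, chart_map \<eta> y)"
  have D: "linear ?D"
    using \<kappa> \<eta> by (intro has_derivative_linear[OF partial_gradient_has_derivative[OF f]]) simp
  have D0: "linear (\<lambda>u. ?D (u, 0))"
    by (rule linearI) (simp_all add: linear_add[OF D, symmetric] linear_scale[OF D, symmetric])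
  have "?D (u, 0) = (\<Sum>i\<in>UNIV. (u $ i) *\<^sub>R ?D (axis i 1, 0))"
    using linear_sum[OF D0, of "\<lambda>i. (u $ i) *\<^sub>R axis i 1" UNIV] basis_expansion[of u]
    by (simp add: linear_scale[OF D0] scalar_mult_eq_scaleR)
  then have "(\<Sum>i\<in>UNIV. u $ i * ?H $ i $ j) = 0" for j
    using zero by (simp add: mixed_hessian_eq[OF \<kappa> \<eta> f] vec_eq_iff)
  then have "transpose ?H *v u = 0"
    by (simp add: vec_eq_iff matrix_vector_mult_def transpose_def mult.commute)
  moreover have "invertible (transpose ?H)"
    using det by (simp add: invertible_det_nz)
  ultimately show ?thesis
    using matrix_left_invertible_ker[of "transpose ?H"] unfolding invertible_def by blast
qed

text \<open>The determinant is a polynomial in second derivatives that are continuous in the chart.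
  Openness matters because a submanifold must be a graph near each of its points, not only near the
  given one.\<close>

lemma open_nondegenerate:
  fixes \<kappa> :: "('a::topological_space, real ^ 'n) chart" and \<eta> :: "('b::topological_space, real ^ 'n) chart"
  assumes \<kappa>: "is_chart \<kappa>" and \<eta>: "is_chart \<eta>"
    and f: "Ck_on 2 (chart_cod \<kappa> \<times> chart_cod \<eta>) (coordinate_cost \<kappa> \<eta> c)"
  shows "open {(x, y). x \<in> chart_dom \<kappa> \<and> y \<in> chart_dom \<eta> \<and> det (mixed_hessian \<kappa> \<eta> c x y) \<noteq> 0}"
proof -
  let ?\<omega> = "prod_chart \<kappa> \<eta>"
  let ?D = "partial_gradient_deriv (coordinate_cost \<kappa> \<eta> c)"
  define G where "G w = det (\<chi> i j. ?D w (axis i 1, 0) $ j)" for w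
  have \<omega>: "is_chart ?\<omega>"
    using \<kappa> \<eta> by (rule is_chart_prod_chart)
  have "continuous_on (chart_cod \<kappa> \<times> chart_cod \<eta>) G"
    unfolding G_def[abs_def] det_def
    by (auto intro!: continuous_intros continuous_on_partial_gradient_deriv[OF f])
  then have "continuous_on (chart_cod ?\<omega>) G"
    by (simp only: chart_cod_prod_chart)
  then have "continuous_on (chart_dom ?\<omega>) (G \<circ> chart_map ?\<omega>)"
    by (rule continuous_on_compose[OF continuous_on_chart_map[OF \<omega>]])
  moreover have "open (chart_dom ?\<omega>)"
    using \<omega> unfolding is_chart_def by blast
  ultimately have "open (chart_dom ?\<omega> \<inter> (G \<circ> chart_map ?\<omega>) -` (- {0}))"
    by (intro continuous_open_preimage) auto
  moreover have "G (chart_map \<kappa> x, chart_map \<eta> y) = det (mixed_hessian \<kappa> \<eta> c x y)"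
    if "x \<in> chart_dom \<kappa>" "y \<in> chart_dom \<eta>" for x y
    unfolding G_def by (rule arg_cong[where f = det]) (simp add: vec_eq_iff mixed_hessian_eq[OF \<kappa> that(1) \<eta> that(2) f])
  then have "chart_dom ?\<omega> \<inter> (G \<circ> chart_map ?\<omega>) -` (- {0})
      = {(x, y). x \<in> chart_dom \<kappa> \<and> y \<in> chart_dom \<eta> \<and> det (mixed_hessian \<kappa> \<eta> c x y) \<noteq> 0}"
    by auto
  ultimately show ?thesis
    by simp
qed

section \<open>The contact set as a Lipschitz submanifold\<close>

definition locally_semiconvex ::
  "('b::topological_space, 'e::euclidean_space) chart set \<Rightarrow> ('b \<Rightarrow> real) \<Rightarrow> bool" where
  "locally_semiconvex \<B> \<psi> \<longleftrightarrow> (\<forall>\<eta>\<in>\<B>. \<forall>y\<in>chart_dom \<eta>. \<exists>r>0. \<exists>\<Lambda>\<ge>0. ball (chart_map \<eta> y) r \<subseteq> chart_cod \<eta> \<and>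
     convex_on (ball (chart_map \<eta> y) r) (\<lambda>v. \<psi> (chart_inv \<eta> v) + \<Lambda> * norm v ^ 2))"

text \<open>In a product chart the contact set becomes the subgradient relation of a convex
  function. That \<open>chart_dom \<zeta>\<close> fits into \<open>N\<close> ensures that
  intersecting the contact set with \<open>N\<close> changes nothing inside the chart.\<close>

lemma contact_set_local_graph:
  fixes \<A> :: "('a::topological_space, real ^ 'n) chart set" and \<B> :: "('b::t2_space, real ^ 'n) chart set"
  assumes \<A>: "smooth_atlas \<A>" and \<B>: "smooth_atlas \<B>" and c: "Ck_function 2 (prod_atlas \<A> \<B>) c"
    and \<psi>: "locally_semiconvex \<B> \<psi>" and xy: "(x, y) \<in> contact_set \<B> \<psi> c"
    and nondeg: "nondegenerate_at \<A> \<B> c x y" and N: "open N" "(x, y) \<in> N"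
  obtains \<zeta> D f L where "\<zeta> \<in> smooth_charts (prod_atlas \<A> \<B>)" "(x, y) \<in> chart_dom \<zeta>" "chart_dom \<zeta> \<subseteq> N"
    "open D" "L-lipschitz_on D f" "chart_map \<zeta> ` (contact_set \<B> \<psi> c \<inter> chart_dom \<zeta>) = {(u, f u) |u. u \<in> D}"
proof -
  obtain \<kappa> \<eta> where \<kappa>: "\<kappa> \<in> \<A>" "x \<in> chart_dom \<kappa>" and \<eta>: "\<eta> \<in> \<B>" "y \<in> chart_dom \<eta>"
    and det: "det (mixed_hessian \<kappa> \<eta> c x y) \<noteq> 0"
    using nondeg by (auto simp: nondegenerate_at_def)
  have charts: "is_chart \<kappa>" "is_chart \<eta>"
    using \<A> \<B> \<kappa> \<eta> by (auto simp: smooth_atlas_def)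
  define \<omega> where "\<omega> = prod_chart \<kappa> \<eta>"
  have \<omega>: "is_chart \<omega>" "\<omega> \<in> prod_atlas \<A> \<B>"
    using is_chart_prod_chart[OF charts] prod_chart_in_prod_atlas[OF \<kappa>(1) \<eta>(1)] by (auto simp: \<omega>_def)
  define u0 where "u0 = chart_map \<kappa> x"
  define v0 where "v0 = chart_map \<eta> y"
  define S where "S = chart_cod \<kappa> \<times> chart_cod \<eta>"
  let ?f = "coordinate_cost \<kappa> \<eta> c"
  have f: "Ck_on 2 S ?f"
    unfolding S_def by (rule Ck_function_coordinate_cost[OF c \<kappa>(1) \<eta>(1)])
  have opn: "open (chart_cod \<eta>)" "open S"
    using charts unfolding S_def is_chart_def by (blast intro: open_Times)+
  have z0: "(u0, v0) \<in> S"
    using \<kappa> \<eta> by (simp add: S_def u0_def v0_def)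
  obtain r \<Lambda> where r: "r > 0" "ball v0 r \<subseteq> chart_cod \<eta>" and \<Lambda>: "\<Lambda> \<ge> 0"
    and F: "convex_on (ball v0 r) (\<lambda>v. \<psi> (chart_inv \<eta> v) + \<Lambda> * norm v ^ 2)"
    using \<psi> \<eta> unfolding locally_semiconvex_def v0_def by blast
  let ?F = "\<lambda>v. \<psi> (chart_inv \<eta> v) + \<Lambda> * norm v ^ 2"
  define P where "P w = (2 * \<Lambda>) *\<^sub>R snd w - partial_gradient ?f w" for w
  define P' where "P' w h = (2 * \<Lambda>) *\<^sub>R snd h - partial_gradient_deriv ?f w h" for w h

  have contact_iff: "(chart_inv \<kappa> u, chart_inv \<eta> v) \<in> contact_set \<B> \<psi> c \<longleftrightarrow> subgradient (ball v0 r) ?F v (P (u, v))"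
    if uv: "u \<in> chart_cod \<kappa>" "v \<in> ball v0 r" for u v
  proof -
    have v: "v \<in> chart_cod \<eta>"
      using uv r by blast
    have "((\<lambda>v. ?f (u, v)) has_derivative (\<lambda>k. partial_gradient ?f (u, v) \<bullet> k)) (at v)"
      using uv v by (intro has_derivative_partial_gradient[OF f]) (simp add: S_def)
    then have "((\<lambda>v. c (chart_inv \<kappa> u, chart_inv \<eta> v)) has_derivative (\<lambda>k. partial_gradient ?f (u, v) \<bullet> k)) (at v)"
      by (rule has_derivative_transform_within_open[OF _ opn(1) v])
        (simp add: chart_inv_prod_chart[OF charts uv(1)])
    from frechet_subgradient_iff[OF F \<Lambda> uv(2) this]
    show ?thesis
      using contact_set_chart_iff[OF \<B> \<eta>(1) chart_inv_in_dom[OF v charts(2)], of "chart_inv \<kappa> u" \<psi> c]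
      by (simp add: chart_map_inv[OF v charts(2)] P_def)
  qed

  have P_deriv: "(P has_derivative P' w) (at w)" if "w \<in> S" for w
    unfolding P_def[abs_def] P'_def[abs_def]
    by (intro has_derivative_diff has_derivative_scaleR_right has_derivative_snd has_derivative_ident
        partial_gradient_has_derivative[OF f that])
  have P_cont: "continuous_on S (\<lambda>w. P' w h)" for h
    unfolding P'_def by (intro continuous_intros continuous_on_partial_gradient_deriv[OF f])
  have strict: "\<exists>\<delta>>0. \<forall>z\<in>ball (u0, v0) \<delta>. \<forall>z'\<in>ball (u0, v0) \<delta>. norm (P z - P z' - P' (u0, v0) (z - z')) \<le> \<epsilon> * norm (z - z')"
    if "\<epsilon> > 0" for \<epsilon>
    using continuous_derivative_imp_strict[OF opn(2) z0 P_deriv P_cont that] by metis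
  \<comment> \<open>The quadratic correction contributes nothing in the directions
    \<open>(u, 0)\<close>, where \<open>P'\<close> is minus the action of the mixed Hessian.\<close>
  have inj: "u = 0" if "P' (u0, v0) (u, 0) = 0" for u
    using that mixed_hessian_injective[OF charts(1) \<kappa>(2) charts(2) \<eta>(2) f[unfolded S_def] det, of u]
    by (simp add: P'_def u0_def v0_def)
  have sub0: "subgradient (ball v0 r) ?F v0 (P (u0, v0))"
    using contact_iff[of u0 v0] xy r \<kappa> \<eta> charts by (simp add: u0_def v0_def)
  \<comment> \<open>The second factor keeps \<open>v\<close> where \<open>F\<close> is convex, so
    that \<open>contact_iff\<close> covers all points of the new chart.\<close>
  define N' where "N' = chart_map \<omega> ` (N \<inter> chart_dom \<omega>) \<inter> UNIV \<times> ball v0 r"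
  have "open (N \<inter> chart_dom \<omega>)"
    using N(1) \<omega>(1) unfolding is_chart_def by blast
  then have "open (chart_map \<omega> ` (N \<inter> chart_dom \<omega>))"
    by (rule open_chart_image[OF \<omega>(1)]) simp
  then have N': "open N'"
    unfolding N'_def by (intro open_Int open_Times) auto
  have "(x, y) \<in> N \<inter> chart_dom \<omega>"
    using N \<kappa> \<eta> by (simp add: \<omega>_def)
  then have z0_N': "(u0, v0) \<in> N'"
    using r by (force simp: N'_def \<omega>_def u0_def v0_def)
  obtain \<Phi> :: "(real ^ 'n) \<times> (real ^ 'n) \<Rightarrow> (real ^ 'n) \<times> (real ^ 'n)" and W D g L
    where \<Phi>: "linear \<Phi>" "inj \<Phi>" and W: "open W" "(u0, v0) \<in> W" "W \<subseteq> N'"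
      and D: "open D" "L-lipschitz_on D g"
      and graph: "\<Phi> ` {(u, v) \<in> W. v \<in> ball v0 r \<and> subgradient (ball v0 r) ?F v (P (u, v))} = {(u, g u) |u. u \<in> D}"
    by (rule subgradient_relation_lipschitz_graph[OF F sub0 r(1) has_derivative_linear[OF P_deriv[OF z0]] inj strict N' z0_N'])
  define M where "M = chart_dom \<omega> \<inter> chart_map \<omega> -` W"
  have "open M"
    unfolding M_def by (rule open_chart_preimage[OF \<omega>(1) W(1)])
  then have \<zeta>: "(M, \<Phi> \<circ> chart_map \<omega>) \<in> smooth_charts (prod_atlas \<A> \<B>)"
    using linear_rechart[OF smooth_atlas_prod_atlas[OF \<A> \<B>] \<omega>(2) \<Phi>] by (simp add: M_def)
  have "(x, y) \<in> M"
    using W(2) \<kappa> \<eta> by (simp add: M_def \<omega>_def u0_def v0_def)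
  moreover have "M \<subseteq> N"
  proof
    fix p
    assume "p \<in> M"
    then obtain q where "q \<in> N" "q \<in> chart_dom \<omega>" "chart_map \<omega> p = chart_map \<omega> q" "p \<in> chart_dom \<omega>"
      using W(3) by (auto simp: M_def N'_def)
    then show "p \<in> N"
      using chart_inj_on[OF \<omega>(1)] by (metis inj_onD)
  qed
  moreover have "chart_map \<omega> ` (contact_set \<B> \<psi> c \<inter> M)
      = {(u, v) \<in> W. v \<in> ball v0 r \<and> subgradient (ball v0 r) ?F v (P (u, v))}" (is "?L = ?R")
  proof
    show "?L \<subseteq> ?R"
    proof (rule image_subsetI)
      fix p
      assume p: "p \<in> contact_set \<B> \<psi> c \<inter> M"
      obtain x' y' where p_eq: "p = (x', y')"
        by force
      have dom: "x' \<in> chart_dom \<kappa>" "y' \<in> chart_dom \<eta>" and inW: "(chart_map \<kappa> x', chart_map \<eta> y') \<in> W"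
        using p by (auto simp: M_def \<omega>_def p_eq)
      moreover have "chart_map \<eta> y' \<in> ball v0 r"
        using inW W(3) by (auto simp: N'_def)
      ultimately show "chart_map \<omega> p \<in> ?R"
        using contact_iff[of "chart_map \<kappa> x'" "chart_map \<eta> y'"] p charts by (simp add: \<omega>_def p_eq)
    qed
    show "?R \<subseteq> ?L"
    proof
      fix q
      assume q: "q \<in> ?R"
      obtain u v where q_eq: "q = (u, v)"
        by force
      have "q \<in> chart_cod \<omega>"
        using q W(3) by (auto simp: N'_def)
      then have cod: "u \<in> chart_cod \<kappa>" "v \<in> chart_cod \<eta>"
        by (auto simp: \<omega>_def q_eq)
      then have "(chart_inv \<kappa> u, chart_inv \<eta> v) \<in> contact_set \<B> \<psi> c"
        using contact_iff[of u v] q by (simp add: q_eq)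
      moreover have map: "chart_map \<omega> (chart_inv \<kappa> u, chart_inv \<eta> v) = q"
        by (simp add: \<omega>_def q_eq chart_map_inv cod charts)
      moreover have "(chart_inv \<kappa> u, chart_inv \<eta> v) \<in> M"
        using map q chart_inv_in_dom[OF cod(1) charts(1)] chart_inv_in_dom[OF cod(2) charts(2)]
        unfolding M_def by (auto simp: \<omega>_def)
      ultimately show "q \<in> ?L"
        by (metis IntI imageI)
    qed
  qed
  then have "chart_map (M, \<Phi> \<circ> chart_map \<omega>) ` (contact_set \<B> \<psi> c \<inter> chart_dom (M, \<Phi> \<circ> chart_map \<omega>)) = {(u, g u) |u. u \<in> D}"
    using graph by (simp only: fst_conv snd_conv image_comp[symmetric])
  ultimately show ?thesis
    using that[OF \<zeta> _ _ D] by simp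
qed

text \<open>The parameter \<open>N\<close> serves both claims: for the local one it is the set where
  a Hessian determinant in fixed charts is nonzero, for the global one it is
  \<open>UNIV\<close>.\<close>

lemma contact_set_lipschitz_submanifold:
  fixes \<A> :: "('a::topological_space, real ^ 'n) chart set" and \<B> :: "('b::t2_space, real ^ 'n) chart set"
  assumes "smooth_atlas \<A>" "smooth_atlas \<B>" "Ck_function 2 (prod_atlas \<A> \<B>) c" "locally_semiconvex \<B> \<psi>"
    and N: "open N" and nondeg: "\<And>x y. (x, y) \<in> N \<Longrightarrow> nondegenerate_at \<A> \<B> c x y"
  shows "lipschitz_submanifold (prod_atlas \<A> \<B>) (contact_set \<B> \<psi> c \<inter> N)"
  unfolding lipschitz_submanifold_def
proof
  fix p
  assume p: "p \<in> contact_set \<B> \<psi> c \<inter> N"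
  obtain x y where p_eq: "p = (x, y)"
    by force
  have xy: "(x, y) \<in> contact_set \<B> \<psi> c" "(x, y) \<in> N"
    using p by (auto simp: p_eq)
  obtain \<zeta> D f L where \<zeta>: "\<zeta> \<in> smooth_charts (prod_atlas \<A> \<B>)" "(x, y) \<in> chart_dom \<zeta>" "chart_dom \<zeta> \<subseteq> N"
    and D: "open D" "L-lipschitz_on D f"
    and graph: "chart_map \<zeta> ` (contact_set \<B> \<psi> c \<inter> chart_dom \<zeta>) = {(u, f u) |u. u \<in> D}"
    by (rule contact_set_local_graph[OF assms(1-4) xy(1) nondeg[OF xy(2)] N xy(2)])
  have eq: "contact_set \<B> \<psi> c \<inter> N \<inter> chart_dom \<zeta> = contact_set \<B> \<psi> c \<inter> chart_dom \<zeta>"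
    using \<zeta>(3) by blast
  show "\<exists>\<zeta>\<in>smooth_charts (prod_atlas \<A> \<B>). p \<in> chart_dom \<zeta> \<and>
        (\<exists>D f L. open D \<and> L-lipschitz_on D f \<and>
           chart_map \<zeta> ` (contact_set \<B> \<psi> c \<inter> N \<inter> chart_dom \<zeta>) = {(u, f u) |u. u \<in> D})"
  proof (intro bexI conjI exI)
    show "chart_map \<zeta> ` (contact_set \<B> \<psi> c \<inter> N \<inter> chart_dom \<zeta>) = {(u, f u) |u. u \<in> D}"
      unfolding eq by (fact graph)
  qed (use \<zeta> D p_eq in auto)
qed

theorem theorem1p2:
  fixes \<A> :: "('a::{t2_space, second_countable_topology}, real ^ 'n) chart set"
    and \<B> :: "('b::{t2_space, second_countable_topology}, real ^ 'n) chart set"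
    and c :: "'a \<times> 'b \<Rightarrow> real"
    and \<mu> :: "'a measure" and \<nu> :: "'b measure" and \<gamma> :: "('a \<times> 'b) measure"
  assumes "smooth_atlas \<A>" and "smooth_atlas \<B>"
    and "Ck_function 2 (prod_atlas \<A> \<B>) c"
    and "borel_prob \<mu>" and "compact (spt \<mu>)"
    and "borel_prob \<nu>" and "compact (spt \<nu>)"
    and "kantorovich_solution c \<mu> \<nu> \<gamma>"
  shows "(\<forall>x\<^sub>0 y\<^sub>0. (x\<^sub>0, y\<^sub>0) \<in> spt \<gamma> \<and> nondegenerate_at \<A> \<B> c x\<^sub>0 y\<^sub>0 \<longrightarrow>
            (\<exists>N S. open N \<and> (x\<^sub>0, y\<^sub>0) \<in> N \<and>
                   lipschitz_submanifold (prod_atlas \<A> \<B>) S \<and> N \<inter> spt \<gamma> \<subseteq> S))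
       \<and> ((\<forall>x y. nondegenerate_at \<A> \<B> c x y) \<longrightarrow>
            (\<exists>S. lipschitz_submanifold (prod_atlas \<A> \<B>) S \<and> spt \<gamma> \<subseteq> S))"
proof (cases "spt \<gamma> = {}")
  case True
  then show ?thesis
    by (auto simp: lipschitz_submanifold_def intro!: exI[of _ "{}"])
next
  case False
  have c_cont: "continuous_on UNIV c"
    using Ck_function_continuous[OF _ smooth_atlas_prod_atlas[OF assms(1,2)], of 1 c] assms(3)
    by (simp add: numeral_2_eq_2)
  have mono: "cyclically_monotone c (spt \<gamma>)"
    by (rule kantorovich_solution_cyclically_monotone[OF c_cont assms(4-8)])
  have sub: "fst ` spt \<gamma> \<subseteq> spt \<mu>"
    using has_marginals_spt(2)[OF _ assms(4,6)] assms(8) unfolding kantorovich_solution_def by fastforce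
  obtain R \<psi> where R: "R \<noteq> {}" "fst ` R \<subseteq> spt \<mu>" "\<forall>y. bdd_above ((\<lambda>(x, t). t - c (x, y)) ` R)"
    and \<psi>: "\<forall>y. \<psi> y = (SUP (x, t)\<in>R. t - c (x, y))"
    and le: "\<forall>x y y'. (x, y) \<in> spt \<gamma> \<longrightarrow> \<psi> y + c (x, y) \<le> \<psi> y' + c (x, y')"
    by (rule cyclically_monotone_potential[OF mono False assms(5) sub c_cont])
  have semiconvex: "locally_semiconvex \<B> \<psi>"
    unfolding locally_semiconvex_def
  proof (intro ballI)
    fix \<eta> y
    assume \<eta>: "\<eta> \<in> \<B>" "y \<in> chart_dom \<eta>"
    obtain r \<Lambda> where "r > 0" "\<Lambda> \<ge> 0" "ball (chart_map \<eta> y) r \<subseteq> chart_cod \<eta>"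
      "convex_on (ball (chart_map \<eta> y) r) (\<lambda>v. \<psi> (chart_inv \<eta> v) + \<Lambda> * norm v ^ 2)"
      by (rule sup_potential_semiconvex[OF assms(1-3,5) R(2,1) R(3)[rule_format] \<psi>[rule_format] \<eta>])
    then show "\<exists>r>0. \<exists>\<Lambda>\<ge>0. ball (chart_map \<eta> y) r \<subseteq> chart_cod \<eta> \<and>
        convex_on (ball (chart_map \<eta> y) r) (\<lambda>v. \<psi> (chart_inv \<eta> v) + \<Lambda> * norm v ^ 2)"
      by blast
  qed
  \<comment> \<open>On the support \<open>y\<close> is a global minimizer of
    \<open>\<psi> + c (x, \<cdot>)\<close>, so the first-order condition holds there for every error
    term.\<close>
  have spt_contact: "spt \<gamma> \<subseteq> contact_set \<B> \<psi> c"
  proof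
    fix p
    assume p: "p \<in> spt \<gamma>"
    obtain x y where p_eq: "p = (x, y)"
      by force
    obtain \<eta> where \<eta>: "\<eta> \<in> \<B>" "y \<in> chart_dom \<eta>"
      using assms(2) unfolding smooth_atlas_def by (metis UN_E UNIV_I)
    have "\<psi> y + c (x, y) - \<epsilon> * norm (v - chart_map \<eta> y) \<le> \<psi> (chart_inv \<eta> v) + c (x, chart_inv \<eta> v)"
      if "\<epsilon> > 0" for \<epsilon> v
    proof -
      have "\<psi> y + c (x, y) \<le> \<psi> (chart_inv \<eta> v) + c (x, chart_inv \<eta> v)"
        using le p p_eq by blast
      moreover have "\<epsilon> * norm (v - chart_map \<eta> y) \<ge> 0"
        using that by simp
      ultimately show ?thesis
        by linarith
    qed
    then show "p \<in> contact_set \<B> \<psi> c"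
      unfolding p_eq contact_set_chart_iff[OF assms(2) \<eta>] by (intro allI impI always_eventually) auto
  qed
  note submanifold = contact_set_lipschitz_submanifold[OF assms(1-3) semiconvex]
  show ?thesis
  proof (intro conjI allI impI)
    fix x0 y0
    assume "(x0, y0) \<in> spt \<gamma> \<and> nondegenerate_at \<A> \<B> c x0 y0"
    then obtain \<kappa> \<eta> where \<kappa>: "\<kappa> \<in> \<A>" "x0 \<in> chart_dom \<kappa>" and \<eta>: "\<eta> \<in> \<B>" "y0 \<in> chart_dom \<eta>"
      and det: "det (mixed_hessian \<kappa> \<eta> c x0 y0) \<noteq> 0"
      by (auto simp: nondegenerate_at_def)
    define N where "N = {(x, y). x \<in> chart_dom \<kappa> \<and> y \<in> chart_dom \<eta> \<and> det (mixed_hessian \<kappa> \<eta> c x y) \<noteq> 0}"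
    have "is_chart \<kappa>" "is_chart \<eta>"
      using assms(1,2) \<kappa> \<eta> by (auto simp: smooth_atlas_def)
    from open_nondegenerate[OF this Ck_function_coordinate_cost[OF assms(3) \<kappa>(1) \<eta>(1)]]
    have N: "open N"
      by (simp add: N_def)
    have "(x0, y0) \<in> N"
      using \<kappa> \<eta> det by (simp add: N_def)
    moreover have "lipschitz_submanifold (prod_atlas \<A> \<B>) (contact_set \<B> \<psi> c \<inter> N)"
      using \<kappa>(1) \<eta>(1) by (intro submanifold N) (auto simp: N_def nondegenerate_at_def)
    ultimately show "\<exists>N S. open N \<and> (x0, y0) \<in> N \<and> lipschitz_submanifold (prod_atlas \<A> \<B>) S \<and> N \<inter> spt \<gamma> \<subseteq> S"
      using N spt_contact by blast
  next
    assume "\<forall>x y. nondegenerate_at \<A> \<B> c x y"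
    then have "lipschitz_submanifold (prod_atlas \<A> \<B>) (contact_set \<B> \<psi> c \<inter> UNIV)"
      by (intro submanifold) auto
    then show "\<exists>S. lipschitz_submanifold (prod_atlas \<A> \<B>) S \<and> spt \<gamma> \<subseteq> S"
      using spt_contact by auto
  qed
qed

end
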